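(* Extension Roman Hitting Function, parameterized by $\kappa_1=|\{i\in I : \tau^{-1}(i)=\emptyset\}|$, is W[1]-hard.
   Context: A hypergraph is $H=(X,(s_i)_{i\in I})$ with finite $X$, finite index set $I$, $s_i\subseteq X$ (repetitions allowed). A correspondence is a map $\tau:X\to I$ with $x\in s_{\tau(x)}$ for all $x$. A function $g:X\to\{0,1,2\}$ is a Roman hitting function (rhf) if for every $i\in I$ there is $x\in s_i$ with $g(x)=2$ or there is $x$ with $\tau(x)=i$ and $g(x)=1$. Functions are ordered pointwise; an rhf $g$ is minimal if every rhf $h\le g$ equals $g$. Extension Roman Hitting Function: given $H$, $\tau$ and $f:X\to\{0,1,2\}$, decide whether there is a minimal rhf $g$ with $f\le g$. *)

theory Defs
  imports Main "HOL-Library.FuncSet"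
begin

section \<open>Roman hitting functions\<close>

definition hypergraph :: "'a set \<Rightarrow> 'i set \<Rightarrow> ('i \<Rightarrow> 'a set) \<Rightarrow> bool" where
  "hypergraph X I s \<longleftrightarrow> finite X \<and> finite I \<and> (\<forall>i\<in>I. s i \<subseteq> X)"

definition correspondence :: "'a set \<Rightarrow> 'i set \<Rightarrow> ('i \<Rightarrow> 'a set) \<Rightarrow> ('a \<Rightarrow> 'i) \<Rightarrow> bool" where
  "correspondence X I s \<tau> \<longleftrightarrow> \<tau> \<in> X \<rightarrow> I \<and> (\<forall>x\<in>X. x \<in> s (\<tau> x))"

definition rhf ::
    "'a set \<Rightarrow> 'i set \<Rightarrow> ('i \<Rightarrow> 'a set) \<Rightarrow> ('a \<Rightarrow> 'i) \<Rightarrow> ('a \<Rightarrow> nat) \<Rightarrow> bool" where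
  "rhf X I s \<tau> g \<longleftrightarrow> g \<in> X \<rightarrow> {0, 1, 2} \<and>
     (\<forall>i\<in>I. (\<exists>x\<in>s i. g x = 2) \<or> (\<exists>x\<in>X. \<tau> x = i \<and> g x = 1))"

text \<open>Functions on \<open>X\<close> are total functions whose values outside \<open>X\<close> are irrelevant, so order
  and equality of functions are taken on \<open>X\<close>.\<close>

definition minimal_rhf ::
    "'a set \<Rightarrow> 'i set \<Rightarrow> ('i \<Rightarrow> 'a set) \<Rightarrow> ('a \<Rightarrow> 'i) \<Rightarrow> ('a \<Rightarrow> nat) \<Rightarrow> bool" where
  "minimal_rhf X I s \<tau> g \<longleftrightarrow> rhf X I s \<tau> g \<and>
     (\<forall>h. rhf X I s \<tau> h \<and> (\<forall>x\<in>X. h x \<le> g x) \<longrightarrow> (\<forall>x\<in>X. h x = g x))"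

definition ext_rhf ::
    "'a set \<Rightarrow> 'i set \<Rightarrow> ('i \<Rightarrow> 'a set) \<Rightarrow> ('a \<Rightarrow> 'i) \<Rightarrow> ('a \<Rightarrow> nat) \<Rightarrow> bool" where
  "ext_rhf X I s \<tau> f \<longleftrightarrow> (\<exists>g. minimal_rhf X I s \<tau> g \<and> (\<forall>x\<in>X. f x \<le> g x))"

definition kappa1 :: "'a set \<Rightarrow> 'i set \<Rightarrow> ('a \<Rightarrow> 'i) \<Rightarrow> nat" where
  "kappa1 X I \<tau> = card {i \<in> I. {x \<in> X. \<tau> x = i} = {}}"


section \<open>Random access machines\<close>

text \<open>Programs of a random access machine with structured control flow. The machine has
  registers, a memory addressed indirectly through registers, and a write-only output tape.
  The only arithmetic is addition and truncated subtraction, so that the uniform cost measure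
  is polynomially related to Turing machine time.\<close>

datatype com =
    Const nat nat
  | Add nat nat nat
  | Sub nat nat nat
  | Load nat nat
  | Store nat nat
  | Write nat
  | Seq com com
  | Cond nat com com
  | While nat com

record state =
  reg :: "nat \<Rightarrow> nat"
  mem :: "nat \<Rightarrow> nat"
  out_tape :: "bool list"

text \<open>\<open>exec c s t s'\<close>: started in \<open>s\<close>, the program \<open>c\<close> halts after \<open>t\<close> steps in \<open>s'\<close>.\<close>

inductive exec :: "com \<Rightarrow> state \<Rightarrow> nat \<Rightarrow> state \<Rightarrow> bool" where
  exec_Const: "exec (Const r n) s 1 (s\<lparr>reg := (reg s)(r := n)\<rparr>)"
| exec_Add: "exec (Add r a b) s 1 (s\<lparr>reg := (reg s)(r := reg s a + reg s b)\<rparr>)"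
| exec_Sub: "exec (Sub r a b) s 1 (s\<lparr>reg := (reg s)(r := reg s a - reg s b)\<rparr>)"
| exec_Load: "exec (Load r a) s 1 (s\<lparr>reg := (reg s)(r := mem s (reg s a))\<rparr>)"
| exec_Store: "exec (Store a r) s 1 (s\<lparr>mem := (mem s)(reg s a := reg s r)\<rparr>)"
| exec_Write: "exec (Write r) s 1 (s\<lparr>out_tape := out_tape s @ [reg s r \<noteq> 0]\<rparr>)"
| exec_Seq: "exec c1 s t1 s1 \<Longrightarrow> exec c2 s1 t2 s2 \<Longrightarrow> exec (Seq c1 c2) s (t1 + t2) s2"
| exec_CondT: "reg s r \<noteq> 0 \<Longrightarrow> exec c1 s t s1 \<Longrightarrow> exec (Cond r c1 c2) s (Suc t) s1"
| exec_CondF: "reg s r = 0 \<Longrightarrow> exec c2 s t s1 \<Longrightarrow> exec (Cond r c1 c2) s (Suc t) s1"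
| exec_WhileF: "reg s r = 0 \<Longrightarrow> exec (While r c) s 1 s"
| exec_WhileT: "reg s r \<noteq> 0 \<Longrightarrow> exec c s t1 s1 \<Longrightarrow> exec (While r c) s1 t2 s2
     \<Longrightarrow> exec (While r c) s (Suc (t1 + t2)) s2"

text \<open>Initially the memory holds the input string, one bit per cell, register 0 its length and
  register 1 the parameter. The result is the string on the output tape together with the
  parameter in register 1.\<close>

definition init_state :: "bool list \<Rightarrow> nat \<Rightarrow> state" where
  "init_state x k =
     \<lparr>reg = (\<lambda>r. 0)(0 := length x, 1 := k),
      mem = (\<lambda>a. if a < length x then of_bool (x ! a) else 0),
      out_tape = []\<rparr>"

definition computes_in :: "com \<Rightarrow> bool list \<Rightarrow> nat \<Rightarrow> nat \<Rightarrow> bool list \<Rightarrow> nat \<Rightarrow> bool" where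
  "computes_in p x k t x' k' \<longleftrightarrow>
     (\<exists>s. exec p (init_state x k) t s \<and> out_tape s = x' \<and> reg s 1 = k')"


section \<open>Computable functions\<close>

text \<open>\<open>general_recursive n F\<close>: on lists of length \<open>n\<close>, \<open>F\<close> is a total recursive function. By
  Kleene's normal form theorem, minimization is only needed where it yields a total function.\<close>

inductive general_recursive :: "nat \<Rightarrow> (nat list \<Rightarrow> nat) \<Rightarrow> bool" where
  gr_zero: "general_recursive n (\<lambda>xs. 0)"
| gr_suc: "i < n \<Longrightarrow> general_recursive n (\<lambda>xs. Suc (xs ! i))"
| gr_proj: "i < n \<Longrightarrow> general_recursive n (\<lambda>xs. xs ! i)"
| gr_comp: "general_recursive (length Gs) F \<Longrightarrow> (\<forall>G\<in>set Gs. general_recursive n G)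
     \<Longrightarrow> general_recursive n (\<lambda>xs. F (map (\<lambda>G. G xs) Gs))"
| gr_primrec: "general_recursive n F \<Longrightarrow> general_recursive (Suc (Suc n)) G
     \<Longrightarrow> general_recursive (Suc n)
           (\<lambda>xs. rec_nat (F (tl xs)) (\<lambda>y r. G (y # r # tl xs)) (hd xs))"
| gr_minimize: "general_recursive (Suc n) F
     \<Longrightarrow> (\<forall>xs. length xs = n \<longrightarrow> (\<exists>y. F (y # xs) = 0))
     \<Longrightarrow> general_recursive n (\<lambda>xs. LEAST y. F (y # xs) = 0)"

definition computable :: "(nat \<Rightarrow> nat) \<Rightarrow> bool" where
  "computable f \<longleftrightarrow> (\<exists>F. general_recursive 1 F \<and> (\<forall>k. f k = F [k]))"


section \<open>Parameterized problems and reductions\<close>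

type_synonym param_problem = "(bool list \<times> nat) set"

text \<open>The factor \<open>length x + 1\<close> instead of \<open>length x\<close> only accounts for the empty input.\<close>

definition fpt_reducible :: "param_problem \<Rightarrow> param_problem \<Rightarrow> bool" where
  "fpt_reducible A B \<longleftrightarrow>
     (\<exists>p f g c. computable f \<and> computable g \<and>
        (\<forall>x k. \<exists>t x' k'. computes_in p x k t x' k' \<and>
           t \<le> f k * (length x + 1) ^ c \<and>
           k' \<le> g k \<and>
           ((x, k) \<in> A \<longleftrightarrow> (x', k') \<in> B)))"

text \<open>Numbers are written in unary. All numbers occurring in instances below are indices or sizes,
  hence bounded by the size of the instance.\<close>

definition encode_nats :: "nat list \<Rightarrow> bool list" where
  "encode_nats ns = concat (map (\<lambda>n. replicate n True @ [False]) ns)"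


section \<open>Weighted circuit satisfiability and the W-hierarchy\<close>

text \<open>A circuit is a directed acyclic graph whose nodes are listed in topological order. The
  arguments of a gate are the positions of its in-neighbours, and the last node is the output.\<close>

datatype gate = Input | Neg nat | Conj "nat list" | Disj "nat list"

type_synonym circuit = "gate list"

fun gate_args :: "gate \<Rightarrow> nat list" where
  "gate_args Input = []"
| "gate_args (Neg a) = [a]"
| "gate_args (Conj as) = as"
| "gate_args (Disj as) = as"

fun gate_ok :: "gate \<Rightarrow> bool" where
  "gate_ok Input = True"
| "gate_ok (Neg a) = True"
| "gate_ok (Conj as) = (distinct as \<and> 2 \<le> length as)"
| "gate_ok (Disj as) = (distinct as \<and> 2 \<le> length as)"

definition wf_circuit :: "circuit \<Rightarrow> bool" where
  "wf_circuit C \<longleftrightarrow> C \<noteq> [] \<and>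
     (\<forall>j<length C. gate_ok (C ! j) \<and> (\<forall>a\<in>set (gate_args (C ! j)). a < j))"

definition input_nodes :: "circuit \<Rightarrow> nat set" where
  "input_nodes C = {j. j < length C \<and> C ! j = Input}"

definition io_path :: "circuit \<Rightarrow> nat list \<Rightarrow> bool" where
  "io_path C p \<longleftrightarrow> p \<noteq> [] \<and> set p \<subseteq> {..<length C} \<and>
     hd p \<in> input_nodes C \<and> last p = length C - 1 \<and>
     (\<forall>i. Suc i < length p \<longrightarrow> p ! i \<in> set (gate_args (C ! (p ! Suc i))))"

definition large :: "gate \<Rightarrow> bool" where
  "large G \<longleftrightarrow> 2 < length (gate_args G)"

definition depth_le :: "nat \<Rightarrow> circuit \<Rightarrow> bool" where
  "depth_le d C \<longleftrightarrow> (\<forall>p. io_path C p \<longrightarrow> length p - 1 \<le> d)"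

definition weft_le :: "nat \<Rightarrow> circuit \<Rightarrow> bool" where
  "weft_le t C \<longleftrightarrow> (\<forall>p. io_path C p \<longrightarrow> length (filter (\<lambda>v. large (C ! v)) p) \<le> t)"

text \<open>The values of the nodes are computed from left to right; \<open>vs\<close> lists those of the nodes
  already processed, and \<open>S\<close> is the set of input nodes that are assigned true.\<close>

fun gate_value :: "nat set \<Rightarrow> bool list \<Rightarrow> gate \<Rightarrow> bool" where
  "gate_value S vs Input = (length vs \<in> S)"
| "gate_value S vs (Neg a) = (\<not> vs ! a)"
| "gate_value S vs (Conj as) = (\<forall>a\<in>set as. vs ! a)"
| "gate_value S vs (Disj as) = (\<exists>a\<in>set as. vs ! a)"

definition node_values :: "nat set \<Rightarrow> circuit \<Rightarrow> bool list" where
  "node_values S C = foldl (\<lambda>vs G. vs @ [gate_value S vs G]) [] C"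

definition satisfies :: "nat set \<Rightarrow> circuit \<Rightarrow> bool" where
  "satisfies S C \<longleftrightarrow> last (node_values S C)"

fun encode_gate :: "gate \<Rightarrow> nat list" where
  "encode_gate Input = [0]"
| "encode_gate (Neg a) = [1, a]"
| "encode_gate (Conj as) = 2 # length as # as"
| "encode_gate (Disj as) = 3 # length as # as"

definition encode_circuit :: "circuit \<Rightarrow> bool list" where
  "encode_circuit C = encode_nats (concat (map encode_gate C))"

definition WCS :: "nat \<Rightarrow> nat \<Rightarrow> param_problem" where
  "WCS t d = {(encode_circuit C, k) | C k.
     wf_circuit C \<and> weft_le t C \<and> depth_le d C \<and>
     (\<exists>S\<subseteq>input_nodes C. card S = k \<and> satisfies S C)}"

definition W_class :: "nat \<Rightarrow> param_problem set" where
  "W_class t = {L. \<exists>d. fpt_reducible L (WCS t d)}"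

definition W_hard :: "nat \<Rightarrow> param_problem \<Rightarrow> bool" where
  "W_hard t L \<longleftrightarrow> (\<forall>L'\<in>W_class t. fpt_reducible L' L)"


section \<open>Extension Roman Hitting Function as a parameterized problem\<close>

text \<open>Up to renaming, an instance has \<open>X = {..<n}\<close> and \<open>I = {..<m}\<close>. The hypergraph is given by its
  incidence matrix.\<close>

definition encode_instance ::
    "nat \<Rightarrow> nat \<Rightarrow> (nat \<Rightarrow> nat set) \<Rightarrow> (nat \<Rightarrow> nat) \<Rightarrow> (nat \<Rightarrow> nat) \<Rightarrow> bool list" where
  "encode_instance n m s \<tau> f = encode_nats
     ([n, m] @ [of_bool (x \<in> s i). i \<leftarrow> [0..<m], x \<leftarrow> [0..<n]] @ map \<tau> [0..<n] @ map f [0..<n])"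

definition ExtensionRHF_kappa1 :: param_problem where
  "ExtensionRHF_kappa1 =
     {(encode_instance n m s \<tau> f, kappa1 {..<n} {..<m} \<tau>) | n m s \<tau> f.
        hypergraph {..<n} {..<m} s \<and> correspondence {..<n} {..<m} s \<tau> \<and>
        f \<in> {..<n} \<rightarrow> {0, 1, 2} \<and> ext_rhf {..<n} {..<m} s \<tau> f}"

end

theory Submission
  imports Defs "HOL-Library.Nat_Bijection"
begin

text \<open>Since parameterized reductions compose, it suffices to reduce weighted satisfiability of
  circuits of weft 1 and depth \<open>d\<close> for each constant \<open>d\<close>.

  In a minimal Roman hitting function every vertex of value 2 has a private edge, and an edge \<open>i\<close>
  with empty \<open>\<tau>\<^sup>-\<^sup>1(i)\<close> must contain a vertex of value 2. Hence an instance asks for a set of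
  selected vertices that hits \<open>\<kappa>\<^sub>1\<close> given sets and leaves each forced vertex one of its edges free of
  other selected vertices. So a forced vertex expresses a disjunction of conjunctions of negated
  selections. The first \<open>k\<close> sets select the \<open>k\<close> inputs that are assigned true, and as each of them
  selects one input, positive statements about inputs become conjunctions of negated ones. The last
  set selects a guess of the values of the inputs and large gates that the output depends on through
  small gates, with a witness for each large gate whose value is determined by one of its arguments.
  There are boundedly many of these gates, so there are polynomially many guesses. That the guess is
  right means that certain nodes \<open>c\<close> have certain values. Because the weft is 1, such a node depends
  on boundedly many inputs. So it is a disjunction of polynomially many claims of the form that some
  of these inputs are selected by given sets and that the others are not selected, and one forced
  vertex for the guess and \<open>c\<close> expresses it.\<close>

section \<open>Closure properties of computable functions\<close>

text \<open>Reductions are programs of the random access machine, and this shapes the construction.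
  The instance is defined from the bits of the input rather than from a circuit, by arithmetic,
  bounded sums, bounded quantifiers and recursions along constants; each of these operations has a
  rule for polynomial time. Correctness is proved separately, by relating the bits to a circuit. A
  string that encodes no suitable circuit is mapped to an instance whose last set is empty.

  Guesses, vertices and the edges of a vertex are all numbers below one bound, read as nested Cantor
  pairs. Numbers below \<open>N\<close> have pair codes below \<open>4 * N * N\<close>, which is one
  level of the bound. A guess has one level for the pairs at the leaves and \<open>d\<close> levels
  for the gates above them; a check \<open>(2, (c, h))\<close> adds two. Hence \<open>d + 3\<close>
  levels, and a bound of degree \<open>2 ^ (d + 3)\<close> in the size of the input. The new
  parameter is \<open>k + 1\<close>: one set for each of the \<open>k\<close> inputs and one for the
  guess.\<close>

lemma general_recursive_const: "general_recursive n (\<lambda>xs. c)"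
proof (induction c)
  case 0
  show ?case by (rule gr_zero)
next
  case (Suc c)
  have "general_recursive (length [\<lambda>xs::nat list. c]) (\<lambda>xs. Suc (xs ! 0))"
    by (rule gr_suc) simp
  from gr_comp[OF this, of n] Suc show ?case by simp
qed

definition computable2 :: "(nat \<Rightarrow> nat \<Rightarrow> nat) \<Rightarrow> bool" where
  "computable2 h \<longleftrightarrow> (\<exists>F. general_recursive 2 F \<and> (\<forall>a b. F [a, b] = h a b))"

lemma computable_const: "computable (\<lambda>k. c)"
  unfolding computable_def using general_recursive_const by blast

lemma computable_Suc: "computable Suc"
  unfolding computable_def using gr_suc[of 0 1] by force

lemma computable_id: "computable (\<lambda>k. k)"
  unfolding computable_def using gr_proj[of 0 1] by force

lemma computable_comp:
  assumes "computable f" "computable g"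
  shows "computable (\<lambda>k. f (g k))"
proof -
  from assms obtain F G where F: "general_recursive 1 F" "\<And>k. f k = F [k]"
    and G: "general_recursive 1 G" "\<And>k. g k = G [k]"
    unfolding computable_def by metis
  have "general_recursive 1 (\<lambda>xs. F (map (\<lambda>G. G xs) [G]))"
    by (rule gr_comp) (use F G in auto)
  then show ?thesis
    unfolding computable_def by (intro exI[of _ "\<lambda>xs. F [G xs]"]) (simp add: F G)
qed

lemma computable_comp2:
  assumes "computable2 h" "computable f" "computable g"
  shows "computable (\<lambda>k. h (f k) (g k))"
proof -
  from assms obtain H F G where H: "general_recursive 2 H" "\<And>a b. H [a, b] = h a b"
    and F: "general_recursive 1 F" "\<And>k. f k = F [k]"
    and G: "general_recursive 1 G" "\<And>k. g k = G [k]"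
    unfolding computable_def computable2_def by metis
  have "general_recursive 1 (\<lambda>xs. H (map (\<lambda>G. G xs) [F, G]))"
    by (rule gr_comp) (use H F G in \<open>auto simp: numeral_2_eq_2\<close>)
  then show ?thesis
    unfolding computable_def by (intro exI[of _ "\<lambda>xs. H [F xs, G xs]"]) (simp add: H F G)
qed

lemma computable2_add: "computable2 (+)"
proof -
  have F: "general_recursive 1 (\<lambda>xs. xs ! 0)" by (rule gr_proj) simp
  have G: "general_recursive (Suc (Suc 1)) (\<lambda>xs. Suc (xs ! 1))" by (rule gr_suc) simp
  have *: "rec_nat b (\<lambda>y. Suc) a = a + b" for a b by (induction a) auto
  from gr_primrec[OF _ G, of "\<lambda>xs. xs ! 0"] F show ?thesis
    unfolding computable2_def numeral_2_eq_2 by (force simp: *)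
qed

lemma computable2_mult: "computable2 (*)"
proof -
  from computable2_add obtain H where H: "general_recursive 2 H" "\<And>a b. H [a, b] = a + b"
    unfolding computable2_def by blast
  have "general_recursive 3 (\<lambda>xs. H (map (\<lambda>G. G xs) [\<lambda>xs. xs ! 1, \<lambda>xs. xs ! 2]))"
    by (rule gr_comp) (use H in \<open>auto simp: numeral_2_eq_2 intro: gr_proj\<close>)
  then have G: "general_recursive (Suc (Suc 1)) (\<lambda>xs. H [xs ! 1, xs ! 2])"
    by (simp add: numeral_3_eq_3)
  have *: "rec_nat 0 (\<lambda>y r. r + b) a = a * b" for a b :: nat by (induction a) auto
  from gr_primrec[OF _ G, of "\<lambda>xs. 0"] gr_zero[of 1] show ?thesis
    unfolding computable2_def numeral_2_eq_2 by (force simp: H * numeral_2_eq_2)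
qed

lemmas computable_add = computable_comp2[OF computable2_add]
lemmas computable_mult = computable_comp2[OF computable2_mult]

lemma computable_power:
  assumes "computable f"
  shows "computable (\<lambda>k. f k ^ c)"
  by (induction c) (simp_all add: computable_const computable_mult[OF assms])

text \<open>A computable majorant: it bounds \<open>f j\<close> for all \<open>j \<le> k\<close>,
  whether or not \<open>f\<close> is monotone. Composition needs it because the parameter produced
  by the first reduction is only known up to an upper bound.\<close>

lemma computable_sum:
  assumes "computable f"
  shows "computable (\<lambda>k. \<Sum>j\<le>k. f j)"
proof -
  from computable2_add obtain H where H: "general_recursive 2 H" "\<And>a b. H [a, b] = a + b"
    unfolding computable2_def by blast
  from computable_comp[OF assms computable_Suc] obtain F
    where F: "general_recursive 1 F" "\<And>k. f (Suc k) = F [k]"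
    unfolding computable_def by auto
  have "general_recursive 2 (\<lambda>xs. F (map (\<lambda>G. G xs) [\<lambda>xs. xs ! 0]))"
    by (rule gr_comp) (use F in \<open>auto intro: gr_proj\<close>)
  then have "general_recursive 2 (\<lambda>xs. H (map (\<lambda>G. G xs) [\<lambda>xs. xs ! 1, \<lambda>xs. F [xs ! 0]]))"
    by (intro gr_comp) (use H in \<open>auto simp: numeral_2_eq_2 intro: gr_proj\<close>)
  then have G: "general_recursive (Suc (Suc 0)) (\<lambda>xs. H [xs ! 1, F [xs ! 0]])"
    by (simp add: numeral_2_eq_2)
  have *: "rec_nat (f 0) (\<lambda>y r. r + F [y]) k = (\<Sum>j\<le>k. f j)" for k
    by (induction k) (auto simp: F)
  from gr_primrec[OF general_recursive_const G, of "f 0"] show ?thesis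
    unfolding computable_def by (force simp: * H)
qed


section \<open>Composition of parameterized reductions\<close>

text \<open>A step writes at most one bit. Hence the input of the second program is no longer than
  the running time of the first.\<close>

lemma length_out_tape_exec: "exec c s t s' \<Longrightarrow> length (out_tape s') \<le> length (out_tape s) + t"
  by (induction rule: exec.induct) auto

definition rho :: "nat \<Rightarrow> nat \<Rightarrow> nat" where
  "rho b r = 2 * r + b + 4"

definition address :: "nat \<Rightarrow> nat \<Rightarrow> com" where
  "address b a = Seq (Add 0 (rho b a) (rho b a)) (Add 0 0 2)"

text \<open>Two programs share the machine: program \<open>b \<in> {0, 1}\<close> uses the registers \<open>2 r + b + 4\<close> and
  the memory cells \<open>2 a + b\<close>. The output of program 0 goes to the odd cells, where program 1 finds
  it as its input, and its length is counted in register 5, which is register 0 of program 1.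
  Register 2 holds \<open>b\<close>, and register 3 holds 1.\<close>

fun tr :: "nat \<Rightarrow> com \<Rightarrow> com" where
  "tr b (Const r n) = Const (rho b r) n"
| "tr b (Add r x y) = Add (rho b r) (rho b x) (rho b y)"
| "tr b (Sub r x y) = Sub (rho b r) (rho b x) (rho b y)"
| "tr b (Load r a) = Seq (address b a) (Load (rho b r) 0)"
| "tr b (Store a r) = Seq (address b a) (Store 0 (rho b r))"
| "tr b (Write r) = (if b = 0 then Seq (Cond (rho b r) (Seq (Add 0 5 5) (Seq (Add 0 0 3) (Store 0 3)))
      (Const 0 0)) (Add 5 5 3) else Write (rho b r))"
| "tr b (Seq c d) = Seq (tr b c) (tr b d)"
| "tr b (Cond r c d) = Cond (rho b r) (tr b c) (tr b d)"
| "tr b (While r c) = While (rho b r) (tr b c)"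

text \<open>While program 0 runs, the initial state of program 1 builds up beside it: the odd cells
  hold the output so far and 0 beyond it, and the registers \<open>2 * r + 7\<close>, which are
  \<open>rho 1 (Suc r)\<close>, stay 0. The real tape is left empty for program 1.\<close>

definition simulates :: "nat \<Rightarrow> state \<Rightarrow> state \<Rightarrow> bool" where
  "simulates b s u \<longleftrightarrow>
     (\<forall>r. reg u (rho b r) = reg s r) \<and> (\<forall>a. mem u (2 * a + b) = mem s a) \<and>
     reg u 2 = b \<and> reg u 3 = 1 \<and>
     (if b = 0 then
        reg u 5 = length (out_tape s) \<and>
        (\<forall>j. mem u (2 * j + 1) = (if j < length (out_tape s) then of_bool (out_tape s ! j) else 0)) \<and>
        (\<forall>r. reg u (2 * r + 7) = 0) \<and> out_tape u = []
      else out_tape u = out_tape s)"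

lemma rho_eq_iff [simp]: "rho b r = rho b r' \<longleftrightarrow> r = r'"
  by (simp add: rho_def)

lemma rho_neq [simp]:
  "rho b r \<noteq> 0" "rho b r \<noteq> 2" "rho b r \<noteq> 3" "rho 0 r \<noteq> 5" "rho 0 r \<noteq> 2 * q + 7"
  "0 \<noteq> rho b r" "2 \<noteq> rho b r" "3 \<noteq> rho b r" "5 \<noteq> rho 0 r" "2 * q + 7 \<noteq> rho 0 r"
  "rho b r \<noteq> Suc 0" "Suc 0 \<noteq> rho b r"
  unfolding rho_def by presburger+

lemma exec_addressI:
  assumes "u' = u\<lparr>reg := (reg u)(0 := reg u (rho b a) + reg u (rho b a) + reg u 2)\<rparr>"
  shows "exec (address b a) u 2 u'"
proof -
  have "exec (address b a) u (1 + 1) u'"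
    unfolding address_def assms
    by (rule exec_Seq[OF exec_Add], rule back_subst[of "exec _ _ _"], rule exec_Add) simp
  then show ?thesis by (simp add: numeral_2_eq_2)
qed

lemma even_odd_cell [simp]:
  "(2 * a + b = 2 * a' + b) = (a = (a'::nat))"
  "2 * a \<noteq> Suc (2 * (a'::nat))" "Suc (2 * (a'::nat)) \<noteq> 2 * a"
  by presburger+

lemma exec_trI:
  assumes "exec (tr b c) u t' u'" "t' \<le> T" "simulates b s' u'"
  shows "\<exists>t' u'. exec (tr b c) u t' u' \<and> t' \<le> T \<and> simulates b s' u'"
  using assms by blast

text \<open>The factor 5 is the cost of the most expensive translation, that of writing a 1 in
  program 0. Writing a 0 only advances the counter, since the cell is already 0.\<close>

lemma exec_tr:
  assumes "exec c s t s'" "b < 2" "simulates b s u"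
  shows "\<exists>t' u'. exec (tr b c) u t' u' \<and> t' \<le> 5 * t \<and> simulates b s' u'"
  using assms
proof (induction arbitrary: u rule: exec.induct)
  case (exec_Const r n s)
  show ?case
    by (rule exI[of _ 1], rule exI, simp, rule conjI, rule exec.exec_Const[unfolded One_nat_def])
      (use exec_Const in \<open>simp add: simulates_def split: if_splits\<close>)
next
  case (exec_Add r x y s)
  show ?case
    by (rule exI[of _ 1], rule exI, simp, rule conjI, rule exec.exec_Add[unfolded One_nat_def])
      (use exec_Add in \<open>simp add: simulates_def split: if_splits\<close>)
next
  case (exec_Sub r x y s)
  show ?case
    by (rule exI[of _ 1], rule exI, simp, rule conjI, rule exec.exec_Sub[unfolded One_nat_def])
      (use exec_Sub in \<open>simp add: simulates_def split: if_splits\<close>)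
next
  case (exec_Load r a s)
  have *: "exec (tr b (Load r a)) u (2 + 1) (u\<lparr>reg := (reg u)
      (0 := 2 * reg s a + b, rho b r := mem s (reg s a))\<rparr>)"
    unfolding tr.simps
    by (rule exec_Seq[OF exec_addressI[OF refl]], rule back_subst[of "exec _ _ _"], rule exec.exec_Load)
      (use exec_Load in \<open>simp add: simulates_def mult_2\<close>)
  show ?case using exec_Load
    by (intro exec_trI[OF *]) (auto simp: simulates_def split: if_splits)
next
  case (exec_Store a r s)
  have *: "exec (tr b (Store a r)) u (2 + 1) (u\<lparr>reg := (reg u)(0 := 2 * reg s a + b),
      mem := (mem u)(2 * reg s a + b := reg s r)\<rparr>)"
    unfolding tr.simps
    by (rule exec_Seq[OF exec_addressI[OF refl]], rule back_subst[of "exec _ _ _"], rule exec.exec_Store)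
      (use exec_Store in \<open>simp add: simulates_def mult_2\<close>)
  show ?case using exec_Store
    by (intro exec_trI[OF *]) (auto simp: simulates_def split: if_splits)
next
  case (exec_Write r s)
  show ?case
  proof (cases "b = 0")
    case False
    have *: "exec (tr b (Write r)) u 1 (u\<lparr>out_tape := out_tape s @ [reg s r \<noteq> 0]\<rparr>)"
      using exec.exec_Write[of "rho b r" u] False exec_Write by (simp add: simulates_def)
    show ?thesis using exec_Write False
      by (intro exec_trI[OF *]) (auto simp: simulates_def)
  next
    case b: True
    let ?c = "Cond (rho b r) (Seq (Add 0 5 5) (Seq (Add 0 0 3) (Store 0 3))) (Const 0 0)"
    have tr: "tr b (Write r) = Seq ?c (Add 5 5 3)" by (simp add: b)
    show ?thesis
    proof (cases "reg s r = 0")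
      case True
      have *: "exec (tr b (Write r)) u (Suc 1 + 1) (u\<lparr>reg := (reg u)(0 := 0, 5 := reg u 5 + 1)\<rparr>)"
        unfolding tr
        apply (rule exec_Seq[OF exec_CondF[OF _ exec_Const]])
        subgoal using exec_Write True by (simp add: simulates_def)
        apply (rule back_subst[of "exec _ _ _"], rule exec.exec_Add)
        using exec_Write by (simp add: simulates_def)
      show ?thesis using exec_Write True b
        by (intro exec_trI[OF *]) (auto simp: simulates_def nth_append less_Suc_eq)
    next
      case False
      have *: "exec (tr b (Write r)) u (Suc (1 + (1 + 1)) + 1)
          (u\<lparr>reg := (reg u)(0 := 2 * reg u 5 + 1, 5 := reg u 5 + 1),
            mem := (mem u)(2 * reg u 5 + 1 := 1)\<rparr>)"
        unfolding tr
        apply (rule exec_Seq[OF exec_CondT[OF _ exec_Seq[OF exec_Add exec_Seq[OF exec_Add exec_Store]]]])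
        subgoal using exec_Write False by (simp add: simulates_def)
        apply (rule back_subst[of "exec _ _ _"], rule exec.exec_Add)
        using exec_Write by (simp add: simulates_def mult_2)
      show ?thesis using exec_Write False b
        by (intro exec_trI[OF *]) (auto simp: simulates_def nth_append less_Suc_eq)
    qed
  qed
next
  case (exec_Seq c1 s t1 s1 c2 t2 s2)
  from exec_Seq(3)[OF exec_Seq(5,6)] obtain t1' u1
    where 1: "exec (tr b c1) u t1' u1" "t1' \<le> 5 * t1" "simulates b s1 u1" by blast
  from exec_Seq(4)[OF exec_Seq(5) 1(3)] obtain t2' u2
    where 2: "exec (tr b c2) u1 t2' u2" "t2' \<le> 5 * t2" "simulates b s2 u2" by blast
  from exec.exec_Seq[OF 1(1) 2(1)] show ?case using 1 2 by force
next
  case (exec_CondT s r c1 t s1 c2)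
  from exec_CondT(3)[OF exec_CondT(4,5)] obtain t' u'
    where 1: "exec (tr b c1) u t' u'" "t' \<le> 5 * t" "simulates b s1 u'" by blast
  have "reg u (rho b r) \<noteq> 0" using exec_CondT by (simp add: simulates_def)
  from exec.exec_CondT[where r="rho b r", OF this 1(1)] show ?case using 1 by fastforce
next
  case (exec_CondF s r c2 t s1 c1)
  from exec_CondF(3)[OF exec_CondF(4,5)] obtain t' u'
    where 1: "exec (tr b c2) u t' u'" "t' \<le> 5 * t" "simulates b s1 u'" by blast
  have "reg u (rho b r) = 0" using exec_CondF by (simp add: simulates_def)
  from exec.exec_CondF[where r="rho b r", OF this 1(1)] show ?case using 1 by fastforce
next
  case (exec_WhileF s r c)
  have "reg u (rho b r) = 0" using exec_WhileF by (simp add: simulates_def)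
  from exec.exec_WhileF[where r="rho b r", OF this] show ?case using exec_WhileF by fastforce
next
  case (exec_WhileT s r c t1 s1 t2 s2)
  from exec_WhileT(4)[OF exec_WhileT(6,7)] obtain t1' u1
    where 1: "exec (tr b c) u t1' u1" "t1' \<le> 5 * t1" "simulates b s1 u1" by blast
  from exec_WhileT(5)[OF exec_WhileT(6) 1(3)] obtain t2' u2
    where 2: "exec (tr b (While r c)) u1 t2' u2" "t2' \<le> 5 * t2" "simulates b s2 u2" by blast
  have "reg u (rho b r) \<noteq> 0" using exec_WhileT by (simp add: simulates_def)
  from exec.exec_WhileT[where r="rho b r", OF this 1(1) 2(1)[simplified]] show ?case using 1 2 by fastforce
qed


section \<open>Moving the input to the even cells\<close>

definition spread_body :: com where
  "spread_body = Seq (Sub 0 0 3) (Seq (Load 1 0) (Seq (Const 2 0) (Seq (Store 0 2)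
     (Seq (Add 2 0 0) (Store 2 1)))))"

text \<open>Cell \<open>j\<close> is cleared before cell \<open>2 * j\<close> is written. For
  \<open>j = 0\<close> these are the same cell, and in this order it keeps its value.\<close>

lemma exec_spread_body:
  assumes "reg u 0 = Suc j" "reg u 3 = 1"
  shows "exec spread_body u 6 (u\<lparr>reg := (reg u)(0 := j, 1 := mem u j, 2 := 2 * j),
    mem := (mem u)(j := 0, 2 * j := mem u j)\<rparr>)"
proof -
  have "exec spread_body u (1 + (1 + (1 + (1 + (1 + 1))))) (u\<lparr>reg := (reg u)(0 := j, 1 := mem u j, 2 := 2 * j),
    mem := (mem u)(j := 0, 2 * j := mem u j)\<rparr>)"
    unfolding spread_body_def
    by (rule exec_Seq[OF exec_Sub exec_Seq[OF exec_Load exec_Seq[OF exec_Const exec_Seq[OF exec_Store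
          exec_Seq[OF exec_Add]]]]], rule back_subst[of "exec _ _ _"], rule exec_Store)
      (use assms in \<open>simp add: fun_upd_twist fun_upd_def fun_eq_iff\<close>)
  then show ?thesis by (simp add: eval_nat_numeral)
qed

text \<open>The cells have to be moved from right to left, since cell \<open>2 j\<close> may be part of the input.\<close>

lemma exec_spread_loop:
  assumes "reg u 0 = j" "reg u 3 = 1" "j \<le> length x"
    "mem u = (\<lambda>a. if a < j then of_bool (x ! a)
       else if even a \<and> 2 * j \<le> a \<and> a div 2 < length x then of_bool (x ! (a div 2)) else 0)"
  shows "\<exists>u'. exec (While 0 spread_body) u (7 * j + 1) u' \<and> (\<forall>r\<ge>3. reg u' r = reg u r) \<and>
    out_tape u' = out_tape u \<and>
    mem u' = (\<lambda>a. if even a \<and> a div 2 < length x then of_bool (x ! (a div 2)) else 0)"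
  using assms
proof (induction j arbitrary: u)
  case 0
  then show ?case using exec_WhileF[of u 0 spread_body] by (intro exI[of _ u]) simp
next
  case (Suc j)
  let ?u = "u\<lparr>reg := (reg u)(0 := j, 1 := mem u j, 2 := 2 * j),
    mem := (mem u)(j := 0, 2 * j := mem u j)\<rparr>"
  note body = exec_spread_body[OF Suc(2,3)]
  have mem: "mem u j = of_bool (x ! j)" using Suc(5) by simp
  have "mem ?u = (\<lambda>a. if a < j then of_bool (x ! a)
       else if even a \<and> 2 * j \<le> a \<and> a div 2 < length x then of_bool (x ! (a div 2)) else 0)"
    unfolding fun_eq_iff
  proof
    fix a
    consider "a < j" | "a = j" "j > 0" | "a = 2 * j" | "a > j" "a < 2 * j" | "a = Suc (2 * j)" | "a \<ge> 2 * Suc j"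
      by atomize_elim arith
    then show "mem ?u a = (if a < j then of_bool (x ! a)
       else if even a \<and> 2 * j \<le> a \<and> a div 2 < length x then of_bool (x ! (a div 2)) else 0)"
      by cases (use Suc(4) mem in \<open>auto simp: Suc(5)\<close>)
  qed
  then obtain u' where u': "exec (While 0 spread_body) ?u (7 * j + 1) u'"
    "\<forall>r\<ge>3. reg u' r = reg ?u r" "out_tape u' = out_tape ?u"
    "mem u' = (\<lambda>a. if even a \<and> a div 2 < length x then of_bool (x ! (a div 2)) else 0)"
    using Suc.IH[of ?u] Suc.prems by auto
  have "exec (While 0 spread_body) u (Suc (6 + (7 * j + 1))) u'"
    by (rule exec_WhileT[OF _ body u'(1)]) (simp add: Suc)
  then show ?case using u' by (intro exI[of _ u']) auto
qed

text \<open>Register 2 is still 0, so the first two additions copy the length and the parameter to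
  \<open>rho 0 0\<close> and \<open>rho 0 1\<close>, away from the scratch registers. The loop
  overwrites register 2, which is then reset to the program number 0.\<close>

definition prologue :: com where
  "prologue = Seq (Add 4 0 2) (Seq (Add 6 1 2) (Seq (Const 3 1) (Seq (While 0 spread_body) (Const 2 0))))"

lemma exec_prologue: "\<exists>u. exec prologue (init_state x k) (7 * length x + 5) u \<and> simulates 0 (init_state x k) u"
proof -
  let ?u = "(init_state x k)\<lparr>reg := (reg (init_state x k))(4 := length x, 6 := k, 3 := 1)\<rparr>"
  have mem: "mem ?u = (\<lambda>a. if a < length x then of_bool (x ! a)
       else if even a \<and> 2 * length x \<le> a \<and> a div 2 < length x then of_bool (x ! (a div 2)) else 0)"
    by (auto simp: init_state_def fun_eq_iff)
  obtain u where u: "exec (While 0 spread_body) ?u (7 * length x + 1) u"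
    "\<forall>r\<ge>3. reg u r = reg ?u r" "out_tape u = out_tape ?u"
    "mem u = (\<lambda>a. if even a \<and> a div 2 < length x then of_bool (x ! (a div 2)) else 0)"
    using exec_spread_loop[of ?u "length x" x, OF _ _ _ mem] by (auto simp: init_state_def)
  have *: "exec (Const 3 1) ((init_state x k)\<lparr>reg := (reg (init_state x k))(4 := length x, 6 := k)\<rparr>) 1 ?u"
    by (rule back_subst[of "exec _ _ _"], rule exec_Const) simp
  have **: "exec (Add 6 1 2) ((init_state x k)\<lparr>reg := (reg (init_state x k))(4 := length x)\<rparr>) 1
      ((init_state x k)\<lparr>reg := (reg (init_state x k))(4 := length x, 6 := k)\<rparr>)"
    by (rule back_subst[of "exec _ _ _"], rule exec_Add) (simp add: init_state_def)
  have ***: "exec (Add 4 0 2) (init_state x k) 1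
      ((init_state x k)\<lparr>reg := (reg (init_state x k))(4 := length x)\<rparr>)"
    by (rule back_subst[of "exec _ _ _"], rule exec_Add) (simp add: init_state_def)
  have "exec prologue (init_state x k) (1 + (1 + (1 + (7 * length x + 1 + 1)))) (u\<lparr>reg := (reg u)(2 := 0)\<rparr>)"
    unfolding prologue_def by (intro exec_Seq[OF ***] exec_Seq[OF **] exec_Seq[OF *] exec_Seq[OF u(1)] exec_Const)
  moreover have "simulates 0 (init_state x k) (u\<lparr>reg := (reg u)(2 := 0)\<rparr>)"
    using u(2-4) by (auto simp: simulates_def init_state_def rho_def)
  ultimately show ?thesis by (intro exI conjI) (simp_all add: eval_nat_numeral)
qed

text \<open>Register 5, which is \<open>rho 1 0\<close>, already counts the output. Only the
  parameter has to be copied, from register 6 (\<open>rho 0 1\<close>) to register 7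
  (\<open>rho 1 1\<close>), and the program number set to 1.\<close>

definition handover :: com where
  "handover = Seq (Const 0 0) (Seq (Add 7 6 0) (Const 2 1))"

lemma exec_handover:
  assumes "simulates 0 s u"
  shows "\<exists>u'. exec handover u 3 u' \<and> simulates 1 (init_state (out_tape s) (reg s 1)) u'"
proof -
  let ?u = "u\<lparr>reg := (reg u)(0 := 0, 7 := reg s 1, 2 := 1)\<rparr>"
  from assms have "reg u (rho 0 1) = reg s 1"
    unfolding simulates_def by blast
  then have 6: "reg u 6 = reg s 1"
    by (simp add: rho_def)
  have "exec handover u (1 + (1 + 1)) ?u"
    unfolding handover_def
    by (rule exec_Seq[OF exec_Const exec_Seq[OF exec_Add]], rule back_subst[of "exec _ _ _"], rule exec_Const)
      (simp add: 6)
  then have "exec handover u 3 ?u" by (simp add: numeral_3_eq_3)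
  moreover have "simulates 1 (init_state (out_tape s) (reg s 1)) ?u"
  proof -
    have "reg ?u (rho 1 r) = reg (init_state (out_tape s) (reg s 1)) r" for r
    proof -
      consider "r = 0" | "r = 1" | q where "r = Suc (Suc q)" by (metis One_nat_def not0_implies_Suc)
      then show ?thesis
      proof cases
        case 3
        then have "rho 1 r = 2 * Suc q + 7" by (simp add: rho_def)
        moreover from assms have "\<forall>r. reg u (2 * r + 7) = 0" unfolding simulates_def by argo
        then have "reg u (2 * Suc q + 7) = 0" by blast
        ultimately show ?thesis using 3 by (simp add: init_state_def del: mult_Suc_right)
      qed (use assms in \<open>auto simp: simulates_def rho_def init_state_def\<close>)
    qed
    then show ?thesis using assms by (auto simp: simulates_def init_state_def)
  qed
  ultimately show ?thesis by blast
qed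

lemma fpt_reducible_trans:
  assumes "fpt_reducible A B" "fpt_reducible B C"
  shows "fpt_reducible A C"
proof -
  from assms(1) obtain p1 f1 g1 c1 where 1: "computable f1" "computable g1"
    and p1: "\<And>x k. \<exists>t x' k'. computes_in p1 x k t x' k' \<and> t \<le> f1 k * (length x + 1) ^ c1 \<and>
      k' \<le> g1 k \<and> ((x, k) \<in> A \<longleftrightarrow> (x', k') \<in> B)"
    unfolding fpt_reducible_def by blast
  from assms(2) obtain p2 f2 g2 c2 where 2: "computable f2" "computable g2"
    and p2: "\<And>x k. \<exists>t x' k'. computes_in p2 x k t x' k' \<and> t \<le> f2 k * (length x + 1) ^ c2 \<and>
      k' \<le> g2 k \<and> ((x, k) \<in> B \<longleftrightarrow> (x', k') \<in> C)"
    unfolding fpt_reducible_def by blast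
  define p where "p = Seq prologue (Seq (tr 0 p1) (Seq handover (Seq (tr 1 p2) (Seq (Const 0 0) (Add 1 7 0)))))"
  define F where "F k = (\<Sum>j\<le>g1 k. f2 j)" for k
  define G where "G k = (\<Sum>j\<le>g1 k. g2 j)" for k
  define f where "f k = 15 * (1 + (f1 k + F k * (f1 k + 1) ^ c2))" for k
  \<comment> \<open>At least each of 1, \<open>c1\<close> and \<open>c1 * c2\<close>, the exponents
    in the times for moving the input and for the two programs.\<close>
  define c where "c = 1 + (c1 + c1 * c2)"
  have F: "computable F" and G: "computable G"
    unfolding F_def G_def using computable_comp[OF computable_sum 1(2)] 2 by blast+
  then have f: "computable f"
    unfolding f_def using 1 by (intro computable_mult computable_add computable_power computable_const)
  have "\<exists>t x' k'. computes_in p x k t x' k' \<and> t \<le> f k * (length x + 1) ^ c \<and>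
      k' \<le> G k \<and> ((x, k) \<in> A \<longleftrightarrow> (x', k') \<in> C)" for x k
  proof -
    from p1[of x k] obtain t1 s1 where s1: "exec p1 (init_state x k) t1 s1"
      "t1 \<le> f1 k * (length x + 1) ^ c1" "reg s1 1 \<le> g1 k"
      "(x, k) \<in> A \<longleftrightarrow> (out_tape s1, reg s1 1) \<in> B"
      unfolding computes_in_def by blast
    from p2[of "out_tape s1" "reg s1 1"] obtain t2 s2
      where s2: "exec p2 (init_state (out_tape s1) (reg s1 1)) t2 s2"
      "t2 \<le> f2 (reg s1 1) * (length (out_tape s1) + 1) ^ c2" "reg s2 1 \<le> g2 (reg s1 1)"
      "(out_tape s1, reg s1 1) \<in> B \<longleftrightarrow> (out_tape s2, reg s2 1) \<in> C"
      unfolding computes_in_def by blast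
    obtain u0 where u0: "exec prologue (init_state x k) (7 * length x + 5) u0" "simulates 0 (init_state x k) u0"
      using exec_prologue by blast
    obtain t1' u1 where u1: "exec (tr 0 p1) u0 t1' u1" "t1' \<le> 5 * t1" "simulates 0 s1 u1"
      using exec_tr[OF s1(1) _ u0(2)] by auto
    obtain u2 where u2: "exec handover u1 3 u2" "simulates 1 (init_state (out_tape s1) (reg s1 1)) u2"
      using exec_handover[OF u1(3)] by blast
    obtain t2' u3 where u3: "exec (tr 1 p2) u2 t2' u3" "t2' \<le> 5 * t2" "simulates 1 s2 u3"
      using exec_tr[OF s2(1) _ u2(2)] by auto
    let ?u = "u3\<lparr>reg := (reg u3)(0 := 0, 1 := reg u3 7)\<rparr>"
    have "exec (Seq (Const 0 0) (Add 1 7 0)) u3 (1 + 1) ?u"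
      by (rule exec_Seq[OF exec_Const], rule back_subst[of "exec _ _ _"], rule exec_Add) simp
    then have exec: "exec p (init_state x k) (7 * length x + 5 + (t1' + (3 + (t2' + (1 + 1))))) ?u"
      unfolding p_def by (intro exec_Seq[OF u0(1)] exec_Seq[OF u1(1)] exec_Seq[OF u2(1)] exec_Seq[OF u3(1)])
    have 7: "reg u3 7 = reg s2 1" and out: "out_tape u3 = out_tape s2"
      using u3(3) unfolding simulates_def rho_def
      by (auto dest!: spec[of _ 1])
    have le: "length (out_tape s1) \<le> t1"
      using length_out_tape_exec[OF s1(1)] by (simp add: init_state_def)
    have f2F: "f2 (reg s1 1) \<le> F k"
      unfolding F_def using s1(3) by (intro member_le_sum) auto
    have g2G: "g2 (reg s1 1) \<le> G k"
      unfolding G_def using s1(3) by (intro member_le_sum) auto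
    let ?n = "length x + 1"
    have one: "1 \<le> ?n ^ e" for e by simp
    have t1n: "t1 + 1 \<le> (f1 k + 1) * ?n ^ c1"
      using add_mono[OF s1(2) one[of c1]] by (simp add: algebra_simps)
    have "t2 \<le> F k * (t1 + 1) ^ c2"
      using s2(2) by (rule order_trans) (use f2F le in \<open>intro mult_mono power_mono; simp\<close>)
    also have "\<dots> \<le> F k * ((f1 k + 1) * ?n ^ c1) ^ c2"
      using t1n by (intro mult_mono power_mono) auto
    finally have t2n: "t2 \<le> F k * (f1 k + 1) ^ c2 * ?n ^ (c1 * c2)"
      by (simp only: power_mult_distrib power_mult mult.assoc)
    have n1: "?n \<le> ?n ^ c"
      using power_increasing[of 1 c ?n] by (simp add: c_def)
    have n2: "?n ^ c1 \<le> ?n ^ c" and n3: "?n ^ (c1 * c2) \<le> ?n ^ c"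
      unfolding c_def by (intro power_increasing; simp)+
    have "7 * length x + 5 + (t1' + (3 + (t2' + (1 + 1)))) \<le> 15 * ?n + 15 * t1 + 15 * t2"
      using u1(2) u3(2) by simp
    also have "\<dots> \<le> 15 * ?n ^ c + 15 * (f1 k * ?n ^ c) + 15 * (F k * (f1 k + 1) ^ c2 * ?n ^ c)"
      using n1 order_trans[OF s1(2) mult_left_mono[OF n2]] order_trans[OF t2n mult_left_mono[OF n3]]
      by (intro add_mono mult_left_mono) auto
    also have "\<dots> = f k * ?n ^ c"
      by (simp add: f_def algebra_simps)
    finally have time: "7 * length x + 5 + (t1' + (3 + (t2' + (1 + 1)))) \<le> f k * ?n ^ c" .
    show ?thesis
    proof (intro exI conjI)
      show "computes_in p x k (7 * length x + 5 + (t1' + (3 + (t2' + (1 + 1))))) (out_tape s2) (reg s2 1)"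
        unfolding computes_in_def using 7 out by (intro exI[of _ ?u] conjI exec) auto
    qed (use time s1 s2 g2G in auto)
  qed
  then show ?thesis
    unfolding fpt_reducible_def using f G by blast
qed

section \<open>Functions computable in polynomial time\<close>

text \<open>A context consists of the input string, the parameter, and a number by powers of which all
  running times are bounded. Registers 0 to 2 hold the length of the input and the other two
  components, registers 3 and 4 the constants 1 and 0.\<close>

type_synonym ctx = "bool list \<times> nat \<times> nat"

abbreviation inp :: "ctx \<Rightarrow> bool list" where "inp g \<equiv> fst g"
abbreviation len :: "ctx \<Rightarrow> nat" where "len g \<equiv> length (fst g)"
abbreviation par :: "ctx \<Rightarrow> nat" where "par g \<equiv> fst (snd g)"
abbreviation bnd :: "ctx \<Rightarrow> nat" where "bnd g \<equiv> snd (snd g)"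

section \<open>Polynomially bounded functions\<close>

definition poly_bound :: "(nat \<Rightarrow> nat) \<Rightarrow> bool" where
  "poly_bound T \<longleftrightarrow> (\<exists>K D. \<forall>b. T b \<le> K * (b + 1) ^ D)"

lemma poly_bound_const: "poly_bound (\<lambda>b. c)"
  unfolding poly_bound_def by (intro exI[of _ c] exI[of _ 0]) simp

lemma poly_bound_id: "poly_bound (\<lambda>b. b)"
  unfolding poly_bound_def by (intro exI[of _ 1]) simp

lemma poly_bound_add:
  assumes "poly_bound S" "poly_bound T"
  shows "poly_bound (\<lambda>b. S b + T b)"
proof -
  from assms obtain K D L E where *: "\<And>b. S b \<le> K * (b + 1) ^ D" "\<And>b. T b \<le> L * (b + 1) ^ E"
    unfolding poly_bound_def by metis
  have "S b + T b \<le> (K + L) * (b + 1) ^ (D + E)" for b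
  proof -
    have "(b + 1) ^ D \<le> (b + 1) ^ (D + E)" "(b + 1) ^ E \<le> (b + 1) ^ (D + E)"
      by (intro power_increasing; simp)+
    then have "S b \<le> K * (b + 1) ^ (D + E)" "T b \<le> L * (b + 1) ^ (D + E)"
      using * by (meson mult_le_mono2 order_trans)+
    then show ?thesis by (simp add: algebra_simps)
  qed
  then show ?thesis unfolding poly_bound_def by blast
qed

lemma poly_bound_mult:
  assumes "poly_bound S" "poly_bound T"
  shows "poly_bound (\<lambda>b. S b * T b)"
proof -
  from assms obtain K D L E where *: "\<And>b. S b \<le> K * (b + 1) ^ D" "\<And>b. T b \<le> L * (b + 1) ^ E"
    unfolding poly_bound_def by metis
  have "S b * T b \<le> (K * L) * (b + 1) ^ (D + E)" for b
    using mult_mono[OF *(1)[of b] *(2)[of b]] by (simp add: power_add mult_ac)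
  then show ?thesis unfolding poly_bound_def by blast
qed

lemma poly_bound_power: "poly_bound (\<lambda>b. K * (b + 1) ^ D)"
  unfolding poly_bound_def by blast

lemmas poly_bound_intros = poly_bound_const poly_bound_id poly_bound_add poly_bound_mult

section \<open>Running programs on a context\<close>

definition ctx_state :: "ctx \<Rightarrow> state \<Rightarrow> bool" where
  "ctx_state g s \<longleftrightarrow> reg s 0 = len g \<and> reg s 1 = par g \<and> reg s 2 = bnd g \<and>
     reg s 3 = 1 \<and> reg s 4 = 0 \<and> (\<forall>a. mem s a = of_bool (a < len g \<and> inp g ! a)) \<and>
     len g \<le> bnd g \<and> par g \<le> bnd g"

text \<open>Memory must be unchanged, so all work is done in registers and the input stays readable.
  Preserving the registers below \<open>z\<close> lets programs be nested with increasing
  \<open>z\<close>.\<close>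

definition runs :: "com \<Rightarrow> nat \<Rightarrow> nat \<Rightarrow> state \<Rightarrow> state \<Rightarrow> bool" where
  "runs c z T s s' \<longleftrightarrow> (\<exists>t\<le>T. exec c s t s') \<and> (\<forall>j<z. reg s' j = reg s j) \<and> mem s' = mem s"

lemma runs_mono: "runs c z T s s' \<Longrightarrow> z' \<le> z \<Longrightarrow> T \<le> T' \<Longrightarrow> runs c z' T' s s'"
  unfolding runs_def by (meson order_trans less_le_trans)

lemma runs_Seq:
  assumes "runs c z T s s1" "runs d z U s1 s2"
  shows "runs (Seq c d) z (T + U) s s2"
proof -
  from assms obtain t u where "t \<le> T" "exec c s t s1" "u \<le> U" "exec d s1 u s2"
    unfolding runs_def by blast
  then have "t + u \<le> T + U" "exec (Seq c d) s (t + u) s2" by (auto intro: exec_Seq)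
  then show ?thesis using assms unfolding runs_def by auto
qed

lemma runs_Const: "z \<le> r \<Longrightarrow> runs (Const r n) z 1 s (s\<lparr>reg := (reg s)(r := n)\<rparr>)"
  unfolding runs_def using exec_Const by auto

lemma runs_Add: "z \<le> r \<Longrightarrow> runs (Add r a b) z 1 s (s\<lparr>reg := (reg s)(r := reg s a + reg s b)\<rparr>)"
  unfolding runs_def using exec_Add by auto

lemma runs_Sub: "z \<le> r \<Longrightarrow> runs (Sub r a b) z 1 s (s\<lparr>reg := (reg s)(r := reg s a - reg s b)\<rparr>)"
  unfolding runs_def using exec_Sub by auto

lemma runs_Load: "z \<le> r \<Longrightarrow> runs (Load r a) z 1 s (s\<lparr>reg := (reg s)(r := mem s (reg s a))\<rparr>)"
  unfolding runs_def using exec_Load by auto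

lemma runs_Write: "runs (Write r) z 1 s (s\<lparr>out_tape := out_tape s @ [reg s r \<noteq> 0]\<rparr>)"
  unfolding runs_def using exec_Write by auto

lemma runs_Cond:
  assumes "runs (if reg s r = 0 then d else c) z T s s'"
  shows "runs (Cond r c d) z (T + 1) s s'"
proof -
  from assms obtain t where "t \<le> T" "exec (if reg s r = 0 then d else c) s t s'" unfolding runs_def by blast
  then have "Suc t \<le> T + 1" "exec (Cond r c d) s (Suc t) s'"
    by (auto intro: exec_CondT exec_CondF split: if_splits)
  then show ?thesis using assms unfolding runs_def by blast
qed

lemma ctx_state_runs: "runs c z T s s' \<Longrightarrow> 5 \<le> z \<Longrightarrow> ctx_state g s \<Longrightarrow> ctx_state g s'"
  unfolding runs_def ctx_state_def by simp

lemma map_reg_runs: "runs c z T s s' \<Longrightarrow> \<forall>v\<in>set vs. v < z \<Longrightarrow> map (reg s') vs = map (reg s) vs"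
  unfolding runs_def by simp

text \<open>\<open>feas r F\<close>: the value of \<open>F\<close> at \<open>r\<close> variables is computed in time polynomial in the bound of
  the context. The variables may be in any registers \<open>vs\<close> below \<open>z\<close>, and the program touches only
  the registers from \<open>z\<close> on. The rules below do not mention variables by name: functions of further
  arguments are expressed by functions of the list of all variables.\<close>

definition slots :: "nat \<Rightarrow> nat list \<Rightarrow> nat \<Rightarrow> bool" where
  "slots r vs z \<longleftrightarrow> length vs = r \<and> (\<forall>v\<in>set vs. v < z) \<and> 5 \<le> z"

definition evaluates :: "com \<Rightarrow> nat \<Rightarrow> nat list \<Rightarrow> (nat \<Rightarrow> nat) \<Rightarrow> (ctx \<Rightarrow> nat list \<Rightarrow> nat) \<Rightarrow> bool" where
  "evaluates c z vs T F \<longleftrightarrow> (\<forall>g s. ctx_state g s \<longrightarrow> (\<exists>s'. runs c z (T (bnd g)) s s' \<and>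
     reg s' z = F g (map (reg s) vs) \<and> out_tape s' = out_tape s))"

definition emits :: "com \<Rightarrow> nat \<Rightarrow> nat list \<Rightarrow> (nat \<Rightarrow> nat) \<Rightarrow> (ctx \<Rightarrow> nat list \<Rightarrow> nat list) \<Rightarrow> bool" where
  "emits c z vs T L \<longleftrightarrow> (\<forall>g s. ctx_state g s \<longrightarrow> (\<exists>s'. runs c z (T (bnd g)) s s' \<and>
     out_tape s' = out_tape s @ encode_nats (L g (map (reg s) vs))))"

definition feas_in :: "(nat \<Rightarrow> nat) \<Rightarrow> nat \<Rightarrow> (ctx \<Rightarrow> nat list \<Rightarrow> nat) \<Rightarrow> bool" where
  "feas_in T r F \<longleftrightarrow> (\<forall>vs z. slots r vs z \<longrightarrow> (\<exists>c. evaluates c z vs T F))"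

definition outp_in :: "(nat \<Rightarrow> nat) \<Rightarrow> nat \<Rightarrow> (ctx \<Rightarrow> nat list \<Rightarrow> nat list) \<Rightarrow> bool" where
  "outp_in T r L \<longleftrightarrow> (\<forall>vs z. slots r vs z \<longrightarrow> (\<exists>c. emits c z vs T L))"

definition feas :: "nat \<Rightarrow> (ctx \<Rightarrow> nat list \<Rightarrow> nat) \<Rightarrow> bool" where
  "feas r F \<longleftrightarrow> (\<exists>T. poly_bound T \<and> feas_in T r F)"

definition outp :: "nat \<Rightarrow> (ctx \<Rightarrow> nat list \<Rightarrow> nat list) \<Rightarrow> bool" where
  "outp r L \<longleftrightarrow> (\<exists>T. poly_bound T \<and> outp_in T r L)"

lemma slotsD:
  assumes "slots r vs z"
  shows "length vs = r" "\<forall>v\<in>set vs. v < z" "5 \<le> z" "slots r vs (Suc z)" "slots (Suc r) (z # vs) (Suc z)"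
    "z \<notin> set vs" "Suc z \<notin> set vs" "Suc (Suc z) \<notin> set vs"
  using assms unfolding slots_def by force+

lemma feasE:
  assumes "feas r F"
  obtains T where "poly_bound T" "feas_in T r F"
  using assms unfolding feas_def by blast

lemma outpE:
  assumes "outp r L"
  obtains T where "poly_bound T" "outp_in T r L"
  using assms unfolding outp_def by blast

lemma feas_inE:
  assumes "feas_in T r F" "slots r vs z"
  obtains c where "evaluates c z vs T F"
  using assms unfolding feas_in_def by blast

lemma outp_inE:
  assumes "outp_in T r L" "slots r vs z"
  obtains c where "emits c z vs T L"
  using assms unfolding outp_in_def by blast

lemma feasI:
  assumes "poly_bound T" "\<And>vs z. slots r vs z \<Longrightarrow> \<exists>c. evaluates c z vs T F"
  shows "feas r F"
  using assms unfolding feas_def feas_in_def by blast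

lemma outpI:
  assumes "poly_bound T" "\<And>vs z. slots r vs z \<Longrightarrow> \<exists>c. emits c z vs T L"
  shows "outp r L"
  using assms unfolding outp_def outp_in_def by blast

lemma evaluatesE:
  assumes "evaluates c z vs T F" "ctx_state g s" "slots r vs z"
  obtains s' where "runs c z (T (bnd g)) s s'" "reg s' z = F g (map (reg s) vs)"
    "out_tape s' = out_tape s" "ctx_state g s'" "map (reg s') vs = map (reg s) vs"
  using assms unfolding evaluates_def
  by (metis ctx_state_runs map_reg_runs slotsD(2,3))

lemma emitsE:
  assumes "emits c z vs T L" "ctx_state g s" "slots r vs z"
  obtains s' where "runs c z (T (bnd g)) s s'"
    "out_tape s' = out_tape s @ encode_nats (L g (map (reg s) vs))"
    "ctx_state g s'" "map (reg s') vs = map (reg s) vs"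
  using assms unfolding emits_def
  by (metis ctx_state_runs map_reg_runs slotsD(2,3))

lemma feas_copy:
  assumes "\<And>vs z. slots r vs z \<Longrightarrow> \<exists>a. \<forall>g s. ctx_state g s \<longrightarrow> reg s a = F g (map (reg s) vs)"
  shows "feas r F"
proof (rule feasI[OF poly_bound_const[of 1]])
  fix vs :: "nat list" and z :: nat
  assume "slots r vs z"
  from assms[OF this] obtain a where
    a: "\<And>g s. ctx_state g s \<Longrightarrow> reg s a = F g (map (reg s) vs)" by blast
  show "\<exists>c. evaluates c z vs (\<lambda>b. 1) F"
    unfolding evaluates_def
    by (intro exI[of _ "Add z a 4"] allI impI, rule exI, rule conjI, rule runs_Add[OF order_refl])
      (use a in \<open>auto simp: ctx_state_def\<close>)
qed

lemma feas_const: "feas r (\<lambda>g w. n)"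
proof (rule feasI[OF poly_bound_const[of 1]])
  show "\<exists>c. evaluates c z vs (\<lambda>b. 1) (\<lambda>g w. n)" for vs z
    unfolding evaluates_def
    by (intro exI[of _ "Const z n"] allI impI, rule exI, rule conjI, rule runs_Const[OF order_refl]) auto
qed

lemma feas_len: "feas r (\<lambda>g w. len g)"
  and feas_par: "feas r (\<lambda>g w. par g)"
  and feas_bnd: "feas r (\<lambda>g w. bnd g)"
  by (rule feas_copy; unfold ctx_state_def; blast)+

lemma feas_hd: "feas (Suc r) (\<lambda>g w. hd w)"
proof (rule feas_copy)
  fix vs :: "nat list" and z assume "slots (Suc r) vs z"
  then show "\<exists>a. \<forall>g s. ctx_state g s \<longrightarrow> reg s a = hd (map (reg s) vs)"
    by (intro exI[of _ "hd vs"]) (auto simp: slots_def hd_map length_Suc_conv)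
qed

text \<open>Weakening: as with de Bruijn indices, \<open>hd w\<close> is the innermost bound
  variable and \<open>tl w\<close> lists the outer ones.\<close>

lemma feas_tl:
  assumes "feas r F"
  shows "feas (Suc r) (\<lambda>g w. F g (tl w))"
proof -
  from assms obtain T where T: "poly_bound T" "feas_in T r F"
    using feasE by blast
  show ?thesis
  proof (rule feasI[OF T(1)])
    fix vs :: "nat list" and z :: nat
    assume "slots (Suc r) vs z"
    then have "slots r (tl vs) z" by (cases vs) (auto simp: slots_def)
    from T(2) this obtain c where "evaluates c z (tl vs) T F" by (rule feas_inE)
    then show "\<exists>c. evaluates c z vs T (\<lambda>g w. F g (tl w))"
      unfolding evaluates_def map_tl by blast
  qed
qed

text \<open>The second operand is evaluated with \<open>Suc z\<close> in place of \<open>z\<close>,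
  so the first one survives in register \<open>z\<close>.\<close>

lemma feas_binary:
  assumes F: "feas r F" and G: "feas r G"
    and op: "\<And>z. 5 \<le> z \<Longrightarrow> \<exists>c. \<forall>g s. ctx_state g s \<longrightarrow> (\<exists>s'. runs c z 1 s s' \<and>
      reg s' z = h g (reg s z) (reg s (Suc z)) \<and> out_tape s' = out_tape s)"
  shows "feas r (\<lambda>g w. h g (F g w) (G g w))"
proof -
  from F obtain T where T: "poly_bound T" "feas_in T r F"
    using feasE by blast
  from G obtain U where U: "poly_bound U" "feas_in U r G"
    using feasE by blast
  have pb: "poly_bound (\<lambda>b. T b + (U b + 1))" by (intro poly_bound_intros T U)
  show ?thesis
  proof (rule feasI[OF pb])
    fix vs :: "nat list" and z :: nat
    assume vs: "slots r vs z"
    note vs1 = slotsD(4)[OF vs]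
    obtain c where c: "evaluates c z vs T F"
      by (rule feas_inE[OF T(2) vs])
    obtain d where d: "evaluates d (Suc z) vs U G"
      by (rule feas_inE[OF U(2) vs1])
    from op[OF slotsD(3)[OF vs]] obtain e where e: "\<And>g s. ctx_state g s \<Longrightarrow> \<exists>s'. runs e z 1 s s' \<and>
      reg s' z = h g (reg s z) (reg s (Suc z)) \<and> out_tape s' = out_tape s" by blast
    have "evaluates (Seq c (Seq d e)) z vs (\<lambda>b. T b + (U b + 1)) (\<lambda>g w. h g (F g w) (G g w))"
      unfolding evaluates_def
    proof (intro allI impI)
      fix g s assume s: "ctx_state g s"
      from evaluatesE[OF c s vs] obtain s1 where 1: "runs c z (T (bnd g)) s s1"
        "reg s1 z = F g (map (reg s) vs)" "out_tape s1 = out_tape s" "ctx_state g s1"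
        "map (reg s1) vs = map (reg s) vs" .
      from evaluatesE[OF d 1(4) vs1] obtain s2 where 2: "runs d (Suc z) (U (bnd g)) s1 s2"
        "reg s2 (Suc z) = G g (map (reg s1) vs)" "out_tape s2 = out_tape s1" "ctx_state g s2" .
      have z: "reg s2 z = reg s1 z" using 2(1) unfolding runs_def by simp
      from e[OF 2(4)] obtain s3 where 3: "runs e z 1 s2 s3"
        "reg s3 z = h g (reg s2 z) (reg s2 (Suc z))" "out_tape s3 = out_tape s2" by blast
      from runs_mono[OF 2(1), of z] have "runs d z (U (bnd g)) s1 s2" by simp
      from runs_Seq[OF 1(1) runs_Seq[OF this 3(1)]]
      show "\<exists>s'. runs (Seq c (Seq d e)) z (T (bnd g) + (U (bnd g) + 1)) s s' \<and>
        reg s' z = h g (F g (map (reg s) vs)) (G g (map (reg s) vs)) \<and> out_tape s' = out_tape s"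
        using 1(2,3) 2(2,3) 3(2,3) z unfolding 1(5) by (intro exI[of _ s3]) simp
    qed
    then show "\<exists>c. evaluates c z vs (\<lambda>b. T b + (U b + 1)) (\<lambda>g w. h g (F g w) (G g w))" by blast
  qed
qed

lemma feas_add: "feas r F \<Longrightarrow> feas r G \<Longrightarrow> feas r (\<lambda>g w. F g w + G g w)"
  by (rule feas_binary[where h = "\<lambda>_. (+)"], assumption+, intro exI allI impI conjI,
      rule runs_Add[OF order_refl]) auto

lemma feas_sub: "feas r F \<Longrightarrow> feas r G \<Longrightarrow> feas r (\<lambda>g w. F g w - G g w)"
  by (rule feas_binary[where h = "\<lambda>_. (-)"], assumption+, intro exI allI impI conjI,
      rule runs_Sub[OF order_refl]) auto

lemma feas_bit: "feas r F \<Longrightarrow> feas r (\<lambda>g w. of_bool (F g w < len g \<and> inp g ! F g w))"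
  by (rule feas_binary[where h = "\<lambda>g a _. of_bool (a < len g \<and> inp g ! a)" and G = F],
      assumption+, intro exI allI impI conjI, rule runs_Load[OF order_refl]) (auto simp: ctx_state_def)

lemma feas_if:
  assumes P: "feas r (\<lambda>g w. of_bool (P g w))" and F: "feas r F" and G: "feas r G"
  shows "feas r (\<lambda>g w. if P g w then F g w else G g w)"
proof -
  from P obtain S where S: "poly_bound S" "feas_in S r (\<lambda>g w. of_bool (P g w))"
    using feasE by blast
  from F obtain T where T: "poly_bound T" "feas_in T r F"
    using feasE by blast
  from G obtain U where U: "poly_bound U" "feas_in U r G"
    using feasE by blast
  have pb: "poly_bound (\<lambda>b. S b + (T b + U b + 1))" by (intro poly_bound_intros S T U)
  show ?thesis
  proof (rule feasI[OF pb])
    fix vs :: "nat list" and z :: nat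
    assume vs: "slots r vs z"
    obtain c where c: "evaluates c z vs S (\<lambda>g w. of_bool (P g w))"
      by (rule feas_inE[OF S(2) vs])
    obtain d where d: "evaluates d z vs T F"
      by (rule feas_inE[OF T(2) vs])
    obtain e where e: "evaluates e z vs U G"
      by (rule feas_inE[OF U(2) vs])
    have "evaluates (Seq c (Cond z d e)) z vs (\<lambda>b. S b + (T b + U b + 1))
        (\<lambda>g w. if P g w then F g w else G g w)"
      unfolding evaluates_def
    proof (intro allI impI)
      fix g s assume s: "ctx_state g s"
      define w where "w = map (reg s) vs"
      from evaluatesE[OF c s vs] obtain s1 where 1: "runs c z (S (bnd g)) s s1"
        "reg s1 z = of_bool (P g w)" "out_tape s1 = out_tape s" "ctx_state g s1" "map (reg s1) vs = w"
        unfolding w_def .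
      have "\<exists>s'. runs (Cond z d e) z (T (bnd g) + U (bnd g) + 1) s1 s' \<and>
          reg s' z = (if P g w then F g w else G g w) \<and> out_tape s' = out_tape s1"
      proof (cases "P g w")
        case True
        from evaluatesE[OF d 1(4) vs] obtain s2 where 2: "runs d z (T (bnd g)) s1 s2"
          "reg s2 z = F g w" "out_tape s2 = out_tape s1" unfolding 1(5) .
        have "runs d z (T (bnd g) + U (bnd g)) s1 s2" by (rule runs_mono[OF 2(1)]) auto
        then show ?thesis using True 1(2) 2 by (intro exI[of _ s2] conjI runs_Cond) simp_all
      next
        case False
        from evaluatesE[OF e 1(4) vs] obtain s2 where 2: "runs e z (U (bnd g)) s1 s2"
          "reg s2 z = G g w" "out_tape s2 = out_tape s1" unfolding 1(5) .
        have "runs e z (T (bnd g) + U (bnd g)) s1 s2" by (rule runs_mono[OF 2(1)]) auto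
        then show ?thesis using False 1(2) 2 by (intro exI[of _ s2] conjI runs_Cond) simp_all
      qed
      then show "\<exists>s'. runs (Seq c (Cond z d e)) z (S (bnd g) + (T (bnd g) + U (bnd g) + 1)) s s' \<and>
        reg s' z = (if P g (map (reg s) vs) then F g (map (reg s) vs) else G g (map (reg s) vs)) \<and>
        out_tape s' = out_tape s"
        using runs_Seq[OF 1(1)] 1(3) unfolding w_def by fastforce
    qed
    then show "\<exists>c. evaluates c z vs (\<lambda>b. S b + (T b + U b + 1))
        (\<lambda>g w. if P g w then F g w else G g w)" by blast
  qed
qed

text \<open>Register \<open>z\<close> counts down to 0 while the index of the invariant counts up.
  The body works above \<open>z\<close> and cannot disturb the counter. The 2 in each round is the
  decrement and the loop test.\<close>

lemma runs_while:
  assumes body: "\<And>i s. i < n \<Longrightarrow> I i s \<Longrightarrow> \<exists>s'. runs c (Suc z) T s s' \<and>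
      I (Suc i) (s'\<lparr>reg := (reg s')(z := reg s' z - 1)\<rparr>)"
    and "I 0 s" "reg s z = n" "reg s 3 = 1" "3 < z"
  shows "\<exists>s'. runs (While z (Seq c (Sub z z 3))) z (n * (T + 2) + 1) s s' \<and> I n s'"
proof -
  have "\<exists>s'. runs (While z (Seq c (Sub z z 3))) z (m * (T + 2) + 1) s s' \<and> I n s'"
    if "m + i = n" "I i s" "reg s z = m" "reg s 3 = 1" for m i s
    using that
  proof (induction m arbitrary: i s)
    case 0
    then show ?case unfolding runs_def by (auto intro!: exI[of _ s] exec_WhileF exI[of _ 1])
  next
    case (Suc m)
    from body[of i s] Suc.prems obtain s1 where 1: "runs c (Suc z) T s s1"
      "I (Suc i) (s1\<lparr>reg := (reg s1)(z := reg s1 z - 1)\<rparr>)" by auto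
    let ?s = "s1\<lparr>reg := (reg s1)(z := reg s1 z - 1)\<rparr>"
    have z: "reg s1 z = Suc m" and three: "reg s1 3 = 1"
      using 1(1) Suc.prems \<open>3 < z\<close> unfolding runs_def by auto
    from Suc.IH[of "Suc i" ?s] Suc.prems 1(2) z three \<open>3 < z\<close>
    obtain s' where s': "runs (While z (Seq c (Sub z z 3))) z (m * (T + 2) + 1) ?s s'" "I n s'"
      by auto
    have "runs (Sub z z 3) z 1 s1 ?s"
      using runs_Sub[OF order_refl, of z z 3 s1] three by simp
    with runs_mono[OF 1(1), of z T] have "runs (Seq c (Sub z z 3)) z (T + 1) s ?s"
      by (intro runs_Seq) auto
    then obtain t1 where t1: "t1 \<le> T + 1" "exec (Seq c (Sub z z 3)) s t1 ?s"
      and eq: "\<And>j. j < z \<Longrightarrow> reg ?s j = reg s j" "mem ?s = mem s"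
      unfolding runs_def by blast
    from s'(1) obtain t2 where t2: "t2 \<le> m * (T + 2) + 1" "exec (While z (Seq c (Sub z z 3))) ?s t2 s'"
      and eq': "\<And>j. j < z \<Longrightarrow> reg s' j = reg ?s j" "mem s' = mem ?s"
      unfolding runs_def by blast
    have "exec (While z (Seq c (Sub z z 3))) s (Suc (t1 + t2)) s'"
      using Suc.prems t1 t2 by (intro exec_WhileT) auto
    then have "runs (While z (Seq c (Sub z z 3))) z (Suc m * (T + 2) + 1) s s'"
      unfolding runs_def using t1(1) t2(1) eq eq' by (intro conjI exI) auto
    with s'(2) show ?case by blast
  qed
  from this[of n 0 s] assms show ?thesis by simp
qed

lemma ctx_state_upd: "5 \<le> z \<Longrightarrow> ctx_state g (s\<lparr>reg := (reg s)(z := v)\<rparr>) = ctx_state g s"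
  by (simp add: ctx_state_def)

text \<open>Under unit cost, repeated doubling can make values exponential in the running time, so
  \<open>feas\<close> does not bound them. Numbers of loop rounds and numbers written in unary need
  this separate bound.\<close>

definition small :: "(ctx \<Rightarrow> nat list \<Rightarrow> nat) \<Rightarrow> bool" where
  "small B \<longleftrightarrow> (\<exists>V. poly_bound V \<and>
     (\<forall>g w. len g \<le> bnd g \<longrightarrow> par g \<le> bnd g \<longrightarrow> B g w \<le> V (bnd g)))"

lemma smallE:
  assumes "small B"
  obtains V where "poly_bound V" "\<And>g s w. ctx_state g s \<Longrightarrow> B g w \<le> V (bnd g)"
  using assms unfolding small_def ctx_state_def by blast

lemma small_const: "small (\<lambda>g w. n)"
  unfolding small_def using poly_bound_const[of n] by blast

lemma small_len: "small (\<lambda>g w. len g)"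
  and small_par: "small (\<lambda>g w. par g)"
  and small_bnd: "small (\<lambda>g w. bnd g)"
  unfolding small_def using poly_bound_id by blast+

lemma small_add:
  assumes "small A" "small B"
  shows "small (\<lambda>g w. A g w + B g w)"
proof -
  from assms obtain V W where VW: "poly_bound V" "poly_bound W"
    and *: "\<And>g w. len g \<le> bnd g \<Longrightarrow> par g \<le> bnd g \<Longrightarrow> A g w \<le> V (bnd g) \<and> B g w \<le> W (bnd g)"
    unfolding small_def by metis
  show ?thesis
    unfolding small_def
    by (rule exI[of _ "\<lambda>b. V b + W b"]) (use * VW in \<open>auto intro!: poly_bound_add add_mono\<close>)
qed

lemma small_mult:
  assumes "small A" "small B"
  shows "small (\<lambda>g w. A g w * B g w)"
proof -
  from assms obtain V W where VW: "poly_bound V" "poly_bound W"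
    and *: "\<And>g w. len g \<le> bnd g \<Longrightarrow> par g \<le> bnd g \<Longrightarrow> A g w \<le> V (bnd g) \<and> B g w \<le> W (bnd g)"
    unfolding small_def by metis
  show ?thesis
    unfolding small_def
    by (rule exI[of _ "\<lambda>b. V b * W b"]) (use * VW in \<open>auto intro!: poly_bound_mult mult_mono\<close>)
qed

lemma small_le:
  assumes "small A" "\<And>g w. B g w \<le> A g w"
  shows "small B"
  using assms unfolding small_def by (meson order_trans)

text \<open>The one rule that creates loops for values; sums, quantifiers and products are derived
  from it. Register \<open>z\<close> is the loop counter, the next two hold the accumulator and the
  index, and the step is evaluated above them.\<close>

lemma feas_rec:
  assumes A: "feas r A" and B: "feas r B" "small B"
    and S: "feas (Suc (Suc r)) (\<lambda>g w. S g (tl (tl w)) (hd (tl w)) (hd w))"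
  shows "feas r (\<lambda>g w. rec_nat (A g w) (S g w) (B g w))"
proof -
  from A obtain T where T: "poly_bound T" "feas_in T r A"
    using feasE by blast
  from B obtain U where U: "poly_bound U" "feas_in U r B"
    using feasE by blast
  from S obtain W where W: "poly_bound W" "feas_in W (Suc (Suc r)) (\<lambda>g w. S g (tl (tl w)) (hd (tl w)) (hd w))"
    using feasE by blast
  from B(2) obtain V where V: "poly_bound V" "\<And>g s w. ctx_state g s \<Longrightarrow> B g w \<le> V (bnd g)"
    using smallE by blast
  define X where "X b = U b + (T b + (1 + ((V b * (W b + (1 + 1) + 2) + 1) + 1)))" for b
  have pb: "poly_bound X"
    unfolding X_def by (intro poly_bound_intros T U W V)
  show ?thesis
  proof (rule feasI[OF pb])
    fix vs :: "nat list" and z :: nat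
    assume vs: "slots r vs z"
    note vs1 = slotsD(4)[OF vs] and z5 = slotsD(3)[OF vs]
    have vs3: "slots (Suc (Suc r)) (Suc z # Suc (Suc z) # vs) (Suc (Suc (Suc z)))"
      using vs unfolding slots_def by auto
    obtain c where c: "evaluates c z vs U B"
      by (rule feas_inE[OF U(2) vs])
    obtain d where d: "evaluates d (Suc z) vs T A"
      by (rule feas_inE[OF T(2) vs1])
    obtain e where e: "evaluates e (Suc (Suc (Suc z))) (Suc z # Suc (Suc z) # vs) W
      (\<lambda>g w. S g (tl (tl w)) (hd (tl w)) (hd w))"
      by (rule feas_inE[OF W(2) vs3])
    let ?b = "Seq e (Seq (Add (Suc z) (Suc (Suc (Suc z))) 4) (Add (Suc (Suc z)) (Suc (Suc z)) 3))"
    let ?w = "While z (Seq ?b (Sub z z 3))"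
    let ?p = "Seq c (Seq d (Seq (Const (Suc (Suc z)) 0) (Seq ?w (Add z (Suc z) 4))))"
    have "evaluates ?p z vs X (\<lambda>g w. rec_nat (A g w) (S g w) (B g w))"
      unfolding evaluates_def
    proof (intro allI impI)
      fix g s assume s: "ctx_state g s"
      define w where "w = map (reg s) vs"
      define f where "f = rec_nat (A g w) (S g w)"
      from evaluatesE[OF c s vs] obtain s1 where 1: "runs c z (U (bnd g)) s s1"
        "reg s1 z = B g w" "out_tape s1 = out_tape s" "ctx_state g s1" "map (reg s1) vs = w"
        unfolding w_def .
      from evaluatesE[OF d 1(4) vs1] obtain s2 where 2: "runs d (Suc z) (T (bnd g)) s1 s2"
        "reg s2 (Suc z) = A g w" "out_tape s2 = out_tape s1" "ctx_state g s2" "map (reg s2) vs = w"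
        unfolding 1(5) .
      from runs_mono[OF 2(1), of z] have r2: "runs d z (T (bnd g)) s1 s2" by simp
      have z2: "reg s2 z = B g w" using 2(1) 1(2) unfolding runs_def by simp
      let ?s3 = "s2\<lparr>reg := (reg s2)(Suc (Suc z) := 0)\<rparr>"
      have r3: "runs (Const (Suc (Suc z)) 0) z 1 s2 ?s3" by (rule runs_Const) simp
      define I where "I i u \<longleftrightarrow> reg u (Suc z) = f i \<and> reg u (Suc (Suc z)) = i \<and>
        ctx_state g u \<and> map (reg u) vs = w \<and> out_tape u = out_tape s" for i u
      have "\<exists>s'. runs ?w z (B g w * ((W (bnd g) + (1 + 1)) + 2) + 1) ?s3 s' \<and> I (B g w) s'"
      proof (rule runs_while)
        fix i u assume I: "I i u"
        then have u: "ctx_state g u" unfolding I_def by simp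
        from evaluatesE[OF e u vs3] I obtain u1
          where u1: "runs e (Suc (Suc (Suc z))) (W (bnd g)) u u1" "ctx_state g u1"
          "reg u1 (Suc (Suc (Suc z))) = f (Suc i)" "out_tape u1 = out_tape s" "map (reg u1) vs = w"
          "reg u1 (Suc (Suc z)) = i"
          unfolding I_def f_def by auto
        let ?u2 = "u1\<lparr>reg := (reg u1)(Suc z := reg u1 (Suc (Suc (Suc z))) + reg u1 4)\<rparr>"
        let ?u3 = "?u2\<lparr>reg := (reg ?u2)(Suc (Suc z) := reg ?u2 (Suc (Suc z)) + reg ?u2 3)\<rparr>"
        have "runs e (Suc z) (W (bnd g)) u u1" using runs_mono[OF u1(1)] by simp
        then have r: "runs ?b (Suc z) (W (bnd g) + (1 + 1)) u ?u3"
          by (rule runs_Seq[OF _ runs_Seq[OF runs_Add runs_Add]]) simp_all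
        have 4: "reg u1 4 = 0" "reg u1 3 = 1" using u1(2) unfolding ctx_state_def by auto
        have "I (Suc i) (?u3\<lparr>reg := (reg ?u3)(z := reg ?u3 z - 1)\<rparr>)"
          unfolding I_def using u1 4 z5 slotsD(6-8)[OF vs] by (auto simp: ctx_state_def)
        then show "\<exists>s'. runs ?b (Suc z) (W (bnd g) + (1 + 1)) u s' \<and>
            I (Suc i) (s'\<lparr>reg := (reg s')(z := reg s' z - 1)\<rparr>)"
          using r by blast
      next
        show "I 0 ?s3"
          unfolding I_def using 1 2 z5 slotsD(6-8)[OF vs] ctx_state_upd[of "Suc (Suc z)"] by (auto simp: f_def)
      qed (use z2 2 z5 in \<open>auto simp: ctx_state_def\<close>)
      moreover have "B g w * ((W (bnd g) + (1 + 1)) + 2) + 1 \<le> V (bnd g) * (W (bnd g) + (1 + 1) + 2) + 1"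
        using V(2)[OF s, of w] by (intro add_mono mult_mono) auto
      ultimately obtain s4 where s4: "runs ?w z (V (bnd g) * (W (bnd g) + (1 + 1) + 2) + 1) ?s3 s4" "I (B g w) s4"
        using runs_mono[OF _ order_refl] by blast
      let ?s5 = "s4\<lparr>reg := (reg s4)(z := reg s4 (Suc z) + reg s4 4)\<rparr>"
      have "runs ?p z (X (bnd g)) s ?s5"
        unfolding X_def by (intro runs_Seq[OF 1(1)] runs_Seq[OF r2] runs_Seq[OF r3] runs_Seq[OF s4(1)] runs_Add) simp
      then show "\<exists>s'. runs ?p z (X (bnd g)) s s' \<and>
        reg s' z = rec_nat (A g (map (reg s) vs)) (S g (map (reg s) vs)) (B g (map (reg s) vs)) \<and>
        out_tape s' = out_tape s"
        using s4(2) unfolding I_def ctx_state_def f_def w_def[symmetric] by (intro exI[of _ ?s5]) auto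
    qed
    then show "\<exists>c. evaluates c z vs X (\<lambda>g w. rec_nat (A g w) (S g w) (B g w))" by blast
  qed
qed


section \<open>Predicates, bounded sums and bounded quantifiers\<close>

lemma feas_cong:
  assumes "feas r F" "\<And>g w. F g w = G g w"
  shows "feas r G"
proof -
  from assms(2) have "F = G" by (intro ext)
  with assms(1) show ?thesis by simp
qed

abbreviation feasp :: "nat \<Rightarrow> (ctx \<Rightarrow> nat list \<Rightarrow> bool) \<Rightarrow> bool" where
  "feasp r P \<equiv> feas r (\<lambda>g w. of_bool (P g w))"

text \<open>With truncated subtraction, \<open>1 - (1 - (b - a))\<close> is 1 if
  \<open>a < b\<close> and 0 otherwise.\<close>

lemma feasp_less: "feas r F \<Longrightarrow> feas r G \<Longrightarrow> feasp r (\<lambda>g w. F g w < G g w)"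
  by (rule feas_cong[OF feas_sub[OF feas_const[of r 1] feas_sub[OF feas_const[of r 1] feas_sub[of r G F]]]]) auto

lemma feasp_not: "feasp r P \<Longrightarrow> feasp r (\<lambda>g w. \<not> P g w)"
  by (rule feas_cong[OF feas_sub[OF feas_const[of r 1]]]) auto

lemma feasp_conj: "feasp r P \<Longrightarrow> feasp r Q \<Longrightarrow> feasp r (\<lambda>g w. P g w \<and> Q g w)"
  by (rule feas_cong[OF feas_if[OF _ _ feas_const[of r 0], of P "\<lambda>g w. of_bool (Q g w)"]]) auto

lemma feasp_disj: "feasp r P \<Longrightarrow> feasp r Q \<Longrightarrow> feasp r (\<lambda>g w. P g w \<or> Q g w)"
  by (rule feas_cong[OF feas_if[OF _ feas_const[of r 1], of P "\<lambda>g w. of_bool (Q g w)"]]) auto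

lemma feasp_imp: "feasp r P \<Longrightarrow> feasp r Q \<Longrightarrow> feasp r (\<lambda>g w. P g w \<longrightarrow> Q g w)"
  by (rule feas_cong[OF feas_if[OF _ _ feas_const[of r 1], of P "\<lambda>g w. of_bool (Q g w)"]]) auto

lemma feasp_if: "feasp r P \<Longrightarrow> feasp r Q \<Longrightarrow> feasp r R \<Longrightarrow>
    feasp r (\<lambda>g w. if P g w then Q g w else R g w)"
  by (rule feas_cong[OF feas_if[of r P "\<lambda>g w. of_bool (Q g w)" "\<lambda>g w. of_bool (R g w)"]]) auto

lemma feasp_le: "feas r F \<Longrightarrow> feas r G \<Longrightarrow> feasp r (\<lambda>g w. F g w \<le> G g w)"
  unfolding not_less[symmetric] by (intro feasp_not feasp_less)

lemma feasp_eq: "feas r F \<Longrightarrow> feas r G \<Longrightarrow> feasp r (\<lambda>g w. F g w = G g w)"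
  unfolding eq_iff by (intro feasp_conj feasp_le)

lemma feas_min: "feas r F \<Longrightarrow> feas r G \<Longrightarrow> feas r (\<lambda>g w. min (F g w) (G g w))"
  unfolding min_def by (intro feas_if feasp_le)

lemma feas_sum:
  assumes "feas r B" "small B" "feas (Suc r) (\<lambda>g w. F g (tl w) (hd w))"
  shows "feas r (\<lambda>g w. \<Sum>i<B g w. F g w i)"
proof -
  have *: "rec_nat 0 (\<lambda>i a. a + F g w i) n = (\<Sum>i<n. F g w i)" for g w n
    by (induction n) auto
  have "feas r (\<lambda>g w. rec_nat 0 (\<lambda>i a. a + F g w i) (B g w))"
    by (rule feas_rec) (intro assms feas_const feas_add feas_hd feas_tl[OF assms(3)])+
  then show ?thesis unfolding * .
qed

lemma feasp_ex:
  assumes "feas r B" "small B" "feasp (Suc r) (\<lambda>g w. P g (tl w) (hd w))"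
  shows "feasp r (\<lambda>g w. \<exists>i<B g w. P g w i)"
  by (rule feas_cong[OF feasp_less[OF feas_const[of r 0] feas_sum[OF assms(1,2), of "\<lambda>g w i. of_bool (P g w i)"]]])
    (use assms(3) in \<open>auto simp: sum_eq_0_iff of_bool_def simp flip: neq0_conv\<close>)

lemma feasp_all:
  assumes "feas r B" "small B" "feasp (Suc r) (\<lambda>g w. P g (tl w) (hd w))"
  shows "feasp r (\<lambda>g w. \<forall>i<B g w. P g w i)"
proof -
  have "feasp r (\<lambda>g w. \<not> (\<exists>i<B g w. \<not> P g w i))"
    by (intro feasp_not feasp_ex assms)
  then show ?thesis by simp
qed

text \<open>The machine has no multiplication, so the product is a sum of \<open>F g w\<close> equal
  terms; this is why the first factor has to be small.\<close>

lemma feas_mult: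
  assumes "feas r F" "small F" "feas r G"
  shows "feas r (\<lambda>g w. F g w * G g w)"
  using feas_sum[OF assms(1,2) feas_tl[OF assms(3)]] by simp

section \<open>Writing lists of numbers in unary\<close>

lemma encode_nats_append: "encode_nats (xs @ ys) = encode_nats xs @ encode_nats ys"
  by (simp add: encode_nats_def)

lemma outp_num:
  assumes "feas r F" "small F"
  shows "outp r (\<lambda>g w. [F g w])"
proof -
  from assms obtain T where T: "poly_bound T" "feas_in T r F"
    using feasE by blast
  from assms(2) obtain V where V: "poly_bound V" "\<And>g s w. ctx_state g s \<Longrightarrow> F g w \<le> V (bnd g)"
    using smallE by blast
  define X where "X b = T b + ((V b * (1 + 2) + 1) + 1)" for b
  have pb: "poly_bound X" unfolding X_def by (intro poly_bound_intros T V)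
  show ?thesis
  proof (rule outpI[OF pb])
    fix vs :: "nat list" and z :: nat
    assume vs: "slots r vs z"
    note z5 = slotsD(3)[OF vs]
    obtain c where c: "evaluates c z vs T F"
      by (rule feas_inE[OF T(2) vs])
    let ?w = "While z (Seq (Write 3) (Sub z z 3))"
    have "emits (Seq c (Seq ?w (Write 4))) z vs X (\<lambda>g w. [F g w])"
      unfolding emits_def
    proof (intro allI impI)
      fix g s assume s: "ctx_state g s"
      define w where "w = map (reg s) vs"
      from evaluatesE[OF c s vs] obtain s1 where 1: "runs c z (T (bnd g)) s s1"
        "reg s1 z = F g w" "out_tape s1 = out_tape s" "ctx_state g s1"
        unfolding w_def .
      define I where "I i u \<longleftrightarrow> out_tape u = out_tape s @ replicate i True \<and> ctx_state g u" for i u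
      have "\<exists>s'. runs ?w z (F g w * (1 + 2) + 1) s1 s' \<and> I (F g w) s'"
      proof (rule runs_while)
        show "\<exists>s'. runs (Write 3) (Suc z) 1 u s' \<and> I (Suc i) (s'\<lparr>reg := (reg s')(z := reg s' z - 1)\<rparr>)"
          if "I i u" for i u
          by (intro exI conjI, rule runs_Write)
            (use that z5 in \<open>auto simp: I_def ctx_state_def replicate_append_same simp flip: replicate_Suc\<close>)
      qed (use 1 z5 in \<open>auto simp: ctx_state_def I_def\<close>)
      moreover have "F g w * (1 + 2) + 1 \<le> V (bnd g) * (1 + 2) + 1"
        using V(2)[OF s, of w] by (intro add_mono mult_mono) auto
      ultimately obtain s2 where s2: "runs ?w z (V (bnd g) * (1 + 2) + 1) s1 s2" "I (F g w) s2"
        using runs_mono[OF _ order_refl] by blast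
      show "\<exists>s'. runs (Seq c (Seq ?w (Write 4))) z (X (bnd g)) s s' \<and>
          out_tape s' = out_tape s @ encode_nats [F g (map (reg s) vs)]"
        unfolding X_def
        by (intro exI conjI, rule runs_Seq[OF 1(1) runs_Seq[OF s2(1) runs_Write]])
          (use s2(2) in \<open>simp add: I_def ctx_state_def encode_nats_def w_def\<close>)
    qed
    then show "\<exists>c. emits c z vs X (\<lambda>g w. [F g w])" by blast
  qed
qed

lemma outp_append:
  assumes L: "outp r L" and M: "outp r M"
  shows "outp r (\<lambda>g w. L g w @ M g w)"
proof -
  from L obtain T where T: "poly_bound T" "outp_in T r L"
    using outpE by blast
  from M obtain U where U: "poly_bound U" "outp_in U r M"
    using outpE by blast
  show ?thesis
  proof (rule outpI[OF poly_bound_add[OF T(1) U(1)]])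
    fix vs :: "nat list" and z :: nat
    assume vs: "slots r vs z"
    obtain c where c: "emits c z vs T L"
      by (rule outp_inE[OF T(2) vs])
    obtain d where d: "emits d z vs U M"
      by (rule outp_inE[OF U(2) vs])
    have "emits (Seq c d) z vs (\<lambda>b. T b + U b) (\<lambda>g w. L g w @ M g w)"
      unfolding emits_def
    proof (intro allI impI)
      fix g s assume s: "ctx_state g s"
      from emitsE[OF c s vs] obtain s1 where 1: "runs c z (T (bnd g)) s s1"
        "out_tape s1 = out_tape s @ encode_nats (L g (map (reg s) vs))"
        "ctx_state g s1" "map (reg s1) vs = map (reg s) vs" .
      from emitsE[OF d 1(3) vs] obtain s2 where 2: "runs d z (U (bnd g)) s1 s2"
        "out_tape s2 = out_tape s1 @ encode_nats (M g (map (reg s1) vs))" .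
      show "\<exists>s'. runs (Seq c d) z (T (bnd g) + U (bnd g)) s s' \<and>
          out_tape s' = out_tape s @ encode_nats (L g (map (reg s) vs) @ M g (map (reg s) vs))"
        by (intro exI conjI, rule runs_Seq[OF 1(1) 2(1)])
          (simp add: 2(2)[unfolded 1(4)] 1(2) encode_nats_append)
    qed
    then show "\<exists>c. emits c z vs (\<lambda>b. T b + U b) (\<lambda>g w. L g w @ M g w)" by blast
  qed
qed

lemma outp_concat:
  assumes B: "feas r B" "small B" and L: "outp (Suc r) (\<lambda>g w. L g (tl w) (hd w))"
  shows "outp r (\<lambda>g w. concat (map (L g w) [0..<B g w]))"
proof -
  from B obtain U where U: "poly_bound U" "feas_in U r B"
    using feasE by blast
  from L obtain W where W: "poly_bound W" "outp_in W (Suc r) (\<lambda>g w. L g (tl w) (hd w))"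
    using outpE by blast
  from B(2) obtain V where V: "poly_bound V" "\<And>g s w. ctx_state g s \<Longrightarrow> B g w \<le> V (bnd g)"
    using smallE by blast
  define X where "X b = U b + (1 + (V b * (W b + 1 + 2) + 1))" for b
  have pb: "poly_bound X"
    unfolding X_def by (intro poly_bound_intros U W V)
  show ?thesis
  proof (rule outpI[OF pb])
    fix vs :: "nat list" and z :: nat
    assume vs: "slots r vs z"
    note z5 = slotsD(3)[OF vs]
    have vs2: "slots (Suc r) (Suc z # vs) (Suc (Suc z))"
      using vs unfolding slots_def by auto
    obtain c where c: "evaluates c z vs U B"
      by (rule feas_inE[OF U(2) vs])
    obtain e where e: "emits e (Suc (Suc z)) (Suc z # vs) W
      (\<lambda>g w. L g (tl w) (hd w))"
      by (rule outp_inE[OF W(2) vs2])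
    let ?b = "Seq e (Add (Suc z) (Suc z) 3)"
    let ?w = "While z (Seq ?b (Sub z z 3))"
    let ?p = "Seq c (Seq (Const (Suc z) 0) ?w)"
    have "emits ?p z vs X (\<lambda>g w. concat (map (L g w) [0..<B g w]))"
      unfolding emits_def
    proof (intro allI impI)
      fix g s assume s: "ctx_state g s"
      define w where "w = map (reg s) vs"
      from evaluatesE[OF c s vs] obtain s1 where 1: "runs c z (U (bnd g)) s s1"
        "reg s1 z = B g w" "out_tape s1 = out_tape s" "ctx_state g s1" "map (reg s1) vs = w"
        unfolding w_def .
      let ?s2 = "s1\<lparr>reg := (reg s1)(Suc z := 0)\<rparr>"
      have r2: "runs (Const (Suc z) 0) z 1 s1 ?s2" by (rule runs_Const) simp
      define I where "I i u \<longleftrightarrow> reg u (Suc z) = i \<and> ctx_state g u \<and> map (reg u) vs = w \<and>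
        out_tape u = out_tape s @ encode_nats (concat (map (L g w) [0..<i]))" for i u
      have "\<exists>s'. runs ?w z (B g w * ((W (bnd g) + 1) + 2) + 1) ?s2 s' \<and> I (B g w) s'"
      proof (rule runs_while)
        fix i u assume I: "I i u"
        then have u: "ctx_state g u" unfolding I_def by simp
        from emitsE[OF e u vs2] I obtain u1
          where u1: "runs e (Suc (Suc z)) (W (bnd g)) u u1" "ctx_state g u1"
          "out_tape u1 = out_tape s @ encode_nats (concat (map (L g w) [0..<Suc i]))" "map (reg u1) vs = w"
          "reg u1 (Suc z) = i"
          unfolding I_def by (auto simp: encode_nats_append)
        let ?u2 = "u1\<lparr>reg := (reg u1)(Suc z := reg u1 (Suc z) + reg u1 3)\<rparr>"
        have "runs e (Suc z) (W (bnd g)) u u1" using runs_mono[OF u1(1)] by simp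
        then have r: "runs ?b (Suc z) (W (bnd g) + 1) u ?u2"
          by (rule runs_Seq[OF _ runs_Add]) simp_all
        have 3: "reg u1 3 = 1" using u1(2) unfolding ctx_state_def by auto
        have "I (Suc i) (?u2\<lparr>reg := (reg ?u2)(z := reg ?u2 z - 1)\<rparr>)"
          unfolding I_def using u1 3 z5 slotsD(6-8)[OF vs] by (auto simp: ctx_state_def)
        then show "\<exists>s'. runs ?b (Suc z) (W (bnd g) + 1) u s' \<and>
            I (Suc i) (s'\<lparr>reg := (reg s')(z := reg s' z - 1)\<rparr>)"
          using r by blast
      next
        show "I 0 ?s2"
          unfolding I_def using 1 z5 slotsD(6-8)[OF vs] ctx_state_upd[of "Suc z"]
          by (auto simp: encode_nats_def)
      qed (use 1 z5 in \<open>auto simp: ctx_state_def\<close>)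
      moreover have "B g w * ((W (bnd g) + 1) + 2) + 1 \<le> V (bnd g) * (W (bnd g) + 1 + 2) + 1"
        using V(2)[OF s, of w] by (intro add_mono mult_mono) auto
      ultimately obtain s3 where s3: "runs ?w z (V (bnd g) * (W (bnd g) + 1 + 2) + 1) ?s2 s3" "I (B g w) s3"
        using runs_mono[OF _ order_refl] by blast
      have "runs ?p z (X (bnd g)) s s3"
        unfolding X_def by (intro runs_Seq[OF 1(1)] runs_Seq[OF r2] s3(1))
      then show "\<exists>s'. runs ?p z (X (bnd g)) s s' \<and>
          out_tape s' = out_tape s @ encode_nats (concat (map (L g (map (reg s) vs)) [0..<B g (map (reg s) vs)]))"
        using s3(2) unfolding I_def w_def[symmetric] by blast
    qed
    then show "\<exists>c. emits c z vs X (\<lambda>g w. concat (map (L g w) [0..<B g w]))" by blast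
  qed
qed

text \<open>\<open>small\<close> speaks of all lists of variables, but \<open>F\<close> is bounded
  by \<open>V\<close> only at indices below \<open>B\<close>. Capping \<open>F\<close> by
  \<open>V\<close> makes it small everywhere and changes nothing at these indices.\<close>

lemma outp_map:
  assumes "feas r B" "small B" "feas (Suc r) (\<lambda>g w. F g (tl w) (hd w))"
    and "small V" "\<And>g w i. i < B g w \<Longrightarrow> F g w i \<le> V g w" "feas (Suc r) (\<lambda>g w. V g (tl w))"
  shows "outp r (\<lambda>g w. map (F g w) [0..<B g w])"
proof -
  have small: "small (\<lambda>g w. min (F g (tl w) (hd w)) (V g (tl w)))"
    using assms(4) unfolding small_def by (meson min.cobounded2 order_trans)
  have *: "outp r (\<lambda>g w. concat (map (\<lambda>i. [min (F g w i) (V g w)]) [0..<B g w]))"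
    by (rule outp_concat[OF assms(1,2) outp_num[OF feas_min[OF assms(3,6)] small]])
  have **: "concat (map (\<lambda>i. [min (F g w i) (V g w)]) [0..<B g w]) = map (F g w) [0..<B g w]" for g w
    unfolding concat_map_singleton using assms(5) by (intro map_cong refl) (simp add: min_def)
  from * show ?thesis unfolding ** .
qed

section \<open>The bound of the context and the resulting reductions\<close>

primrec iterbnd :: "nat \<Rightarrow> nat \<Rightarrow> nat" where
  "iterbnd 0 N = N"
| "iterbnd (Suc j) N = 4 * iterbnd j N * iterbnd j N"

text \<open>The summand 4 keeps the vertex types 0 to 3 below the base even for the empty
  input.\<close>

abbreviation "bound_of j x k \<equiv> iterbnd j (length x + k + 4)"

lemma iterbnd_mono: "1 \<le> N \<Longrightarrow> iterbnd j N \<le> iterbnd (Suc j) N \<and> 1 \<le> iterbnd j N"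
  by (induction j) auto

text \<open>Each level squares four times the bound, so for constant \<open>j\<close> the bound is
  polynomial.\<close>

lemma iterbnd_closed: "4 * iterbnd j N = (4 * N) ^ (2 ^ j)"
proof (induction j)
  case (Suc j)
  have "4 * iterbnd (Suc j) N = (4 * iterbnd j N) * (4 * iterbnd j N)" by simp
  also have "\<dots> = (4 * N) ^ (2 ^ j + 2 ^ j)" unfolding Suc power_add ..
  finally show ?case by (simp add: mult_2)
qed simp

text \<open>\<open>j\<close> is a constant of the program, which contains one copy of the
  multiplication for each level. The bound only grows, so the time of earlier levels is polynomial
  in the final bound as well.\<close>

lemma exec_set_bound:
  "\<exists>c K D. \<forall>x k. \<exists>t s. exec c (init_state x k) t s \<and>
     t \<le> K * (bound_of j x k + 1) ^ D \<and> ctx_state (x, k, bound_of j x k) s \<and>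
     out_tape s = []"
proof (induction j)
  case 0
  let ?c = "Seq (Add 2 0 1) (Seq (Const 3 1) (Seq (Const 4 4) (Seq (Add 2 2 4) (Const 4 0))))"
  have "\<exists>t s. exec ?c (init_state x k) t s \<and>
     t \<le> 5 * (bound_of 0 x k + 1) ^ 0 \<and> ctx_state (x, k, bound_of 0 x k) s \<and>
     out_tape s = []" for x k
    by (intro exI conjI, rule exec_Seq[OF exec_Add exec_Seq[OF exec_Const exec_Seq[OF exec_Const
          exec_Seq[OF exec_Add exec_Const]]]]) (auto simp: init_state_def ctx_state_def)
  then show ?case by blast
next
  case (Suc j)
  then obtain c K D where c: "\<And>x k. \<exists>t s. exec c (init_state x k) t s \<and>
     t \<le> K * (bound_of j x k + 1) ^ D \<and> ctx_state (x, k, bound_of j x k) s \<and>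
     out_tape s = []" by blast
  have "feas 0 (\<lambda>g w. 4 * bnd g * bnd g)"
    by (intro feas_mult feas_const feas_bnd small_mult small_const small_bnd)
  then obtain T where T: "poly_bound T" "feas_in T 0 (\<lambda>g w. 4 * bnd g * bnd g)"
    using feasE by blast
  have slots: "slots 0 [] 5" by (simp add: slots_def)
  obtain d where d: "evaluates d 5 [] T (\<lambda>g w. 4 * bnd g * bnd g)"
      by (rule feas_inE[OF T(2) slots])
  from T(1) have "poly_bound (\<lambda>b. K * (b + 1) ^ D + (T b + 1))"
    by (intro poly_bound_add poly_bound_power poly_bound_const)
  then obtain L E where LE: "\<And>b. K * (b + 1) ^ D + (T b + 1) \<le> L * (b + 1) ^ E"
    unfolding poly_bound_def by blast
  have "\<exists>t s. exec (Seq c (Seq d (Add 2 5 4))) (init_state x k) t s \<and>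
     t \<le> L * (bound_of (Suc j) x k + 1) ^ E \<and>
     ctx_state (x, k, bound_of (Suc j) x k) s \<and> out_tape s = []" for x k
  proof -
    define N where "N = bound_of j x k"
    have N: "N \<le> 4 * N * N" "1 \<le> N"
      using iterbnd_mono[of "length x + k + 4" j] unfolding N_def by auto
    from c[of x k] obtain t s where 1: "exec c (init_state x k) t s" "t \<le> K * (N + 1) ^ D"
      "ctx_state (x, k, N) s" "out_tape s = []" unfolding N_def by blast
    from evaluatesE[OF d 1(3) slots] obtain s' where 2: "runs d 5 (T N) s s'" "reg s' 5 = 4 * N * N"
      "out_tape s' = out_tape s" "ctx_state (x, k, N) s'" by auto
    from 2(1) obtain t' where t': "t' \<le> T N" "exec d s t' s'" unfolding runs_def by blast
    have "t + (t' + 1) \<le> K * (N + 1) ^ D + (T N + 1)" using 1 t' by simp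
    also note LE[of N]
    also have "L * (N + 1) ^ E \<le> L * (4 * N * N + 1) ^ E"
      using N by (intro mult_left_mono power_mono) auto
    finally have "t + (t' + 1) \<le> L * (bound_of (Suc j) x k + 1) ^ E"
      unfolding N_def by simp
    moreover have "ctx_state (x, k, bound_of (Suc j) x k) (s'\<lparr>reg := (reg s')(2 := reg s' 5 + reg s' 4)\<rparr>)"
      using 2(2,4) order_trans[OF _ N(1)] unfolding ctx_state_def by (simp add: N_def[symmetric])
    ultimately show ?thesis
      using exec_Seq[OF 1(1) exec_Seq[OF t'(2) exec_Add]] 1(4) 2(3) by fastforce
  qed
  then show ?case by blast
qed

theorem fpt_reducibleI:
  assumes L: "outp 0 (\<lambda>g w. L g)"
    and iff: "\<And>x k. (x, k) \<in> A \<longleftrightarrow> (encode_nats (L (x, k, bound_of j x k)), Suc k) \<in> B"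
  shows "fpt_reducible A B"
proof -
  obtain c K D where c: "\<And>x k. \<exists>t s. exec c (init_state x k) t s \<and>
     t \<le> K * (bound_of j x k + 1) ^ D \<and> ctx_state (x, k, bound_of j x k) s \<and>
     out_tape s = []" using exec_set_bound by blast
  from L obtain T where T: "poly_bound T" "outp_in T 0 (\<lambda>g w. L g)"
    using outpE by blast
  have slots: "slots 0 [] 5" by (simp add: slots_def)
  obtain d where d: "emits d 5 [] T (\<lambda>g w. L g)"
      by (rule outp_inE[OF T(2) slots])
  from T(1) have "poly_bound (\<lambda>b. K * (b + 1) ^ D + (T b + 1))"
    by (intro poly_bound_add poly_bound_power poly_bound_const)
  then obtain M E where ME: "\<And>b. K * (b + 1) ^ D + (T b + 1) \<le> M * (b + 1) ^ E"
    unfolding poly_bound_def by blast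
  define e where "e = 2 ^ j * E"
  \<comment> \<open>\<open>4 * (n + k + 4) + 1 \<le> 17 * (k + 1) * (n + 1)\<close> splits the bound
    into a factor depending on \<open>k\<close> and one depending on the length
    \<open>n\<close>.\<close>
  define f where "f k = M * (17 * (k + 1)) ^ e" for k :: nat
  have "computable (\<lambda>k. M * (17 * (k + 1)) ^ e)"
    by (intro computable_mult computable_const computable_power computable_add computable_id)
  then have f: "computable f" unfolding f_def .
  have "\<exists>t x' k'. computes_in (Seq c (Seq d (Add 1 1 3))) x k t x' k' \<and>
      t \<le> f k * (length x + 1) ^ e \<and> k' \<le> Suc k \<and> ((x, k) \<in> A \<longleftrightarrow> (x', k') \<in> B)" for x k
  proof -
    define N where "N = bound_of j x k"
    from c[of x k] obtain t s where 1: "exec c (init_state x k) t s" "t \<le> K * (N + 1) ^ D"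
      "ctx_state (x, k, N) s" "out_tape s = []" unfolding N_def by blast
    from emitsE[OF d 1(3) slots] obtain s' where 2: "runs d 5 (T N) s s'"
      "out_tape s' = encode_nats (L (x, k, N))" "ctx_state (x, k, N) s'" using 1(4) by auto
    from 2(1) obtain t' where t': "t' \<le> T N" "exec d s t' s'" unfolding runs_def by blast
    have "N + 1 \<le> 4 * N + 1" by simp
    also have "\<dots> \<le> (17 * (k + 1) * (length x + 1)) ^ (2 ^ j)"
    proof -
      let ?a = "4 * (length x + k + 4)"
      have "?a ^ (2 ^ j) + 1 \<le> (?a + 1) ^ (2 ^ j)"
        using power_strict_mono[of ?a "?a + 1" "2 ^ j"] by simp
      also have "\<dots> \<le> (17 * (k + 1) * (length x + 1)) ^ (2 ^ j)"
        by (intro power_mono) (auto simp: algebra_simps)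
      finally show ?thesis unfolding N_def iterbnd_closed .
    qed
    finally have N: "N + 1 \<le> (17 * (k + 1) * (length x + 1)) ^ (2 ^ j)" .
    have "t + (t' + 1) \<le> K * (N + 1) ^ D + (T N + 1)" using 1 t' by simp
    also note ME[of N]
    also have "M * (N + 1) ^ E \<le> M * ((17 * (k + 1) * (length x + 1)) ^ (2 ^ j)) ^ E"
      using N by (intro mult_left_mono power_mono) auto
    also have "\<dots> = f k * (length x + 1) ^ e"
      unfolding f_def e_def by (simp only: power_mult power_mult_distrib mult.assoc)
    finally have time: "t + (t' + 1) \<le> f k * (length x + 1) ^ e" .
    let ?s = "s'\<lparr>reg := (reg s')(1 := reg s' 1 + reg s' 3)\<rparr>"
    have "exec (Seq c (Seq d (Add 1 1 3))) (init_state x k) (t + (t' + 1)) ?s"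
      by (rule exec_Seq[OF 1(1) exec_Seq[OF t'(2) exec_Add]])
    moreover have "out_tape ?s = encode_nats (L (x, k, N))" "reg ?s 1 = Suc k"
      using 2 unfolding ctx_state_def by auto
    ultimately have "computes_in (Seq c (Seq d (Add 1 1 3))) x k (t + (t' + 1)) (encode_nats (L (x, k, N))) (Suc k)"
      unfolding computes_in_def by blast
    then show ?thesis
      using time iff[of x k] unfolding N_def by blast
  qed
  then show ?thesis
    unfolding fpt_reducible_def using f computable_Suc by blast
qed

section \<open>The instance computed by the reduction\<close>

definition bit_at :: "ctx \<Rightarrow> nat \<Rightarrow> bool" where
  "bit_at g p \<longleftrightarrow> p < len g \<and> inp g ! p"

text \<open>Each number in the unary code ends with a 0, so the zeros before a position give the
  index of the number to which it belongs. Numbers can thus be read by counting, without scanning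
  the string in order.\<close>

definition zeros :: "ctx \<Rightarrow> nat \<Rightarrow> nat" where
  "zeros g p = (\<Sum>q<len g. of_bool (q < p \<and> \<not> bit_at g q))"

definition num :: "ctx \<Rightarrow> nat \<Rightarrow> nat" where
  "num g j = (\<Sum>p<len g. of_bool (bit_at g p \<and> zeros g p = j))"

definition nums :: "ctx \<Rightarrow> nat" where
  "nums g = zeros g (len g)"

definition gate_end :: "ctx \<Rightarrow> nat \<Rightarrow> nat" where
  "gate_end g p = (if num g p = 0 then p + 1 else if num g p = 1 then p + 2 else p + 2 + num g (p + 1))"

text \<open>The cap keeps the number of rounds small for arbitrary \<open>a\<close>; indices of
  gates are below the length of the input anyway.\<close>

definition gate_start :: "ctx \<Rightarrow> nat \<Rightarrow> nat" where
  "gate_start g a = rec_nat 0 (\<lambda>i p. gate_end g p) (min a (len g))"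

definition ngates :: "ctx \<Rightarrow> nat" where
  "ngates g = (\<Sum>a<len g. of_bool (gate_start g a < nums g))"

definition kind :: "ctx \<Rightarrow> nat \<Rightarrow> nat" where
  "kind g a = num g (gate_start g a)"

definition nargs :: "ctx \<Rightarrow> nat \<Rightarrow> nat" where
  "nargs g a = (if kind g a = 0 then 0 else if kind g a = 1 then 1 else num g (gate_start g a + 1))"

definition arg :: "ctx \<Rightarrow> nat \<Rightarrow> nat \<Rightarrow> nat" where
  "arg g a t = num g (gate_start g a + (if kind g a = 1 then 1 else 2) + t)"

definition isarg :: "ctx \<Rightarrow> nat \<Rightarrow> nat \<Rightarrow> bool" where
  "isarg g a b \<longleftrightarrow> (\<exists>t<len g. t < nargs g a \<and> arg g a t = b)"

definition big :: "ctx \<Rightarrow> nat \<Rightarrow> bool" where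
  "big g a \<longleftrightarrow> 2 < nargs g a"

definition leaf :: "ctx \<Rightarrow> nat \<Rightarrow> bool" where
  "leaf g a \<longleftrightarrow> kind g a = 0 \<or> big g a"

text \<open>All quantifiers have to be bounded. An argument that is not below \<open>len g\<close>
  escapes the condition on \<open>isarg\<close> and is caught by the one on
  \<open>arg\<close>.\<close>

definition wf_code :: "ctx \<Rightarrow> bool" where
  "wf_code g \<longleftrightarrow> 0 < len g \<and> \<not> bit_at g (len g - 1) \<and>
     gate_start g (ngates g) = nums g \<and>
     (\<forall>a<len g. a < ngates g \<longrightarrow> kind g a \<le> 3 \<and>
       (\<forall>b<len g. isarg g a b \<longrightarrow> b < a) \<and>
       (\<forall>t<len g. t < nargs g a \<longrightarrow> arg g a t < len g) \<and>
       (2 \<le> kind g a \<longrightarrow> 2 \<le> nargs g a \<and>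
         (\<forall>t<len g. t < nargs g a \<longrightarrow> (\<forall>u<len g. u < nargs g a \<longrightarrow>
           arg g a t = arg g a u \<longrightarrow> t = u))))"

text \<open>\<open>l\<close> will be a constant, so this unfolds into a fixed nest of bounded
  quantifiers. The path may stop anywhere: in a well-formed circuit it can be continued to an
  input.\<close>

primrec path_from :: "nat \<Rightarrow> ctx \<Rightarrow> nat \<Rightarrow> bool" where
  "path_from 0 g a = True"
| "path_from (Suc l) g a = (\<exists>b<len g. isarg g a b \<and> path_from l g b)"

primrec big_below :: "nat \<Rightarrow> ctx \<Rightarrow> nat \<Rightarrow> bool" where
  "big_below 0 g a = big g a"
| "big_below (Suc l) g a = (big g a \<or> (\<exists>b<len g. isarg g a b \<and> big_below l g b))"

primrec two_big_below :: "nat \<Rightarrow> ctx \<Rightarrow> nat \<Rightarrow> bool" where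
  "two_big_below 0 g a = False"
| "two_big_below (Suc l) g a =
     (\<exists>b<len g. isarg g a b \<and> (big g a \<and> big_below l g b \<or> two_big_below l g b))"

definition root :: "ctx \<Rightarrow> nat" where
  "root g = ngates g - 1"

definition valid :: "nat \<Rightarrow> ctx \<Rightarrow> bool" where
  "valid d g \<longleftrightarrow> wf_code g \<and> \<not> path_from (Suc d) g (root g) \<and> \<not> two_big_below d g (root g)"

text \<open>The sum is the triangular number of \<open>a + b\<close>, provided \<open>a\<close> and
  \<open>b\<close> are below the bound. So this is the equation
  \<open>prod_encode (a, b) = e\<close>, written without division.\<close>

definition is_pair :: "ctx \<Rightarrow> nat \<Rightarrow> nat \<Rightarrow> nat \<Rightarrow> bool" where
  "is_pair g a b e \<longleftrightarrow> (\<Sum>i<bnd g + bnd g. if i \<le> a + b then i else 0) + a = e"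

text \<open>The components of the pair with Cantor code \<open>e\<close>, if \<open>e\<close> is less than the bound.\<close>

definition pl :: "ctx \<Rightarrow> nat \<Rightarrow> nat" where
  "pl g e = (\<Sum>a<bnd g. \<Sum>b<bnd g. if is_pair g a b e then a else 0)"

definition pr :: "ctx \<Rightarrow> nat \<Rightarrow> nat" where
  "pr g e = (\<Sum>a<bnd g. \<Sum>b<bnd g. if is_pair g a b e then b else 0)"

text \<open>A guess for a gate assigns to each leaf of the tree unfolding of the circuit below the gate,
  cut at the inputs and the large gates, a pair of a truth value and a witness. It is the code of
  the pair of the guesses for the two arguments of the gate.\<close>

primrec guess_value :: "nat \<Rightarrow> ctx \<Rightarrow> nat \<Rightarrow> nat \<Rightarrow> bool" where
  "guess_value 0 g a e = (pl g e = 1)"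
| "guess_value (Suc l) g a e =
     (if leaf g a then pl g e = 1
      else if kind g a = 1 then \<not> guess_value l g (arg g a 0) (pl g e)
      else if kind g a = 2 then
        guess_value l g (arg g a 0) (pl g e) \<and> guess_value l g (arg g a 1) (pr g e)
      else guess_value l g (arg g a 0) (pl g e) \<or> guess_value l g (arg g a 1) (pr g e))"

text \<open>Ranges over occurrences of leaves in the tree unfolding: a node reached along two paths
  has two independent guesses. Statements about all leaves are expressed by negation.\<close>

primrec ex_leaf :: "nat \<Rightarrow> ctx \<Rightarrow> (nat \<Rightarrow> nat \<Rightarrow> bool) \<Rightarrow> nat \<Rightarrow> nat \<Rightarrow> bool" where
  "ex_leaf 0 g Q a e = Q a e"
| "ex_leaf (Suc l) g Q a e =
     (if leaf g a then Q a e
      else ex_leaf l g Q (arg g a 0) (pl g e) \<or>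
        kind g a \<noteq> 1 \<and> ex_leaf l g Q (arg g a 1) (pr g e))"

text \<open>A guess for the root is justified if, at each leaf \<open>a\<close> with guess \<open>h\<close>, all nodes \<open>c\<close> with
  \<open>relevant g a h c\<close> have the guessed truth value. Where one argument of a large gate suffices, it
  is the witness.\<close>

definition one_suffices :: "ctx \<Rightarrow> nat \<Rightarrow> nat \<Rightarrow> bool" where
  "one_suffices g a h \<longleftrightarrow> kind g a \<noteq> 0 \<and> (if pl g h = 1 then kind g a \<noteq> 2 else kind g a = 2)"

definition relevant :: "ctx \<Rightarrow> nat \<Rightarrow> nat \<Rightarrow> nat \<Rightarrow> bool" where
  "relevant g a h c \<longleftrightarrow> (if kind g a = 0 then c = a else if one_suffices g a h then c = pr g h
     else isarg g a c)"

definition witness_ok :: "ctx \<Rightarrow> nat \<Rightarrow> nat \<Rightarrow> bool" where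
  "witness_ok g a h \<longleftrightarrow> (one_suffices g a h \<longrightarrow> isarg g a (pr g h))"

definition required :: "nat \<Rightarrow> ctx \<Rightarrow> nat \<Rightarrow> nat \<Rightarrow> bool" where
  "required d g h c \<longleftrightarrow> ex_leaf d g (\<lambda>a h'. relevant g a h' c) (root g) h"

text \<open>A guess for a node with only inputs below it claims for each of these inputs \<open>v\<close> that it is not
  selected or that it is the one with number \<open>pr g e\<close>.\<close>

definition conflicts :: "nat \<Rightarrow> ctx \<Rightarrow> nat \<Rightarrow> nat \<Rightarrow> nat \<Rightarrow> bool" where
  "conflicts d g c e u \<longleftrightarrow> ex_leaf d g (\<lambda>v e'. if pl g e' = 1 then pl g u = pr g e' \<and> pr g u \<noteq> v
     else pr g u = v) c e"

text \<open>The faults of a guess \<open>e\<close> for \<open>c\<close> that do not depend on the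
  selection: a number that is no number of an input, or a value of \<open>c\<close> other than the
  one \<open>h\<close> needs. Forced vertices of type at least 4 spoil the edges with such
  faults.\<close>

definition bad_guess :: "nat \<Rightarrow> ctx \<Rightarrow> nat \<Rightarrow> nat \<Rightarrow> nat \<Rightarrow> bool" where
  "bad_guess d g c h e \<longleftrightarrow> ex_leaf d g (\<lambda>v e'. pl g e' = 1 \<and> par g \<le> pr g e') c e \<or>
     ex_leaf d g (\<lambda>a h'. relevant g a h' c \<and> (pl g h' = 1) \<noteq> guess_value d g c e) (root g) h"

text \<open>Vertices are codes of nested pairs. \<open>(0, (i, v))\<close>: the input with number \<open>i\<close> is \<open>v\<close>.
  \<open>(1, h)\<close>: the guess for the root is \<open>h\<close>. The other vertices are forced. \<open>(2, (c, h))\<close> checks that, if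
  \<open>h\<close> is the guess and its justification requires a value of \<open>c\<close>, then \<open>c\<close> has it. \<open>(3, (v, (i, j)))\<close>
  checks that \<open>v\<close> is not selected as both input \<open>i\<close> and input \<open>j\<close>. Types from 4 on serve to rule out
  edges as private edges. The last condition in \<open>group\<close> makes sure that all checks of the selected
  guess have codes below the bound, so that they are vertices.\<close>

definition forced :: "ctx \<Rightarrow> nat \<Rightarrow> bool" where
  "forced g x \<longleftrightarrow> 2 \<le> pl g x"

definition group :: "nat \<Rightarrow> ctx \<Rightarrow> nat \<Rightarrow> nat \<Rightarrow> bool" where
  "group d g i x \<longleftrightarrow> (if i < par g then pl g x = 0 \<and> pl g (pr g x) = i \<and> pr g (pr g x) < ngates g \<and>
       kind g (pr g (pr g x)) = 0
     else valid d g \<and> pl g x = 1 \<and> guess_value d g (root g) (pr g x) \<and>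
       \<not> ex_leaf d g (\<lambda>a h. \<not> witness_ok g a h) (root g) (pr g x) \<and>
       (\<forall>c<len g. \<exists>w<bnd g. pl g w = 2 \<and> pl g (pr g w) = c \<and> pr g (pr g w) = pr g x))"

text \<open>\<open>excludes d g x e y\<close>: edge \<open>e\<close> of vertex \<open>x\<close> contains \<open>y\<close>, so it is not private if \<open>y\<close> is selected.
  The edge of a check \<open>(2, (c, h))\<close> with \<open>pl g e = 0\<close> is private if the check is not needed.\<close>

definition excludes :: "nat \<Rightarrow> ctx \<Rightarrow> nat \<Rightarrow> nat \<Rightarrow> nat \<Rightarrow> bool" where
  "excludes d g x e y \<longleftrightarrow>
     pl g x = 2 \<and>
       (if pl g e = 0 then pl g y = 1 \<and> pr g y = pr g (pr g x) \<and> required d g (pr g (pr g x)) (pl g (pr g x))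
        else pl g y = 0 \<and> conflicts d g (pl g (pr g x)) (pr g e) (pr g y) \<or>
          4 \<le> pl g y \<and> bad_guess d g (pl g (pr g x)) (pr g (pr g x)) (pr g e)) \<or>
     pl g x = 3 \<and> pl g y = 0 \<and> pl g (pr g (pr g x)) \<noteq> pr g (pr g (pr g x)) \<and>
       pr g (pr g y) = pl g (pr g x) \<and>
       pl g (pr g y) = (if pl g e = 0 then pl g (pr g (pr g x)) else pr g (pr g (pr g x)))"


section \<open>The instance is computable in polynomial time\<close>

lemmas small_intros = small_const small_len small_par small_bnd small_add small_mult

text \<open>Apart from the recursion in \<open>gate_start\<close>, the definitions of the instance
  use only operations covered here and recursion on constants. So feasibility follows their
  syntax.\<close>

lemmas feas_basic = feas_hd feas_tl feas_const feas_len feas_par feas_bnd feas_add feas_sub feas_if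
  feasp_less feasp_le feasp_eq feasp_not feasp_conj feasp_disj feasp_imp feasp_if feasp_ex feasp_all
  feas_sum small_intros

lemma feasp_bit_at: "feas r A \<Longrightarrow> feasp r (\<lambda>g w. bit_at g (A g w))"
  unfolding bit_at_def by (rule feas_bit)

lemma feas_zeros: "feas r A \<Longrightarrow> feas r (\<lambda>g w. zeros g (A g w))"
  unfolding zeros_def by (intro feas_basic feasp_bit_at)

lemma feas_num: "feas r A \<Longrightarrow> feas r (\<lambda>g w. num g (A g w))"
  unfolding num_def by (intro feas_basic feasp_bit_at feas_zeros)

lemma feas_nums: "feas r (\<lambda>g w. nums g)"
  unfolding nums_def by (intro feas_basic feas_zeros)

lemma feas_gate_end: "feas r A \<Longrightarrow> feas r (\<lambda>g w. gate_end g (A g w))"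
  unfolding gate_end_def by (intro feas_basic feas_num)

lemma feas_gate_start:
  assumes "feas r A"
  shows "feas r (\<lambda>g w. gate_start g (A g w))"
  unfolding gate_start_def
  by (rule feas_rec) (intro feas_basic feas_gate_end feas_min assms small_le[OF small_len min.cobounded2])+

lemma feas_ngates: "feas r (\<lambda>g w. ngates g)"
  unfolding ngates_def by (intro feas_basic feas_gate_start feas_nums)

lemma feas_kind: "feas r A \<Longrightarrow> feas r (\<lambda>g w. kind g (A g w))"
  unfolding kind_def by (intro feas_num feas_gate_start)

lemma feas_nargs: "feas r A \<Longrightarrow> feas r (\<lambda>g w. nargs g (A g w))"
  unfolding nargs_def by (intro feas_basic feas_num feas_gate_start feas_kind)

lemma feas_arg: "feas r A \<Longrightarrow> feas r B \<Longrightarrow> feas r (\<lambda>g w. arg g (A g w) (B g w))"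
  unfolding arg_def by (intro feas_basic feas_num feas_gate_start feas_kind)

lemma feasp_isarg: "feas r A \<Longrightarrow> feas r B \<Longrightarrow> feasp r (\<lambda>g w. isarg g (A g w) (B g w))"
  unfolding isarg_def by (intro feas_basic feas_arg feas_nargs)

lemma feasp_big: "feas r A \<Longrightarrow> feasp r (\<lambda>g w. big g (A g w))"
  unfolding big_def by (intro feas_basic feas_nargs)

lemma feasp_leaf: "feas r A \<Longrightarrow> feasp r (\<lambda>g w. leaf g (A g w))"
  unfolding leaf_def by (intro feas_basic feasp_big feas_kind)

lemma feasp_wf_code: "feasp r (\<lambda>g w. wf_code g)"
  unfolding wf_code_def
  by (intro feas_basic feasp_bit_at feas_gate_start feas_ngates feas_nums feas_kind feasp_isarg feas_nargs feas_arg)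

lemma feasp_path_from: "feas r A \<Longrightarrow> feasp r (\<lambda>g w. path_from l g (A g w))"
proof (induction l arbitrary: r A)
  case 0
  then show ?case using feas_const[of r 1] by simp
next
  case (Suc l)
  show ?case unfolding path_from.simps by (intro feas_basic feasp_isarg Suc)
qed

lemma feasp_big_below: "feas r A \<Longrightarrow> feasp r (\<lambda>g w. big_below l g (A g w))"
proof (induction l arbitrary: r A)
  case 0
  then show ?case by (simp add: feasp_big)
next
  case (Suc l)
  show ?case unfolding big_below.simps by (intro feas_basic feasp_isarg feasp_big Suc)
qed

lemma feasp_two_big_below: "feas r A \<Longrightarrow> feasp r (\<lambda>g w. two_big_below l g (A g w))"
proof (induction l arbitrary: r A)
  case 0
  then show ?case using feas_const[of r 0] by simp
next
  case (Suc l)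
  show ?case unfolding two_big_below.simps by (intro feas_basic feasp_isarg feasp_big feasp_big_below Suc)
qed

lemma feas_root: "feas r (\<lambda>g w. root g)"
  unfolding root_def by (intro feas_basic feas_ngates)

lemma feasp_valid: "feasp r (\<lambda>g w. valid d g)"
  unfolding valid_def by (intro feas_basic feasp_wf_code feasp_path_from feasp_two_big_below feas_root)

lemma feasp_is_pair: "feas r A \<Longrightarrow> feas r B \<Longrightarrow> feas r D \<Longrightarrow> feasp r (\<lambda>g w. is_pair g (A g w) (B g w) (D g w))"
  unfolding is_pair_def by (intro feas_basic)

lemma feas_pl: "feas r A \<Longrightarrow> feas r (\<lambda>g w. pl g (A g w))"
  unfolding pl_def by (intro feas_basic feasp_is_pair)

lemma feas_pr: "feas r A \<Longrightarrow> feas r (\<lambda>g w. pr g (A g w))"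
  unfolding pr_def by (intro feas_basic feasp_is_pair)

lemma feasp_guess_value: "feas r A \<Longrightarrow> feas r B \<Longrightarrow> feasp r (\<lambda>g w. guess_value l g (A g w) (B g w))"
proof (induction l arbitrary: A B)
  case 0
  then show ?case unfolding guess_value.simps by (intro feas_basic feas_pl)
next
  case (Suc l)
  show ?case unfolding guess_value.simps
    by (intro feas_basic feas_pl feas_pr feasp_leaf feas_kind feas_arg Suc)
qed

lemma feasp_ex_leaf:
  assumes Q: "\<And>A B. feas r A \<Longrightarrow> feas r B \<Longrightarrow> feasp r (\<lambda>g w. Q g w (A g w) (B g w))"
  shows "feas r A \<Longrightarrow> feas r B \<Longrightarrow> feasp r (\<lambda>g w. ex_leaf l g (Q g w) (A g w) (B g w))"
proof (induction l arbitrary: A B)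
  case 0
  then show ?case unfolding ex_leaf.simps by (intro Q)
next
  case (Suc l)
  show ?case unfolding ex_leaf.simps
    by (intro feas_basic feas_pl feas_pr feasp_leaf feas_kind feas_arg Suc Q)
qed

lemma feasp_one_suffices: "feas r A \<Longrightarrow> feas r B \<Longrightarrow> feasp r (\<lambda>g w. one_suffices g (A g w) (B g w))"
  unfolding one_suffices_def by (intro feas_basic feas_kind feas_pl)

lemma feasp_relevant: "feas r A \<Longrightarrow> feas r B \<Longrightarrow> feas r D \<Longrightarrow> feasp r (\<lambda>g w. relevant g (A g w) (B g w) (D g w))"
  unfolding relevant_def by (intro feas_basic feas_kind feas_pr feasp_isarg feasp_one_suffices)

lemma feasp_witness_ok: "feas r A \<Longrightarrow> feas r B \<Longrightarrow> feasp r (\<lambda>g w. witness_ok g (A g w) (B g w))"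
  unfolding witness_ok_def by (intro feas_basic feas_pr feasp_isarg feasp_one_suffices)

lemma feasp_required: "feas r A \<Longrightarrow> feas r B \<Longrightarrow> feasp r (\<lambda>g w. required d g (A g w) (B g w))"
  unfolding required_def by (intro feasp_ex_leaf feasp_relevant feas_root)

lemma feasp_conflicts:
  "feas r A \<Longrightarrow> feas r B \<Longrightarrow> feas r D \<Longrightarrow> feasp r (\<lambda>g w. conflicts d g (A g w) (B g w) (D g w))"
  unfolding conflicts_def by (intro feasp_ex_leaf feas_basic feas_pl feas_pr)

lemma feasp_iff:
  assumes "feasp r P" "feasp r Q"
  shows "feasp r (\<lambda>g w. P g w = Q g w)"
proof -
  have "feasp r (\<lambda>g w. (P g w \<longrightarrow> Q g w) \<and> (Q g w \<longrightarrow> P g w))"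
    by (intro feasp_conj feasp_imp assms)
  then show ?thesis by (simp add: iff_conv_conj_imp)
qed

lemma feasp_bad_guess:
  "feas r A \<Longrightarrow> feas r B \<Longrightarrow> feas r D \<Longrightarrow> feasp r (\<lambda>g w. bad_guess d g (A g w) (B g w) (D g w))"
  unfolding bad_guess_def
  by (intro feasp_disj feasp_ex_leaf feasp_conj feasp_not feasp_iff feasp_eq feasp_le feas_const feas_par
      feas_pl feas_pr feas_root feasp_relevant feasp_guess_value)

lemma feasp_forced: "feas r A \<Longrightarrow> feasp r (\<lambda>g w. forced g (A g w))"
  unfolding forced_def by (intro feas_basic feas_pl)

lemma feasp_group: "feas r A \<Longrightarrow> feas r B \<Longrightarrow> feasp r (\<lambda>g w. group d g (A g w) (B g w))"
  unfolding group_def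
  by (intro feas_basic feasp_ex_leaf feas_pl feas_pr feas_ngates feas_kind feasp_valid feasp_guess_value
      feas_root feasp_witness_ok)

lemma feasp_excludes:
  "feas r A \<Longrightarrow> feas r B \<Longrightarrow> feas r D \<Longrightarrow> feasp r (\<lambda>g w. excludes d g (A g w) (B g w) (D g w))"
  unfolding excludes_def
  by (intro feas_basic feas_pl feas_pr feasp_required feasp_conflicts feasp_bad_guess)

section \<open>Correctness of the parser\<close>

lemma zeros_eq: "zeros g p = length (filter Not (take p (inp g)))"
proof -
  have "zeros g p = card ({..<len g} \<inter> {q. q < p \<and> \<not> bit_at g q})"
    unfolding zeros_def by (simp add: sum_of_bool_eq)
  also have "{..<len g} \<inter> {q. q < p \<and> \<not> bit_at g q} =
      {q. q < length (take p (inp g)) \<and> \<not> take p (inp g) ! q}"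
    by (auto simp: bit_at_def)
  finally show ?thesis by (simp add: length_filter_conv_card)
qed

lemma zeros_encode_nats: "length (filter Not (encode_nats ns)) = length ns"
  by (induction ns) (simp_all add: encode_nats_def)

text \<open>A proper prefix of the code misses its last bit, which is a 0.\<close>

lemma zeros_take_encode_nats:
  assumes "p < length (encode_nats ns)"
  shows "length (filter Not (take p (encode_nats ns @ x))) < length ns"
proof (cases ns rule: rev_cases)
  case Nil
  then show ?thesis using assms by (simp add: encode_nats_def)
next
  case (snoc ms n)
  let ?y = "encode_nats ms @ replicate n True"
  have y: "encode_nats ns = ?y @ [False]" by (simp add: snoc encode_nats_def)
  have "take p (encode_nats ns @ x) = take p ?y" using assms unfolding y by simp
  moreover have "length (filter Not (take p ?y)) \<le> length (filter Not ?y)"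
    by (metis append_take_drop_id filter_append length_append le_add1)
  ultimately show ?thesis by (simp add: zeros_encode_nats snoc)
qed

lemma num_encode_nats:
  assumes "inp g = encode_nats ns"
  shows "num g j = (if j < length ns then ns ! j else 0)"
proof -
  have num: "num g j = card {p. p < len g \<and> inp g ! p \<and> zeros g p = j}" for j
    unfolding num_def by (simp add: sum_of_bool_eq) (rule arg_cong[of _ _ card], auto simp: bit_at_def)
  show ?thesis
  proof (cases "j < length ns")
    case False
    then have "{p. p < len g \<and> inp g ! p \<and> zeros g p = j} = {}"
      using zeros_take_encode_nats[of _ ns "[]"] by (auto simp: zeros_eq assms)
    then show ?thesis using False by (simp add: num)
  next
    case True
    define as bs n where "as = take j ns" and "bs = drop (Suc j) ns" and "n = ns ! j"
    have ns: "ns = as @ n # bs" and j: "length as = j"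
      using True by (auto simp: as_def bs_def n_def id_take_nth_drop)
    define P where "P = length (encode_nats as)"
    have x: "inp g = encode_nats as @ replicate n True @ False # encode_nats bs"
      unfolding assms ns by (simp add: encode_nats_def)
    \<comment> \<open>Positions before \<open>P\<close> have fewer zeros before them, position
      \<open>P + n\<close> is itself the separating 0, and later positions have more.\<close>
    have "{p. p < len g \<and> inp g ! p \<and> zeros g p = j} = {P..<P + n}"
    proof (intro equalityI subsetI)
      fix p assume p: "p \<in> {p. p < len g \<and> inp g ! p \<and> zeros g p = j}"
      have "P \<le> p"
      proof (rule ccontr)
        assume "\<not> P \<le> p"
        then have "zeros g p < j"
          using zeros_take_encode_nats[of p as] unfolding zeros_eq x P_def j by simp
        then show False using p by simp
      qed
      moreover have "p < P + n"
      proof (rule ccontr)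
        assume "\<not> p < P + n"
        moreover have "p \<noteq> P + n" using p unfolding x P_def by (auto simp: nth_append)
        ultimately have "P + n < p" by simp
        then obtain q where q: "p = P + (n + Suc q)"
          by (metis add.assoc add_Suc_right less_iff_Suc_add)
        have "zeros g p = j + (Suc (length (filter Not (take q (encode_nats bs)))))"
          unfolding zeros_eq x q P_def by (simp add: zeros_encode_nats j)
        then show False using p by simp
      qed
      ultimately show "p \<in> {P..<P + n}" by simp
    next
      fix p assume "p \<in> {P..<P + n}"
      then obtain q where q: "p = P + q" "q < n" by (metis atLeastLessThan_iff le_iff_add add_less_cancel_left)
      have "zeros g p = j"
        unfolding zeros_eq x q(1) P_def using q(2) by (simp add: zeros_encode_nats j)
      moreover have "p < len g" "inp g ! p"
        unfolding x q(1) P_def using q(2) by (auto simp: nth_append)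
      ultimately show "p \<in> {p. p < len g \<and> inp g ! p \<and> zeros g p = j}" by blast
    qed
    then show ?thesis using True by (simp add: num n_def)
  qed
qed

lemma nums_encode_nats: "inp g = encode_nats ns \<Longrightarrow> nums g = length ns"
  unfolding nums_def zeros_eq by (simp add: zeros_encode_nats)

lemma length_encode_nats: "length ns \<le> length (encode_nats ns)"
  by (metis length_filter_le zeros_encode_nats)

text \<open>By induction from the front: a leading 1 increments the first number, a leading 0 adds a
  number 0.\<close>

lemma encode_nats_exists: "x = [] \<or> \<not> last x \<Longrightarrow> \<exists>ns. x = encode_nats ns"
proof (induction x)
  case Nil
  then show ?case by (intro exI[of _ "[]"]) (simp add: encode_nats_def)
next
  case (Cons b x)
  show ?case
  proof (cases "x = []")
    case True
    then show ?thesis using Cons.prems by (intro exI[of _ "[0]"]) (simp add: encode_nats_def)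
  next
    case False
    then obtain ns where ns: "x = encode_nats ns" using Cons by auto
    with False obtain n ms where ms: "ns = n # ms" by (cases ns) (auto simp: encode_nats_def)
    show ?thesis
    proof (cases b)
      case True
      then show ?thesis unfolding ns ms by (intro exI[of _ "Suc n # ms"]) (simp add: encode_nats_def)
    next
      case False
      then show ?thesis unfolding ns ms by (intro exI[of _ "0 # n # ms"]) (simp add: encode_nats_def)
    qed
  qed
qed

section \<open>Locating the gates in the list of numbers\<close>

lemma gate_start_Suc: "a < len g \<Longrightarrow> gate_start g (Suc a) = gate_end g (gate_start g a)"
  by (simp add: gate_start_def min_absorb1)

lemma gate_start_mono: "a \<le> b \<Longrightarrow> b \<le> len g \<Longrightarrow> gate_start g a \<le> gate_start g b"
proof (induction b rule: dec_induct)
  case (step b)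
  then show ?case using gate_start_Suc[of b g] by (simp add: gate_end_def split: if_splits)
qed simp

lemma ngates_le: "ngates g \<le> len g"
proof -
  have "ngates g \<le> (\<Sum>a<len g. 1)" unfolding ngates_def by (intro sum_mono) simp
  then show ?thesis by simp
qed

locale encoded =
  fixes g :: ctx and C :: circuit
  assumes inp: "inp g = encode_circuit C"
begin

definition offset :: "nat \<Rightarrow> nat" where
  "offset a = length (concat (map encode_gate (take a C)))"

abbreviation "ns \<equiv> concat (map encode_gate C)"

lemma num: "num g j = (if j < length ns then ns ! j else 0)"
  and nums: "nums g = length ns"
  using inp num_encode_nats nums_encode_nats unfolding encode_circuit_def by blast+

lemma length_ns: "length ns \<le> len g"
  unfolding inp encode_circuit_def by (rule length_encode_nats)

lemma length_gate: "length (encode_gate G) = (case G of Input \<Rightarrow> 1 | Neg _ \<Rightarrow> 2 | Conj as \<Rightarrow> 2 + length as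
    | Disj as \<Rightarrow> 2 + length as)"
  by (cases G) auto

lemma length_C: "length C \<le> length ns"
proof (induction C)
  case (Cons G C)
  then show ?case using length_gate[of G] by (simp split: gate.splits)
qed simp

lemma offset_Suc: "a < length C \<Longrightarrow> offset (Suc a) = offset a + length (encode_gate (C ! a))"
  by (simp add: offset_def take_Suc_conv_app_nth)

lemma num_offset:
  assumes "a < length C" "t < length (encode_gate (C ! a))"
  shows "num g (offset a + t) = encode_gate (C ! a) ! t"
proof -
  have "ns = concat (map encode_gate (take a C)) @ encode_gate (C ! a) @ concat (map encode_gate (drop (Suc a) C))"
    by (subst id_take_nth_drop[OF assms(1)]) simp
  then have "ns ! (offset a + t) = encode_gate (C ! a) ! t" "offset a + t < length ns"
    using assms(2) by (simp_all add: nth_append offset_def)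
  then show ?thesis by (simp add: num)
qed

lemma gate_end_offset:
  assumes "a < length C"
  shows "gate_end g (offset a) = offset (Suc a)"
  using num_offset[OF assms, of 0] num_offset[OF assms, of 1] offset_Suc[OF assms]
  by (cases "C ! a") (auto simp: gate_end_def)

lemma gate_start: "a \<le> length C \<Longrightarrow> gate_start g a = offset a"
proof (induction a)
  case 0
  then show ?case by (simp add: gate_start_def offset_def)
next
  case (Suc a)
  then have "a < len g" using length_C length_ns by simp
  then show ?case using Suc gate_start_Suc gate_end_offset by simp
qed

lemma gate_start_less: "a < len g \<Longrightarrow> gate_start g a < nums g \<longleftrightarrow> a < length C"
proof
  assume a: "a < length C"
  have "offset a < offset (Suc a)" using offset_Suc[OF a] length_gate[of "C ! a"] by (simp split: gate.splits)
  also have "\<dots> = gate_start g (Suc a)" using a by (simp add: gate_start)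
  also have "\<dots> \<le> gate_start g (length C)" using a length_C length_ns by (intro gate_start_mono) auto
  also have "\<dots> = nums g" by (simp add: gate_start nums offset_def)
  finally show "gate_start g a < nums g" using a by (simp add: gate_start)
next
  assume a: "a < len g" "gate_start g a < nums g"
  have "gate_start g (length C) = nums g" by (simp add: gate_start nums offset_def)
  then show "a < length C" using a gate_start_mono[of "length C" a g] by linarith
qed

lemma ngates: "ngates g = length C"
proof -
  have "ngates g = card ({..<len g} \<inter> {a. gate_start g a < nums g})"
    unfolding ngates_def by (simp add: sum_of_bool_eq)
  also have "{..<len g} \<inter> {a. gate_start g a < nums g} = {..<length C}"
    using gate_start_less length_C length_ns by fastforce
  finally show ?thesis by simp
qed

context
  fixes a assumes a: "a < length C"
begin

lemma kind: "kind g a = (case C ! a of Input \<Rightarrow> 0 | Neg _ \<Rightarrow> 1 | Conj _ \<Rightarrow> 2 | Disj _ \<Rightarrow> 3)"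
  using num_offset[OF a, of 0] a unfolding kind_def by (simp add: gate_start split: gate.splits)

lemma nargs: "nargs g a = length (gate_args (C ! a))"
  using num_offset[OF a, of 1] a kind unfolding nargs_def by (simp add: gate_start split: gate.splits)

lemma arg: "t < length (gate_args (C ! a)) \<Longrightarrow> arg g a t = gate_args (C ! a) ! t"
  using num_offset[OF a, of "1 + t"] num_offset[OF a, of "2 + t"] a kind
  unfolding arg_def by (auto simp: gate_start split: gate.splits)

lemma nargs_le: "length (gate_args (C ! a)) \<le> len g"
proof -
  have "length (gate_args (C ! a)) \<le> length (encode_gate (C ! a))"
    by (cases "C ! a") auto
  also have "\<dots> \<le> offset (Suc a)" using offset_Suc[OF a] by simp
  also have "\<dots> \<le> length ns"
    unfolding offset_def by (metis append_take_drop_id concat_append length_append map_append le_add1)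
  also note length_ns
  finally show ?thesis .
qed

lemma isarg: "isarg g a b \<longleftrightarrow> b \<in> set (gate_args (C ! a))"
  unfolding isarg_def nargs in_set_conv_nth using nargs_le by (metis arg less_le_trans)

lemma big: "big g a \<longleftrightarrow> large (C ! a)"
  unfolding big_def large_def nargs ..

lemma leaf: "leaf g a \<longleftrightarrow> C ! a = Input \<or> large (C ! a)"
  unfolding leaf_def big kind by (simp split: gate.splits)

end

lemma C_le: "a < length C \<Longrightarrow> a < len g"
  using length_C length_ns by simp

lemma wf_code: "wf_code g \<longleftrightarrow> wf_circuit C"
proof
  assume wf: "wf_code g"
  then have "C \<noteq> []" unfolding wf_code_def inp by (auto simp: encode_circuit_def encode_nats_def)
  moreover have "gate_ok (C ! j) \<and> (\<forall>b\<in>set (gate_args (C ! j)). b < j)" if j: "j < length C" for j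
  proof
    note jl = C_le[OF j] and nl = nargs_le[OF j]
    have *: "\<And>b. b < len g \<Longrightarrow> isarg g j b \<Longrightarrow> b < j"
      "\<And>t. t < nargs g j \<Longrightarrow> t < len g \<Longrightarrow> arg g j t < len g"
      "2 \<le> kind g j \<Longrightarrow> 2 \<le> nargs g j"
      "\<And>t u. 2 \<le> kind g j \<Longrightarrow> t < nargs g j \<Longrightarrow> u < nargs g j \<Longrightarrow> t < len g \<Longrightarrow>
        u < len g \<Longrightarrow> arg g j t = arg g j u \<Longrightarrow> t = u"
      using wf j jl unfolding wf_code_def ngates by blast+
    show "\<forall>b\<in>set (gate_args (C ! j)). b < j"
    proof
      fix b assume b: "b \<in> set (gate_args (C ! j))"
      then obtain t where "t < length (gate_args (C ! j))" "b = gate_args (C ! j) ! t"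
        by (metis in_set_conv_nth)
      then have "b < len g" using *(2)[of t] nl nargs[OF j] arg[OF j] by simp
      then show "b < j" using *(1) isarg[OF j] b by simp
    qed
    have "2 \<le> kind g j \<Longrightarrow> distinct (gate_args (C ! j)) \<and> 2 \<le> length (gate_args (C ! j))"
      unfolding distinct_conv_nth using *(3,4) nl nargs[OF j] arg[OF j] by (metis less_le_trans)
    then show "gate_ok (C ! j)" using kind[OF j] by (cases "C ! j") auto
  qed
  ultimately show "wf_circuit C" unfolding wf_circuit_def by blast
next
  assume wf: "wf_circuit C"
  then have ne: "inp g \<noteq> []" using C_le unfolding wf_circuit_def by fastforce
  have "\<not> bit_at g (len g - 1)"
  proof -
    have "ns \<noteq> []" using ne unfolding inp encode_circuit_def by (metis concat.simps(1) encode_nats_def list.map(1))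
    then obtain ms n where "ns = ms @ [n]" by (meson rev_exhaust)
    then have "inp g = encode_nats ms @ replicate n True @ [False]"
      unfolding inp encode_circuit_def by (simp add: encode_nats_def)
    then show ?thesis unfolding bit_at_def by (simp add: nth_append)
  qed
  moreover have "gate_start g (ngates g) = nums g"
    by (simp add: ngates gate_start nums offset_def)
  moreover have "kind g j \<le> 3 \<and> (\<forall>b<len g. isarg g j b \<longrightarrow> b < j) \<and>
       (\<forall>t<len g. t < nargs g j \<longrightarrow> arg g j t < len g) \<and>
       (2 \<le> kind g j \<longrightarrow> 2 \<le> nargs g j \<and>
         (\<forall>t<len g. t < nargs g j \<longrightarrow> (\<forall>u<len g. u < nargs g j \<longrightarrow>
           arg g j t = arg g j u \<longrightarrow> t = u)))" if j: "j < ngates g" for j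
  proof -
    have jC: "j < length C" using j by (simp add: ngates)
    from wf have ok: "gate_ok (C ! j)" "\<And>b. b \<in> set (gate_args (C ! j)) \<Longrightarrow> b < j"
      using jC unfolding wf_circuit_def by auto
    have "arg g j t < len g" if "t < nargs g j" for t
      using that ok(2)[of "arg g j t"] C_le[OF jC] arg[OF jC] nargs[OF jC] by (metis less_trans nth_mem)
    moreover have "2 \<le> kind g j \<Longrightarrow> distinct (gate_args (C ! j)) \<and> 2 \<le> length (gate_args (C ! j))"
      using ok(1) kind[OF jC] by (cases "C ! j") auto
    moreover have "kind g j \<le> 3" using kind[OF jC] by (simp split: gate.splits)
    ultimately show ?thesis
      using ok(2) isarg[OF jC] nargs[OF jC] arg[OF jC] by (auto simp: distinct_conv_nth)
  qed
  ultimately show "wf_code g" unfolding wf_code_def using ne by blast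
qed

end

text \<open>The gates are read off one by one. Each fits into the list of numbers because the
  starting positions increase and the last gate ends exactly at the end of the list.\<close>

lemma wf_code_exists:
  assumes "wf_code g"
  shows "\<exists>C. inp g = encode_circuit C"
proof -
  have "inp g \<noteq> []" "\<not> last (inp g)"
    using assms unfolding wf_code_def bit_at_def by (auto simp: last_conv_nth)
  then obtain ns where ns: "inp g = encode_nats ns" using encode_nats_exists by blast
  note num = num_encode_nats[OF ns] and nums = nums_encode_nats[OF ns]
  have kind: "kind g a \<le> 3" if "a < ngates g" for a
    using assms that ngates_le[of g] unfolding wf_code_def by (meson less_le_trans)
  have total: "gate_start g (ngates g) = length ns"
    using assms nums unfolding wf_code_def by simp
  have "\<exists>C. concat (map encode_gate C) = take (gate_start g a) ns" if "a \<le> ngates g" for a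
    using that
  proof (induction a)
    case 0
    show ?case by (rule exI[of _ "[]"]) (simp add: gate_start_def)
  next
    case (Suc a)
    then obtain C where C: "concat (map encode_gate C) = take (gate_start g a) ns" by auto
    define p where "p = gate_start g a"
    have end_eq: "gate_start g (Suc a) = gate_end g p"
      using Suc.prems ngates_le[of g] unfolding p_def by (intro gate_start_Suc) simp
    have "gate_start g (Suc a) \<le> gate_start g (ngates g)"
      using Suc.prems ngates_le[of g] by (intro gate_start_mono) auto
    then have le: "gate_end g p \<le> length ns" using end_eq total by simp
    have p: "p < length ns" using le unfolding gate_end_def by (simp split: if_splits)
    have drop: "drop p ns = ns ! p # drop (Suc p) ns" using p by (simp add: Cons_nth_drop_Suc)
    have k: "kind g a = ns ! p" "ns ! p \<le> 3" using kind[of a] Suc.prems p by (simp_all add: kind_def num p_def)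
    have "\<exists>G. take (gate_end g p - p) (drop p ns) = encode_gate G"
    proof -
      consider "ns ! p = 0" | "ns ! p = 1" | "ns ! p = 2 \<or> ns ! p = 3" using k(2) by linarith
      then show ?thesis
      proof cases
        case 1
        then show ?thesis using p by (intro exI[of _ Input]) (simp add: drop gate_end_def num)
      next
        case 2
        then have e: "gate_end g p = p + 2" using p by (simp add: gate_end_def num)
        then have "Suc p < length ns" using le by simp
        then have "drop (Suc p) ns = ns ! Suc p # drop (Suc (Suc p)) ns" by (simp add: Cons_nth_drop_Suc)
        then show ?thesis using 2 e by (intro exI[of _ "Neg (ns ! Suc p)"]) (simp add: drop numeral_2_eq_2)
      next
        case 3
        then have e: "gate_end g p = p + 2 + num g (p + 1)" using p by (auto simp: gate_end_def num)
        then have p1: "Suc p < length ns" using le by simp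
        then have drop': "drop (Suc p) ns = ns ! Suc p # drop (Suc (Suc p)) ns" by (simp add: Cons_nth_drop_Suc)
        define n where "n = ns ! Suc p"
        have e': "gate_end g p = p + Suc (Suc n)" using e p1 by (simp add: num n_def)
        define as where "as = take n (drop (Suc (Suc p)) ns)"
        have len: "length as = n" using le e' by (simp add: as_def)
        have "take (gate_end g p - p) (drop p ns) = ns ! p # n # as"
          unfolding e' by (simp add: drop drop' as_def n_def)
        then show ?thesis using 3 len by (metis encode_gate.simps(3,4))
      qed
    qed
    then obtain G where G: "take (gate_end g p - p) (drop p ns) = encode_gate G" by blast
    have "p \<le> gate_end g p" by (simp add: gate_end_def)
    then have "take (gate_end g p) ns = take p ns @ take (gate_end g p - p) (drop p ns)"
      by (metis le_add_diff_inverse take_add)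
    then show ?case using C G end_eq by (intro exI[of _ "C @ [G]"]) (simp add: p_def)
  qed
  from this[of "ngates g"] obtain C where "concat (map encode_gate C) = ns" using total by auto
  then show ?thesis unfolding encode_circuit_def using ns by blast
qed


section \<open>Depth and weft\<close>

text \<open>\<open>io_path\<close> with an arbitrary last node, as needed for induction along the
  gates.\<close>

definition path_to :: "circuit \<Rightarrow> nat \<Rightarrow> nat list \<Rightarrow> bool" where
  "path_to C a p \<longleftrightarrow> p \<noteq> [] \<and> set p \<subseteq> {..<length C} \<and> hd p \<in> input_nodes C \<and> last p = a \<and>
     (\<forall>i. Suc i < length p \<longrightarrow> p ! i \<in> set (gate_args (C ! (p ! Suc i))))"

lemma io_path_iff: "io_path C p \<longleftrightarrow> path_to C (length C - 1) p"
  unfolding io_path_def path_to_def by auto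

lemma path_to_single: "a < length C \<Longrightarrow> C ! a = Input \<Longrightarrow> path_to C a [a]"
  unfolding path_to_def input_nodes_def by simp

lemma path_to_snoc:
  assumes "path_to C b p" "b \<in> set (gate_args (C ! a))" "a < length C"
  shows "path_to C a (p @ [a])"
proof -
  have "(p @ [a]) ! i \<in> set (gate_args (C ! ((p @ [a]) ! Suc i)))" if "Suc i < length (p @ [a])" for i
  proof (cases "Suc i < length p")
    case True
    then show ?thesis using assms(1) unfolding path_to_def by (simp add: nth_append)
  next
    case False
    then have i: "i = length p - 1" "Suc i = length p" using that by auto
    then have "p ! i = b" using assms(1) last_conv_nth[of p] unfolding path_to_def by simp
    then show ?thesis using i assms(2) by (simp add: nth_append)
  qed
  then show ?thesis using assms unfolding path_to_def by auto
qed

lemma path_to_cases: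
  assumes "path_to C a p"
  obtains "p = [a]" "C ! a = Input" "a < length C"
  | q b where "p = q @ [a]" "b \<in> set (gate_args (C ! a))" "path_to C b q" "a < length C"
proof -
  from assms have ne: "p \<noteq> []" and la: "last p = a" unfolding path_to_def by auto
  define q where "q = butlast p"
  have p: "p = q @ [a]" using ne la by (metis append_butlast_last_id q_def)
  have a: "a < length C" using assms p unfolding path_to_def by auto
  show ?thesis
  proof (cases "q = []")
    case True
    then show ?thesis using that(1) p a assms unfolding path_to_def input_nodes_def by auto
  next
    case False
    have chain: "\<And>i. Suc i < length p \<Longrightarrow> p ! i \<in> set (gate_args (C ! (p ! Suc i)))"
      using assms unfolding path_to_def by blast
    have "last q \<in> set (gate_args (C ! a))"
      using chain[of "length q - 1"] False unfolding p by (simp add: nth_append last_conv_nth)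
    moreover have "path_to C (last q) q"
      unfolding path_to_def
    proof (intro conjI allI impI)
      show "q ! i \<in> set (gate_args (C ! (q ! Suc i)))" if "Suc i < length q" for i
        using chain[of i] that unfolding p by (simp add: nth_append)
    qed (use False assms p in \<open>auto simp: path_to_def\<close>)
    ultimately show ?thesis using that(2) p a by blast
  qed
qed

text \<open>A path may stop at any node, so a longer one can be cut off.\<close>

lemma path_from_antimono: "path_from m g a \<Longrightarrow> l \<le> m \<Longrightarrow> path_from l g a"
proof (induction m arbitrary: l a)
  case (Suc m)
  then show ?case by (cases l) auto
qed simp

context encoded
begin

abbreviation "nlarge p \<equiv> length (filter (\<lambda>v. large (C ! v)) p)"

context
  assumes wf: "wf_circuit C"
begin

lemma args_less: "a < length C \<Longrightarrow> b \<in> set (gate_args (C ! a)) \<Longrightarrow> b < a"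
  using wf unfolding wf_circuit_def by blast

lemma args_nonempty: "a < length C \<Longrightarrow> C ! a \<noteq> Input \<Longrightarrow> gate_args (C ! a) \<noteq> []"
proof -
  assume "a < length C" "C ! a \<noteq> Input"
  moreover have "gate_ok (C ! a)" using wf \<open>a < length C\<close> unfolding wf_circuit_def by blast
  ultimately show ?thesis by (cases "C ! a") auto
qed

text \<open>Every node but an input has an argument, and arguments have smaller indices. So descents
  that stop anywhere, as in \<open>path_from\<close> and \<open>big_below\<close>, extend to paths
  from an input.\<close>

lemma path_to_exists: "a < length C \<Longrightarrow> \<exists>p. path_to C a p"
proof (induction a rule: less_induct)
  case (less a)
  show ?case
  proof (cases "C ! a = Input")
    case True
    then show ?thesis using path_to_single less by blast
  next
    case False
    then obtain b where b: "b \<in> set (gate_args (C ! a))" using args_nonempty less(2) by (metis ex_in_conv set_empty)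
    then have "b < a" using args_less less by blast
    then show ?thesis using less path_to_snoc b by (meson less_trans)
  qed
qed

lemma args_bounds: "a < length C \<Longrightarrow> isarg g a b \<Longrightarrow> b < len g \<and> b < length C"
  using args_less isarg C_le by (meson less_trans)

lemma path_from_of_path_to: "path_to C a p \<Longrightarrow> path_from (length p - 1) g a"
proof (induction "length p" arbitrary: a p)
  case 0
  then show ?case by (simp add: path_to_def)
next
  case (Suc n)
  from Suc(3) show ?case
  proof (cases rule: path_to_cases)
    case (2 q b)
    have "path_from (length q - 1) g b" using Suc(1)[of q] Suc(2) 2 by simp
    moreover have l: "length p - 1 = Suc (length q - 1)" using 2 unfolding path_to_def by simp
    ultimately show ?thesis unfolding l path_from.simps using 2 isarg args_bounds by blast
  qed simp
qed

lemma path_to_of_path_from: "path_from l g a \<Longrightarrow> a < length C \<Longrightarrow> \<exists>p. path_to C a p \<and> Suc l \<le> length p"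
proof (induction l arbitrary: a)
  case 0
  then show ?case using path_to_exists[of a] by (metis One_nat_def Suc_leI length_greater_0_conv path_to_def)
next
  case (Suc l)
  then obtain b where b: "isarg g a b" "path_from l g b" by auto
  then obtain p where "path_to C b p" "Suc l \<le> length p" using Suc args_bounds by blast
  then show ?case using path_to_snoc[of C b p a] b Suc.prems isarg by force
qed

lemma big_below_of_path_to:
  "path_to C a p \<Longrightarrow> length p \<le> Suc l \<Longrightarrow> 1 \<le> nlarge p \<Longrightarrow> big_below l g a"
proof (induction l arbitrary: a p)
  case 0
  from 0(1) show ?case
  proof (cases rule: path_to_cases)
    case 1
    then show ?thesis using 0 by (auto simp: large_def)
  next
    case (2 q b)
    then show ?thesis using 0(2) by (simp add: path_to_def)
  qed
next
  case (Suc l)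
  from Suc(2) show ?case
  proof (cases rule: path_to_cases)
    case 1
    then show ?thesis using Suc by (auto simp: large_def)
  next
    case (2 q b)
    then show ?thesis using Suc isarg args_bounds[of a b] big by (cases "large (C ! a)") auto
  qed
qed

lemma two_big_below_of_path_to:
  "path_to C a p \<Longrightarrow> length p \<le> Suc l \<Longrightarrow> 2 \<le> nlarge p \<Longrightarrow> two_big_below l g a"
proof (induction l arbitrary: a p)
  case 0
  then show ?case by (cases p) (auto split: if_splits)
next
  case (Suc l)
  from Suc(2) show ?case
  proof (cases rule: path_to_cases)
    case 1
    then show ?thesis using Suc by (auto simp: large_def)
  next
    case (2 q b)
    then show ?thesis
      using Suc isarg args_bounds[of a b] big big_below_of_path_to[of b q l]
      by (cases "large (C ! a)") auto
  qed
qed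

lemma path_to_of_big: "big g a \<Longrightarrow> a < length C \<Longrightarrow> \<exists>p. path_to C a p \<and> 1 \<le> nlarge p"
proof -
  assume *: "big g a" "a < length C"
  then obtain p where p: "path_to C a p" using path_to_exists by blast
  then have "a \<in> set (filter (\<lambda>v. large (C ! v)) p)"
    using * big unfolding path_to_def by auto
  then have "1 \<le> nlarge p" by (metis One_nat_def Suc_leI length_pos_if_in_set)
  then show ?thesis using p by blast
qed

lemma path_to_of_big_below: "big_below l g a \<Longrightarrow> a < length C \<Longrightarrow> \<exists>p. path_to C a p \<and> 1 \<le> nlarge p"
proof (induction l arbitrary: a)
  case 0
  then show ?case using path_to_of_big by simp
next
  case (Suc l)
  show ?case
  proof (cases "big g a")
    case False
    then obtain b where b: "isarg g a b" "big_below l g b" using Suc.prems by auto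
    then obtain p where "path_to C b p" "1 \<le> nlarge p" using Suc args_bounds by blast
    then show ?thesis using path_to_snoc[of C b p a] b Suc.prems isarg by force
  qed (use path_to_of_big Suc.prems in blast)
qed

lemma path_to_of_two_big_below:
  "two_big_below l g a \<Longrightarrow> a < length C \<Longrightarrow> \<exists>p. path_to C a p \<and> 2 \<le> nlarge p"
proof (induction l arbitrary: a)
  case (Suc l)
  then obtain b where b: "isarg g a b" "big g a \<and> big_below l g b \<or> two_big_below l g b" by auto
  from b(2) show ?case
  proof
    assume *: "big g a \<and> big_below l g b"
    then obtain p where "path_to C b p" "1 \<le> nlarge p"
      using path_to_of_big_below args_bounds b Suc.prems by blast
    then show ?case using path_to_snoc[of C b p a] b Suc.prems isarg big * by force
  next
    assume "two_big_below l g b"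
    then obtain p where "path_to C b p" "2 \<le> nlarge p" using Suc args_bounds b by blast
    then show ?case using path_to_snoc[of C b p a] b Suc.prems isarg by force
  qed
qed simp

lemma root: "root g = length C - 1" "root g < length C"
  using wf unfolding root_def ngates wf_circuit_def by auto

lemma depth_le_iff: "depth_le d C \<longleftrightarrow> \<not> path_from (Suc d) g (root g)"
proof
  assume "depth_le d C"
  then show "\<not> path_from (Suc d) g (root g)"
    using path_to_of_path_from[OF _ root(2)] unfolding depth_le_def io_path_iff root(1)[symmetric]
    by fastforce
next
  assume *: "\<not> path_from (Suc d) g (root g)"
  show "depth_le d C"
    unfolding depth_le_def io_path_iff root(1)[symmetric]
    using path_from_of_path_to path_from_antimono * by (meson not_less_eq_eq)
qed

text \<open>\<open>two_big_below d\<close> searches only \<open>d\<close> levels; the depth bound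
  makes the search exhaustive.\<close>

lemma weft_le_iff: "depth_le d C \<Longrightarrow> weft_le 1 C \<longleftrightarrow> \<not> two_big_below d g (root g)"
proof
  assume "weft_le 1 C"
  then show "\<not> two_big_below d g (root g)"
    using path_to_of_two_big_below[OF _ root(2)] unfolding weft_le_def io_path_iff root(1)[symmetric]
    by fastforce
next
  assume d: "depth_le d C" and *: "\<not> two_big_below d g (root g)"
  show "weft_le 1 C"
    unfolding weft_le_def io_path_iff root(1)[symmetric]
  proof (intro allI impI)
    fix p assume p: "path_to C (root g) p"
    then have "length p \<le> Suc d" using d unfolding depth_le_def io_path_iff root(1)[symmetric] by force
    then show "nlarge p \<le> 1" using two_big_below_of_path_to[OF p] * by fastforce
  qed
qed

lemma weft_two_big_below: "weft_le 1 C \<Longrightarrow> \<not> two_big_below l g (root g)"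
  using path_to_of_two_big_below[OF _ root(2)] unfolding weft_le_def io_path_iff root(1)[symmetric]
  by fastforce

end

lemma valid_iff: "valid d g \<longleftrightarrow> wf_circuit C \<and> depth_le d C \<and> weft_le 1 C"
  unfolding valid_def wf_code using depth_le_iff weft_le_iff by blast

end

section \<open>Selection problems as Roman hitting functions\<close>

text \<open>The first \<open>V\<close> vertices are the selectable ones, and value 2 means that a vertex is selected.
  The edges below \<open>K\<close> are the sets \<open>G i\<close> that have to be hit, edge \<open>K\<close> absorbs \<open>\<tau>\<close>, and the edges from
  \<open>K + 1\<close> on are the \<open>M\<close> potential private edges of each of the vertices. Each of the latter edges has
  its own vertex that can hit it with value 1 if no selected vertex does.\<close>

locale gadget_data =
  fixes V M K :: nat and F :: "nat \<Rightarrow> bool" and G :: "nat \<Rightarrow> nat \<Rightarrow> bool" and E :: "nat \<Rightarrow> nat \<Rightarrow> nat \<Rightarrow> bool"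
begin

definition "nverts = V + V * M"
definition "nedges = Suc K + V * M"

definition inc :: "nat \<Rightarrow> nat \<Rightarrow> bool" where
  "inc i y \<longleftrightarrow> (if i < K then y < V \<and> G i y else if i = K then True
     else V \<le> y \<and> y - V = i - Suc K \<or>
       (\<exists>x<V. \<exists>e<M. i = Suc K + (x * M + e) \<and> y < V \<and> (y = x \<or> E x e y)))"

definition edge :: "nat \<Rightarrow> nat set" where
  "edge i = {y. y < nverts \<and> inc i y}"

definition \<tau> :: "nat \<Rightarrow> nat" where
  "\<tau> y = (if y < V then K else Suc K + (y - V))"

definition f :: "nat \<Rightarrow> nat" where
  "f y = (if y < V \<and> F y then 2 else 0)"

end

text \<open>\<open>forced_ex\<close> makes a selected vertex hit edge \<open>K\<close>.
  \<open>forced_not_in_group\<close> keeps the sets to be hit from serving as private edges of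
  forced vertices. By \<open>private_forced\<close>, the edges of any other vertex contain no second
  selectable vertex, so selecting it never violates minimality.\<close>

locale gadget = gadget_data +
  assumes forced_ex: "\<exists>x<V. F x" and M_pos: "0 < M"
    and forced_not_in_group: "\<And>i x. F x \<Longrightarrow> \<not> G i x"
    and private_forced: "\<And>x e y. E x e y \<Longrightarrow> F x"
begin

lemma index_less: "x < V \<Longrightarrow> e < M \<Longrightarrow> x * M + e < V * M"
proof -
  assume "x < V" "e < M"
  then have "x * M + e < Suc x * M" by simp
  also have "\<dots> \<le> V * M" using \<open>x < V\<close> by (intro mult_right_mono) auto
  finally show ?thesis .
qed

lemma index_eq: "e < M \<Longrightarrow> e' < M \<Longrightarrow> x * M + e = x' * M + e' \<longleftrightarrow> x = x' \<and> e = e'"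
  using M_pos by (metis add.commute div_mult_self1 div_less add_0 mod_mult_self1 mod_less neq0_conv mult.commute)

lemma V_pos: "0 < V"
  using forced_ex by auto

lemma hypergraph: "hypergraph {..<nverts} {..<nedges} edge"
  unfolding hypergraph_def edge_def by auto

lemma correspondence: "correspondence {..<nverts} {..<nedges} edge \<tau>"
  unfolding correspondence_def edge_def inc_def \<tau>_def nverts_def nedges_def by auto

lemma f_range: "f \<in> {..<nverts} \<rightarrow> {0, 1, 2}"
  unfolding f_def by auto

lemma kappa1: "kappa1 {..<nverts} {..<nedges} \<tau> = K"
proof -
  have "{i \<in> {..<nedges}. {x \<in> {..<nverts}. \<tau> x = i} = {}} = {..<K}"
  proof (intro equalityI subsetI)
    fix i assume i: "i \<in> {i \<in> {..<nedges}. {x \<in> {..<nverts}. \<tau> x = i} = {}}"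
    show "i \<in> {..<K}"
    proof (rule ccontr)
      assume "i \<notin> {..<K}"
      then consider "i = K" | j where "i = Suc K + j" "j < V * M"
        using i by (auto simp: nedges_def) (metis Suc_leI add_diff_inverse_nat add_less_cancel_left
          le_neq_implies_less linorder_not_less plus_nat.simps(2))
      then show False
      proof cases
        case 1
        then have "0 \<in> {x \<in> {..<nverts}. \<tau> x = i}" using V_pos by (auto simp: \<tau>_def nverts_def)
        then show False using i by blast
      next
        case 2
        then have "V + j \<in> {x \<in> {..<nverts}. \<tau> x = i}" by (auto simp: \<tau>_def nverts_def)
        then show False using i by blast
      qed
    qed
  qed (auto simp: \<tau>_def nedges_def split: if_splits)
  then show ?thesis unfolding kappa1_def by simp
qed

lemma ext_rhf_iff:
  "ext_rhf {..<nverts} {..<nedges} edge \<tau> f \<longleftrightarrow>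
    (\<exists>S\<subseteq>{..<V}. (\<forall>x<V. F x \<longrightarrow> x \<in> S \<and> (\<exists>e<M. \<forall>y\<in>S. E x e y \<longrightarrow> y = x)) \<and> (\<forall>i<K. \<exists>y\<in>S. G i y))"
  (is "_ \<longleftrightarrow> (\<exists>S\<subseteq>_. ?P S)")
proof
  assume "ext_rhf {..<nverts} {..<nedges} edge \<tau> f"
  then obtain g where g: "rhf {..<nverts} {..<nedges} edge \<tau> g" "\<forall>x\<in>{..<nverts}. f x \<le> g x"
    and min: "\<And>h. rhf {..<nverts} {..<nedges} edge \<tau> h \<Longrightarrow> \<forall>x\<in>{..<nverts}. h x \<le> g x \<Longrightarrow> \<forall>x\<in>{..<nverts}. h x = g x"
    unfolding ext_rhf_def minimal_rhf_def by blast
  have range: "g x \<in> {0, 1, 2}" if "x < nverts" for x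
    using g(1) that unfolding rhf_def by (auto simp: Pi_def)
  have hit: "(\<exists>x\<in>edge i. g x = 2) \<or> (\<exists>x\<in>{..<nverts}. \<tau> x = i \<and> g x = 1)" if "i < nedges" for i
    using g(1) that unfolding rhf_def by blast
  define S where "S = {y. y < V \<and> g y = 2}"
  have V: "x < nverts" if "x < V" for x using that by (simp add: nverts_def)
  have "?P S"
  proof (intro conjI allI impI)
    fix x assume x: "x < V" "F x"
    then have "2 \<le> g x" using g(2) V[OF x(1)] unfolding f_def by force
    then have x2: "g x = 2" using range[OF V[OF x(1)]] by auto
    then show "x \<in> S" unfolding S_def using x by simp
    \<comment> \<open>With value 1 instead of 0, \<open>x\<close> still hits edge \<open>K\<close>,
      so the edge that becomes unhit is another one.\<close>
    define h where "h = g(x := 1)"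
    have "\<not> rhf {..<nverts} {..<nedges} edge \<tau> h"
      using min[of h] V[OF x(1)] x2 by (force simp: h_def)
    moreover have "h \<in> {..<nverts} \<rightarrow> {0, 1, 2}"
      using range unfolding h_def by fastforce
    ultimately obtain i where i: "i < nedges" "\<not> (\<exists>x\<in>edge i. h x = 2)"
      "\<not> (\<exists>x\<in>{..<nverts}. \<tau> x = i \<and> h x = 1)" unfolding rhf_def by auto
    have xi: "x \<in> edge i" and uniq: "\<And>y. y \<in> edge i \<Longrightarrow> g y = 2 \<Longrightarrow> y = x"
      using i hit[OF i(1)] x2 unfolding h_def
      by (metis fun_upd_apply One_nat_def n_not_Suc_n numeral_2_eq_2)+
    have "\<not> i < K" using xi forced_not_in_group[OF x(2)] by (auto simp: edge_def inc_def)
    moreover have "\<tau> x = K" "h x = 1" using x(1) by (auto simp: \<tau>_def h_def)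
    then have "i \<noteq> K" using i(3) V[OF x(1)] by blast
    ultimately obtain x' e where e: "x' < V" "e < M" "i = Suc K + (x' * M + e)" "x = x' \<or> E x' e x"
      using xi x(1) unfolding edge_def inc_def by auto
    have sub: "y \<in> edge i" if "y < V" "y = x' \<or> E x' e y" for y
      unfolding edge_def inc_def using e that V by auto
    \<comment> \<open>The edge found might belong to another vertex \<open>x'\<close>. But then
      \<open>x'\<close> is forced, has value 2 and lies in its own edge, where \<open>x\<close> is
      the only vertex with value 2.\<close>
    have "F x'" using e(4) x(2) private_forced by blast
    then have "2 \<le> g x'" using g(2) V[OF e(1)] e(1) unfolding f_def by force
    then have "g x' = 2" using range[OF V[OF e(1)]] by auto
    then have "x' = x" using uniq sub e(1) by blast
    then have "\<forall>y\<in>S. E x e y \<longrightarrow> y = x" using uniq sub unfolding S_def by blast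
    then show "\<exists>e<M. \<forall>y\<in>S. E x e y \<longrightarrow> y = x" using e(2) by blast
  next
    fix i assume i: "i < K"
    then have "\<tau> x \<noteq> i" for x unfolding \<tau>_def by arith
    then obtain x where "x \<in> edge i" "g x = 2" using hit[of i] i by (auto simp: nedges_def)
    then show "\<exists>y\<in>S. G i y" using i unfolding S_def edge_def inc_def by auto
  qed
  moreover have "S \<subseteq> {..<V}" unfolding S_def by auto
  ultimately show "\<exists>S\<subseteq>{..<V}. ?P S" by blast
next
  assume "\<exists>S\<subseteq>{..<V}. ?P S"
  then obtain S where S: "S \<subseteq> {..<V}" "?P S" by blast
  \<comment> \<open>The own vertex of an edge gets 1 only if nothing else hits the edge, so no 1 can
    be lowered.\<close>
  define g :: "nat \<Rightarrow> nat" where "g y = (if y < V then if y \<in> S then 2 else 0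
    else if edge (Suc K + (y - V)) \<inter> S = {} then 1 else 0)" for y
  have g2: "g y = 2 \<longleftrightarrow> y \<in> S" for y using S(1) unfolding g_def by auto
  have V: "x < nverts" if "x < V" for x using that by (simp add: nverts_def)
  have "rhf {..<nverts} {..<nedges} edge \<tau> g"
    unfolding rhf_def
  proof (intro conjI ballI)
    show "g \<in> {..<nverts} \<rightarrow> {0, 1, 2}" unfolding g_def by auto
    fix i assume "i \<in> {..<nedges}"
    then have "i < K \<or> i = K \<or> i > K \<and> i - Suc K < V * M"
      by (auto simp: nedges_def)
    then consider "i < K" | "i = K" | j where "i = Suc K + j" "j < V * M"
      by (metis Suc_leI add_diff_inverse_nat linorder_not_less)
    then show "(\<exists>x\<in>edge i. g x = 2) \<or> (\<exists>x\<in>{..<nverts}. \<tau> x = i \<and> g x = 1)"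
    proof cases
      case 1
      then obtain y where "y \<in> S" "G i y" using S by blast
      then have "y \<in> edge i" "g y = 2" using 1 S(1) V g2 unfolding edge_def inc_def by auto
      then show ?thesis by blast
    next
      case 2
      obtain y where "y < V" "F y" using forced_ex by blast
      then have "y \<in> S" using S by blast
      then have "y \<in> edge i" "g y = 2" using 2 S(1) V g2 unfolding edge_def inc_def by auto
      then show ?thesis by blast
    next
      case 3
      show ?thesis
      proof (cases "edge i \<inter> S = {}")
        case True
        then have "V + j \<in> {..<nverts}" "\<tau> (V + j) = i" "g (V + j) = 1"
          using 3 unfolding nverts_def \<tau>_def g_def by auto
        then show ?thesis by blast
      qed (use g2 in blast)
    qed
  qed
  moreover have "\<forall>x\<in>{..<nverts}. h x = g x"
    if h: "rhf {..<nverts} {..<nedges} edge \<tau> h" and le: "\<forall>x\<in>{..<nverts}. h x \<le> g x" for h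
  proof (rule ccontr)
    have hit: "(\<exists>x\<in>edge i. h x = 2) \<or> (\<exists>x\<in>{..<nverts}. \<tau> x = i \<and> h x = 1)" if "i < nedges" for i
      using h that unfolding rhf_def by blast
    have edge: "y < nverts" if "y \<in> edge i" for y i using that by (simp add: edge_def)
    have h2: "y \<in> S" if "h y = 2" "y < nverts" for y
    proof -
      have "2 \<le> g y" using le that by force
      moreover have "g y \<in> {0, 1, 2}" unfolding g_def by auto
      ultimately show ?thesis using g2[of y] by auto
    qed
    assume "\<not> (\<forall>x\<in>{..<nverts}. h x = g x)"
    then obtain y where y: "y < nverts" "h y \<noteq> g y" by blast
    with le have less: "h y < g y" by force
    show False
    proof (cases "y < V")
      case True
      with less have yS: "y \<in> S" using g2 by (auto simp: g_def split: if_splits)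
      \<comment> \<open>A vertex that is not forced may use any of its edges as a private one, by
        \<open>private_forced\<close>.\<close>
      obtain e where e: "e < M" "\<forall>y'\<in>S. E y e y' \<longrightarrow> y' = y"
      proof (cases "F y")
        case True
        then show ?thesis using S \<open>y < V\<close> that by blast
      next
        case False
        then show ?thesis using private_forced M_pos that by blast
      qed
      define i where "i = Suc K + (y * M + e)"
      have i: "i < nedges" using index_less[OF True e(1)] by (simp add: i_def nedges_def)
      have uniq: "y' = y" if "y' \<in> edge i" "y' \<in> S" for y'
        using that e S(1) index_eq[OF e(1)] unfolding edge_def inc_def i_def by auto
      have yi: "y \<in> edge i" using True V e(1) unfolding edge_def inc_def i_def by auto
      from hit[OF i] show False
      proof
        assume "\<exists>x\<in>edge i. h x = 2"
        then show False using uniq h2 edge less g2 yS by (metis less_irrefl)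
      next
        assume "\<exists>x\<in>{..<nverts}. \<tau> x = i \<and> h x = 1"
        then obtain x where x: "x < nverts" "\<tau> x = i" "h x = 1" by blast
        then have "\<not> x < V" "Suc K + (x - V) = i" by (auto simp: \<tau>_def i_def split: if_splits)
        then have "g x = 0" using yi yS unfolding g_def by auto
        then show False using le x by force
      qed
    next
      case False
      define i where "i = Suc K + (y - V)"
      have i: "i < nedges" using y(1) False unfolding i_def nedges_def nverts_def by auto
      have empty: "edge i \<inter> S = {}" and "g y = 1"
        using less False unfolding g_def i_def by (auto split: if_splits)
      with less have "h y = 0" by simp
      from hit[OF i] show False
      proof
        assume "\<exists>x\<in>edge i. h x = 2"
        then show False using empty h2 edge by blast
      next
        assume "\<exists>x\<in>{..<nverts}. \<tau> x = i \<and> h x = 1"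
        then obtain x where x: "\<tau> x = i" "h x = 1" by blast
        then have "x = y" using False by (auto simp: \<tau>_def i_def split: if_splits)
        then show False using x \<open>h y = 0\<close> by simp
      qed
    qed
  qed
  moreover have "\<forall>x\<in>{..<nverts}. f x \<le> g x"
    using S unfolding f_def g_def by auto
  ultimately show "ext_rhf {..<nverts} {..<nedges} edge \<tau> f"
    unfolding ext_rhf_def minimal_rhf_def by blast
qed

end

section \<open>Injectivity of the encoding of instances\<close>

lemma encode_nats_Cons: "encode_nats (n # ns) = replicate n True @ False # encode_nats ns"
  by (simp add: encode_nats_def)

lemma replicate_True_eq: "replicate n True @ False # x = replicate m True @ False # y \<Longrightarrow> n = m \<and> x = y"
proof (induction n arbitrary: m)
  case 0
  then show ?case by (cases m) auto
next
  case (Suc n)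
  then show ?case by (cases m) auto
qed

lemma encode_nats_inj: "encode_nats ms = encode_nats ns \<longleftrightarrow> ms = ns"
proof
  assume "encode_nats ms = encode_nats ns"
  then show "ms = ns"
  proof (induction ms arbitrary: ns)
    case Nil
    then show ?case by (cases ns) (auto simp: encode_nats_def)
  next
    case (Cons m ms)
    then show ?case
      by (cases ns) (auto simp: encode_nats_Cons dest!: replicate_True_eq, simp add: encode_nats_def)
  qed
qed simp

lemma length_concat_const: "\<forall>x\<in>set xs. length (F x) = n \<Longrightarrow> length (concat (map F xs)) = length xs * n"
  by (induction xs) auto

lemma concat_map_eq_const:
  assumes "concat (map F xs) = concat (map F' xs)" "\<And>x. length (F x) = length (F' x)" "x \<in> set xs"
  shows "F x = F' x"
  using assms by (induction xs) auto

text \<open>Membership in the problem only provides some instance with the given code. The two need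
  to agree only where the code looks; \<open>n\<close> and \<open>m\<close> fix the lengths of its
  parts.\<close>

lemma encode_instance_eqD:
  assumes "encode_instance n m s \<tau> f = encode_instance n' m' s' \<tau>' f'"
  shows "n' = n" "m' = m" "\<And>i x. i < m \<Longrightarrow> x < n \<Longrightarrow> x \<in> s i \<longleftrightarrow> x \<in> s' i"
    "\<And>x. x < n \<Longrightarrow> \<tau> x = \<tau>' x" "\<And>x. x < n \<Longrightarrow> f x = f' x"
proof -
  note eq = assms[unfolded encode_instance_def encode_nats_inj]
  from eq show nm: "n' = n" "m' = m" by auto
  let ?A = "\<lambda>s::nat \<Rightarrow> nat set. concat (map (\<lambda>i. map (\<lambda>x. of_bool (x \<in> s i) :: nat) [0..<n]) [0..<m])"
  have "length (?A s) = m * n" for s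
    by (subst length_concat_const[of _ _ n]) auto
  then have *: "?A s = ?A s'" "map \<tau> [0..<n] = map \<tau>' [0..<n]" "map f [0..<n] = map f' [0..<n]"
    using eq unfolding nm by (simp_all add: append_eq_append_conv)
  show "\<And>x. x < n \<Longrightarrow> \<tau> x = \<tau>' x" "\<And>x. x < n \<Longrightarrow> f x = f' x" using *(2,3) by auto
  fix i x assume ix: "i < m" "x < n"
  have "map (\<lambda>x. of_bool (x \<in> s i) :: nat) [0..<n] = map (\<lambda>x. of_bool (x \<in> s' i)) [0..<n]"
    by (rule concat_map_eq_const[OF *(1)]) (use ix in auto)
  then show "x \<in> s i \<longleftrightarrow> x \<in> s' i" using ix by (auto simp: of_bool_eq_iff)
qed

lemma ext_rhf_cong:
  assumes "\<And>i. i \<in> I \<Longrightarrow> s i = s' i" "\<And>x. x \<in> X \<Longrightarrow> \<tau> x = \<tau>' x" "\<And>x. x \<in> X \<Longrightarrow> f x = f' x"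
  shows "ext_rhf X I s \<tau> f \<longleftrightarrow> ext_rhf X I s' \<tau>' f'"
proof -
  have "rhf X I s \<tau> g \<longleftrightarrow> rhf X I s' \<tau>' g" for g
    unfolding rhf_def using assms by simp
  then show ?thesis unfolding ext_rhf_def minimal_rhf_def using assms by simp
qed

lemma encode_instance_in_ExtensionRHF:
  assumes "hypergraph {..<n} {..<m} s" "correspondence {..<n} {..<m} s \<tau>" "f \<in> {..<n} \<rightarrow> {0, 1, 2}"
    and "k = kappa1 {..<n} {..<m} \<tau>"
  shows "(encode_instance n m s \<tau> f, k) \<in> ExtensionRHF_kappa1 \<longleftrightarrow> ext_rhf {..<n} {..<m} s \<tau> f"
proof
  assume "(encode_instance n m s \<tau> f, k) \<in> ExtensionRHF_kappa1"
  then obtain n' m' s' \<tau>' f' where eq: "encode_instance n m s \<tau> f = encode_instance n' m' s' \<tau>' f'"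
    and *: "hypergraph {..<n'} {..<m'} s'" "ext_rhf {..<n'} {..<m'} s' \<tau>' f'"
    unfolding ExtensionRHF_kappa1_def by blast
  note D = encode_instance_eqD[OF eq]
  have "s i = s' i" if "i < m" for i
    using D(3)[OF that] assms(1) *(1) that unfolding D hypergraph_def by blast
  then have "ext_rhf {..<n} {..<m} s \<tau> f \<longleftrightarrow> ext_rhf {..<n} {..<m} s' \<tau>' f'"
    by (intro ext_rhf_cong) (use D(4,5) in auto)
  then show "ext_rhf {..<n} {..<m} s \<tau> f" using * D by simp
next
  assume "ext_rhf {..<n} {..<m} s \<tau> f"
  then show "(encode_instance n m s \<tau> f, k) \<in> ExtensionRHF_kappa1"
    unfolding ExtensionRHF_kappa1_def using assms by blast
qed

section \<open>Cantor pairs\<close>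

lemma triangle_sum: "triangle n = (\<Sum>i\<le>n. i)"
  by (induction n) auto

lemma is_pair_iff: "a < bnd g \<Longrightarrow> b < bnd g \<Longrightarrow> is_pair g a b e \<longleftrightarrow> prod_encode (a, b) = e"
proof -
  assume "a < bnd g" "b < bnd g"
  then have "{..<bnd g + bnd g} \<inter> {i. i \<le> a + b} = {..a + b}" by auto
  then have "(\<Sum>i<bnd g + bnd g. if i \<le> a + b then i else 0) = triangle (a + b)"
    by (simp add: sum.If_cases triangle_sum)
  then show ?thesis by (simp add: is_pair_def prod_encode_def)
qed

lemma pl_pair: "prod_encode (a, b) < bnd g \<Longrightarrow> pl g (prod_encode (a, b)) = a"
  and pr_pair: "prod_encode (a, b) < bnd g \<Longrightarrow> pr g (prod_encode (a, b)) = b"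
proof -
  assume less: "prod_encode (a, b) < bnd g"
  then have ab: "a < bnd g" "b < bnd g"
    using le_prod_encode_1[of a b] le_prod_encode_2[of b a] by simp_all
  have "pl g (prod_encode (a, b)) = (\<Sum>a'<bnd g. if a' = a then (\<Sum>b'<bnd g. if b' = b then a' else 0) else 0)"
    unfolding pl_def by (intro sum.cong refl) (auto simp: is_pair_iff)
  then show "pl g (prod_encode (a, b)) = a" using ab by simp
  have "pr g (prod_encode (a, b)) = (\<Sum>a'<bnd g. if a' = a then (\<Sum>b'<bnd g. if b' = b then b' else 0) else 0)"
    unfolding pr_def by (intro sum.cong refl) (auto simp: is_pair_iff)
  then show "pr g (prod_encode (a, b)) = b" using ab by simp
qed

text \<open>For \<open>N = Suc M\<close>, the components add up to at most \<open>2 * M\<close>,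
  whose triangular number is \<open>M * (2 * M + 1)\<close>.\<close>

lemma prod_encode_bound:
  assumes "a < N" "b < N"
  shows "prod_encode (a, b) < 4 * N * N"
proof -
  obtain M where N: "N = Suc M" using assms by (cases N) auto
  have "triangle (a + b) \<le> triangle (2 * M)" 
    unfolding triangle_sum using assms N by (intro sum_mono2) auto
  also have "\<dots> = M * Suc (2 * M)" by (simp add: triangle_def)
  finally have "prod_encode (a, b) \<le> M * Suc (2 * M) + M" using assms N by (simp add: prod_encode_def)
  also have "\<dots> < 4 * N * N" unfolding N by (simp add: algebra_simps)
  finally show ?thesis .
qed

lemma prod_encode_iterbnd:
  assumes "a < iterbnd l N" "b < iterbnd l N"
  shows "prod_encode (a, b) < iterbnd (Suc l) N"
  using prod_encode_bound[OF assms] by simp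

lemma iterbnd_le: "1 \<le> N \<Longrightarrow> l \<le> m \<Longrightarrow> iterbnd l N \<le> iterbnd m N"
  by (rule lift_Suc_mono_le[of "\<lambda>l. iterbnd l N"]) (use iterbnd_mono in blast)+


section \<open>Guesses\<close>

text \<open>Turns the recursion in \<open>ex_leaf\<close> into a quantifier over a set of leaf
  occurrences with their guesses.\<close>

primrec insts :: "nat \<Rightarrow> ctx \<Rightarrow> nat \<Rightarrow> nat \<Rightarrow> (nat \<times> nat) set" where
  "insts 0 g a e = {(a, e)}"
| "insts (Suc l) g a e = (if leaf g a then {(a, e)} else insts l g (arg g a 0) (pl g e) \<union>
     (if kind g a = 1 then {} else insts l g (arg g a 1) (pr g e)))"

lemma ex_leaf_iff: "ex_leaf l g Q a e \<longleftrightarrow> (\<exists>(v, e')\<in>insts l g a e. Q v e')"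
  by (induction l arbitrary: a e) auto

primrec leaves :: "nat \<Rightarrow> ctx \<Rightarrow> nat \<Rightarrow> nat set" where
  "leaves 0 g a = {a}"
| "leaves (Suc l) g a = (if leaf g a then {a} else leaves l g (arg g a 0) \<union>
     (if kind g a = 1 then {} else leaves l g (arg g a 1)))"

lemma insts_leaves: "(v, e') \<in> insts l g a e \<Longrightarrow> v \<in> leaves l g a"
  by (induction l arbitrary: a e) (auto split: if_splits)

lemma leaves_leaf: "leaf g a \<Longrightarrow> leaves l g a = {a}"
  by (cases l) auto

text \<open>Every branch meets a leaf within \<open>l\<close> levels, so the recursions never take a
  small gate for a leaf because \<open>l\<close> has run out.\<close>

primrec shallow :: "nat \<Rightarrow> ctx \<Rightarrow> nat \<Rightarrow> bool" where
  "shallow 0 g a = leaf g a"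
| "shallow (Suc l) g a = (leaf g a \<or> shallow l g (arg g a 0) \<and> (kind g a \<noteq> 1 \<longrightarrow> shallow l g (arg g a 1)))"

lemma shallow_leaf: "leaf g a \<Longrightarrow> shallow l g a"
  by (cases l) auto

lemma node_values_snoc: "node_values S (C @ [G]) = node_values S C @ [gate_value S (node_values S C) G]"
  by (simp add: node_values_def)

lemma length_node_values: "length (node_values S C) = length C"
  by (induction C rule: rev_induct) (simp_all add: node_values_snoc, simp add: node_values_def)

lemma node_values_nth:
  "a < length C \<Longrightarrow> node_values S C ! a = gate_value S (take a (node_values S C)) (C ! a)"
proof (induction C rule: rev_induct)
  case (snoc G C)
  show ?case
  proof (cases "a < length C")
    case True
    then show ?thesis using snoc by (simp add: node_values_snoc nth_append length_node_values)
  next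
    case False
    then have "a = length C" using snoc by simp
    then show ?thesis using length_node_values[of S C] by (simp add: node_values_snoc nth_append)
  qed
qed simp

locale valid_instance = encoded +
  fixes d :: nat
  assumes wf: "wf_circuit C" and depth: "depth_le d C" and weft: "weft_le 1 C"
    and bnd: "bnd g = iterbnd (d + 3) (len g + par g + 4)"
begin

abbreviation "N0 \<equiv> len g + par g + 4"

definition val :: "nat set \<Rightarrow> nat \<Rightarrow> bool" where
  "val S a = node_values S C ! a"

lemma isarg_less: "a < length C \<Longrightarrow> isarg g a b \<Longrightarrow> b < length C"
  using args_bounds[OF wf] by blast

lemma val_gate:
  assumes a: "a < length C"
  shows "kind g a = 0 \<Longrightarrow> val S a \<longleftrightarrow> a \<in> S"
    and "kind g a = 1 \<Longrightarrow> val S a \<longleftrightarrow> \<not> val S (arg g a 0)"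
    and "kind g a = 2 \<Longrightarrow> val S a \<longleftrightarrow> (\<forall>b. isarg g a b \<longrightarrow> val S b)"
    and "kind g a = 3 \<Longrightarrow> val S a \<longleftrightarrow> (\<exists>b. isarg g a b \<and> val S b)"
proof -
  have len: "length (take a (node_values S C)) = a" using a by (simp add: length_node_values)
  have take: "take a (node_values S C) ! b = val S b" if "b \<in> set (gate_args (C ! a))" for b
    using args_less[OF wf a that] by (simp add: val_def)
  have gv: "val S a = gate_value S (take a (node_values S C)) (C ! a)"
    unfolding val_def by (rule node_values_nth[OF a])
  show "kind g a = 0 \<Longrightarrow> val S a \<longleftrightarrow> a \<in> S"
    using gv len kind[OF a] by (cases "C ! a") auto
  show "kind g a = 1 \<Longrightarrow> val S a \<longleftrightarrow> \<not> val S (arg g a 0)"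
    using gv take kind[OF a] arg[OF a, of 0] by (cases "C ! a") auto
  show "kind g a = 2 \<Longrightarrow> val S a \<longleftrightarrow> (\<forall>b. isarg g a b \<longrightarrow> val S b)"
    using gv take kind[OF a] isarg[OF a] by (cases "C ! a") auto
  show "kind g a = 3 \<Longrightarrow> val S a \<longleftrightarrow> (\<exists>b. isarg g a b \<and> val S b)"
    using gv take kind[OF a] isarg[OF a] by (cases "C ! a") auto
qed

lemma kind_le: "a < length C \<Longrightarrow> kind g a \<le> 3"
  using kind[of a] by (simp split: gate.splits)

text \<open>A conjunction or disjunction has at least two arguments by \<open>gate_ok\<close>, and
  at most two if it is not large.\<close>

lemma not_leaf:
  assumes a: "a < length C" and "\<not> leaf g a"
  shows "isarg g a (arg g a 0)" "kind g a \<noteq> 1 \<Longrightarrow> isarg g a (arg g a 1)"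
    "kind g a \<noteq> 1 \<Longrightarrow> isarg g a b \<longleftrightarrow> b = arg g a 0 \<or> b = arg g a 1"
proof -
  have ok: "gate_ok (C ! a)" using wf a unfolding wf_circuit_def by blast
  have ni: "C ! a \<noteq> Input" "\<not> large (C ! a)" using assms leaf by auto
  have two: "kind g a \<noteq> 1 \<Longrightarrow> length (gate_args (C ! a)) = 2"
    using ok ni kind[OF a] by (cases "C ! a") (auto simp: large_def)
  have pos: "0 < length (gate_args (C ! a))" using ok ni by (cases "C ! a") auto
  show "isarg g a (arg g a 0)" using pos by (simp add: isarg[OF a] arg[OF a])
  assume *: "kind g a \<noteq> 1"
  show "isarg g a (arg g a 1)" using two[OF *] by (simp add: isarg[OF a] arg[OF a])
  show "isarg g a b \<longleftrightarrow> b = arg g a 0 \<or> b = arg g a 1"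
    using two[OF *] unfolding isarg[OF a] in_set_conv_nth
    by (auto simp: arg[OF a] less_2_cases_iff)
qed

lemma guess_value_correct:
  assumes "a < length C" "shallow l g a" "\<And>v e'. (v, e') \<in> insts l g a e \<Longrightarrow> pl g e' = 1 \<longleftrightarrow> val S v"
  shows "guess_value l g a e \<longleftrightarrow> val S a"
  using assms
proof (induction l arbitrary: a e)
  case 0
  then show ?case by simp
next
  case (Suc l)
  show ?case
  proof (cases "leaf g a")
    case True
    then show ?thesis using Suc.prems(3) by simp
  next
    case False
    note n = not_leaf[OF Suc.prems(1) False]
    have IH0: "guess_value l g (arg g a 0) (pl g e) \<longleftrightarrow> val S (arg g a 0)"
      using Suc.prems False isarg_less[OF Suc.prems(1) n(1)] by (intro Suc.IH) auto
    have IH1: "guess_value l g (arg g a 1) (pr g e) \<longleftrightarrow> val S (arg g a 1)" if "kind g a \<noteq> 1"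
      using Suc.prems False that isarg_less[OF Suc.prems(1) n(2)] by (intro Suc.IH) auto
    have "kind g a \<noteq> 0" using False by (simp add: leaf_def)
    then consider "kind g a = 1" | "kind g a = 2" | "kind g a = 3" using kind_le[OF Suc.prems(1)] by linarith
    then show ?thesis
    proof cases
      case 1
      then show ?thesis using False IH0 val_gate(2)[OF Suc.prems(1)] by simp
    next
      case 2
      then show ?thesis using False IH0 IH1 val_gate(3)[OF Suc.prems(1)] n(3) by auto
    next
      case 3
      then show ?thesis using False IH0 IH1 val_gate(4)[OF Suc.prems(1)] n(3) by auto
    qed
  qed
qed

text \<open>Guesses belong to occurrences of leaves, so suitable ones can be paired upwards without
  having to agree. Each level of gates costs one level of the bound.\<close>

lemma guess_exists:
  assumes "a < length C" "shallow l g a" "\<And>v. v \<in> leaves l g a \<Longrightarrow> \<exists>e<N. OK v e"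
    and "1 \<le> N" "iterbnd l N \<le> bnd g"
  shows "\<exists>e<iterbnd l N. \<forall>(v, e')\<in>insts l g a e. OK v e'"
  using assms
proof (induction l arbitrary: a)
  case 0
  then show ?case by simp
next
  case (Suc l)
  have mono: "iterbnd l N \<le> iterbnd (Suc l) N" "1 \<le> iterbnd l N" "N \<le> iterbnd (Suc l) N"
    using iterbnd_mono[OF Suc.prems(4), of l] iterbnd_le[OF Suc.prems(4), of 0 "Suc l"] by simp_all
  show ?case
  proof (cases "leaf g a")
    case True
    then obtain e where "e < N" "OK a e" using Suc.prems(3) by auto
    then show ?thesis using True mono by (intro exI[of _ e]) simp
  next
    case False
    note n = not_leaf[OF Suc.prems(1) False]
    have le: "iterbnd l N \<le> bnd g" using mono(1) Suc.prems(5) by (rule order_trans)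
    obtain e1 where e1: "e1 < iterbnd l N" "\<forall>(v, e')\<in>insts l g (arg g a 0) e1. OK v e'"
      using Suc.IH[of "arg g a 0"] Suc.prems(2-4) False isarg_less[OF Suc.prems(1) n(1)] le by auto
    obtain e2 where e2: "e2 < iterbnd l N" "kind g a \<noteq> 1 \<Longrightarrow> \<forall>(v, e')\<in>insts l g (arg g a 1) e2. OK v e'"
    proof (cases "kind g a = 1")
      case True
      \<comment> \<open>A negation has one argument; 0 fills the second component.\<close>
      then show ?thesis using that[of 0] mono(2) by simp
    next
      case k: False
      then show ?thesis
        using that Suc.IH[of "arg g a 1"] Suc.prems(2-4) False isarg_less[OF Suc.prems(1) n(2)] le by auto
    qed
    have less: "prod_encode (e1, e2) < iterbnd (Suc l) N" by (rule prod_encode_iterbnd[OF e1(1) e2(1)])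
    then have "prod_encode (e1, e2) < bnd g" using Suc.prems(5) by simp
    then have "insts (Suc l) g a (prod_encode (e1, e2)) = insts l g (arg g a 0) e1 \<union>
        (if kind g a = 1 then {} else insts l g (arg g a 1) e2)"
      using False by (simp add: pl_pair pr_pair)
    then show ?thesis
      using less e1(2) e2(2) by (intro exI[of _ "prod_encode (e1, e2)"]) (simp add: ball_Un)
  qed
qed

lemma shallow_if_no_path: "\<not> path_from (Suc l) g a \<Longrightarrow> a < length C \<Longrightarrow> shallow l g a"
proof (induction l arbitrary: a)
  case 0
  have "leaf g a"
  proof (rule ccontr)
    assume "\<not> leaf g a"
    then have *: "isarg g a (arg g a 0)" using not_leaf(1)[OF 0(2)] by blast
    then have "path_from (Suc 0) g a"
      unfolding path_from.simps using args_bounds[OF wf 0(2) *] by blast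
    then show False using 0(1) by blast
  qed
  then show ?case by simp
next
  case (Suc l)
  have "shallow l g b" if "isarg g a b" for b
    using Suc that args_bounds[OF wf Suc.prems(2) that] by (meson path_from.simps(2))
  then show ?case using not_leaf(1,2)[OF Suc.prems(2)] by auto
qed

text \<open>Climbing from a leaf to \<open>a\<close> adds an unknown number of levels, which the
  existential quantifier over \<open>m\<close> hides. Used for long paths and for large
  gates.\<close>

lemma leaves_lift:
  assumes step: "\<And>b c. c < length C \<Longrightarrow> isarg g c b \<Longrightarrow> (\<exists>m\<ge>k. P m b) \<Longrightarrow> (\<exists>m\<ge>k. P m c)"
  shows "v \<in> leaves l g a \<Longrightarrow> a < length C \<Longrightarrow> (\<exists>m\<ge>k. P m v) \<Longrightarrow> (\<exists>m\<ge>k. P m a)"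
proof (induction l arbitrary: a)
  case (Suc l)
  show ?case
  proof (cases "leaf g a")
    case False
    note n = not_leaf[OF Suc.prems(2) False]
    from Suc.prems False consider "v \<in> leaves l g (arg g a 0)" | "kind g a \<noteq> 1" "v \<in> leaves l g (arg g a 1)"
      by (auto split: if_splits)
    then show ?thesis
    proof cases
      case 1
      then show ?thesis
        using Suc.IH[OF 1 isarg_less[OF Suc.prems(2) n(1)] Suc.prems(3)] step[OF Suc.prems(2) n(1)] by blast
    next
      case 2
      then show ?thesis
        using Suc.IH[OF 2(2) isarg_less[OF Suc.prems(2) n(2)] Suc.prems(3)] step[OF Suc.prems(2) n(2)] by blast
    qed
  qed (use Suc in auto)
qed simp

lemma leaves_less: "v \<in> leaves l g a \<Longrightarrow> a < length C \<Longrightarrow> v < length C"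
proof (induction l arbitrary: a)
  case (Suc l)
  show ?case
  proof (cases "leaf g a")
    case False
    note n = not_leaf[OF Suc.prems(2) False]
    from Suc.prems False consider "v \<in> leaves l g (arg g a 0)" | "kind g a \<noteq> 1" "v \<in> leaves l g (arg g a 1)"
      by (auto split: if_splits)
    then show ?thesis
      by cases (use Suc.IH isarg_less[OF Suc.prems(2)] n in blast)+
  qed (use Suc in simp)
qed simp

lemma path_from_lift: "c < length C \<Longrightarrow> isarg g c b \<Longrightarrow> \<exists>m\<ge>k. path_from m g b \<Longrightarrow> \<exists>m\<ge>k. path_from m g c"
  using args_bounds[OF wf] by (meson le_SucI path_from.simps(2))

lemma big_below_lift: "c < length C \<Longrightarrow> isarg g c b \<Longrightarrow> \<exists>m\<ge>k. big_below m g b \<Longrightarrow> \<exists>m\<ge>k. big_below m g c"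
  using args_bounds[OF wf] by (meson le_SucI big_below.simps(2))

lemma two_big_below_lift:
  "c < length C \<Longrightarrow> isarg g c b \<Longrightarrow> \<exists>m\<ge>k. two_big_below m g b \<Longrightarrow> \<exists>m\<ge>k. two_big_below m g c"
  using args_bounds[OF wf] by (meson le_SucI two_big_below.simps(2))

lemmas root_less = root(2)[OF wf]

lemma no_path: "\<not> path_from (Suc d) g (root g)"
  using depth depth_le_iff[OF wf] by blast

lemma shallow_root: "shallow d g (root g)"
  using shallow_if_no_path no_path root_less by blast

text \<open>This is where the weft enters: below a large gate there are only inputs and small gates.\<close>

lemma below_leaf:
  assumes v: "v \<in> leaves d g (root g)" and c: "kind g v = 0 \<and> c = v \<or> kind g v \<noteq> 0 \<and> isarg g v c"
  shows "c < length C" "shallow d g c" "\<And>u. u \<in> leaves d g c \<Longrightarrow> kind g u = 0"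
proof -
  have vC: "v < length C" using leaves_less[OF v root_less] .
  then show cC: "c < length C" using c isarg_less by blast
  have "shallow d g c \<and> (\<forall>u\<in>leaves d g c. kind g u = 0)"
  proof (cases "kind g v = 0")
    case True
    then have "leaf g c" using c by (simp add: leaf_def)
    then show ?thesis using c True by (simp add: shallow_leaf leaves_leaf)
  next
    case False
    then have arg: "isarg g v c" using c by simp
    have "\<not> path_from (Suc d) g c"
    proof
      assume "path_from (Suc d) g c"
      then have *: "\<exists>m\<ge>Suc d. path_from m g v" using path_from_lift[OF vC arg] by blast
      have "\<exists>m\<ge>Suc d. path_from m g (root g)"
        by (rule leaves_lift[where P = "\<lambda>m. path_from m g" and k = "Suc d", OF _ v root_less *]) (rule path_from_lift)
      then show False using no_path path_from_antimono by blast
    qed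
    then have sh: "shallow d g c" using shallow_if_no_path cC by blast
    have sub: "leaf g u" if "u \<in> leaves l g b" "shallow l g b" for u l b
      using that by (induction l arbitrary: b) (auto split: if_splits)
    have "kind g u = 0" if u: "u \<in> leaves d g c" for u
    proof (rule ccontr)
      assume "kind g u \<noteq> 0"
      then have "big g u" using sub[OF u sh] by (simp add: leaf_def)
      then have *: "\<exists>m\<ge>0. big_below m g u" by (intro exI[of _ 0]) simp
      have "\<exists>m\<ge>0. big_below m g c"
        by (rule leaves_lift[where P = "\<lambda>m. big_below m g" and k = 0, OF _ u cC *]) (rule big_below_lift)
      then obtain m where m: "big_below m g c" by blast
      have "leaf g v" using sub[OF v shallow_root] .
      then have "big g v" using False by (simp add: leaf_def)
      \<comment> \<open>The large gates \<open>v\<close> and \<open>u\<close> lie on one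
        path.\<close>
      then have "two_big_below (Suc m) g v" using m arg args_bounds[OF wf vC arg] by auto
      then have *: "\<exists>m\<ge>0. two_big_below m g v" by blast
      have "\<exists>m\<ge>0. two_big_below m g (root g)"
        by (rule leaves_lift[where P = "\<lambda>m. two_big_below m g" and k = 0, OF _ v root_less *]) (rule two_big_below_lift)
      then obtain m where "two_big_below m g (root g)" by blast
      then show False using weft_two_big_below[OF wf weft] by blast
    qed
    then show ?thesis using sh by blast
  qed
  then show "shallow d g c" "\<And>u. u \<in> leaves d g c \<Longrightarrow> kind g u = 0" by auto
qed

lemma relevant_cases:
  "witness_ok g a h \<Longrightarrow> relevant g a h c \<Longrightarrow> kind g a = 0 \<and> c = a \<or> kind g a \<noteq> 0 \<and> isarg g a c"
  unfolding witness_ok_def relevant_def by (auto split: if_splits)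

lemma leaf_kind: "a < length C \<Longrightarrow> leaf g a \<Longrightarrow> kind g a = 0 \<or> kind g a = 2 \<or> kind g a = 3"
  using kind[of a] leaf[of a] by (auto simp: large_def split: gate.splits)

text \<open>One false argument settles a conjunction and one true argument a disjunction; for the
  opposite values \<open>relevant\<close> covers all arguments.\<close>

lemma justified_leaf:
  assumes a: "a < length C" "leaf g a" and "witness_ok g a h"
    and rel: "\<And>c. relevant g a h c \<Longrightarrow> val S c \<longleftrightarrow> pl g h = 1"
  shows "pl g h = 1 \<longleftrightarrow> val S a"
proof -
  from leaf_kind[OF a] consider "kind g a = 0" | "kind g a = 2" | "kind g a = 3" by (elim disjE)
  then show ?thesis
  proof cases
    case 1
    then show ?thesis using rel[of a] by (simp add: relevant_def)
  next
    case 2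
    then show ?thesis
      using assms(3) rel val_gate(3)[OF a(1) 2, of S]
      by (cases "pl g h = 1") (auto simp: witness_ok_def one_suffices_def relevant_def)
  next
    case 3
    then show ?thesis
      using assms(3) rel val_gate(4)[OF a(1) 3, of S]
      by (cases "pl g h = 1") (auto simp: witness_ok_def one_suffices_def relevant_def)
  qed
qed

lemma N0_le: "1 \<le> N0" "length C \<le> N0" "par g \<le> N0"
  using length_C length_ns by simp_all

lemma iterbnd_le_bnd: "l \<le> d + 3 \<Longrightarrow> iterbnd l N0 \<le> bnd g"
  unfolding bnd by (rule iterbnd_le[OF N0_le(1)])

lemma iterbnd_split: "l \<le> m \<Longrightarrow> a < iterbnd l N0 \<Longrightarrow> a < iterbnd m N0"
  using iterbnd_le[OF N0_le(1)] by (meson less_le_trans)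

lemma pair_less:
  assumes "a < iterbnd l N0" "b < iterbnd m N0" "l < d + 3" "m < d + 3"
  shows "prod_encode (a, b) < iterbnd (Suc (max l m)) N0" "prod_encode (a, b) < bnd g"
    "pl g (prod_encode (a, b)) = a" "pr g (prod_encode (a, b)) = b"
proof -
  show less: "prod_encode (a, b) < iterbnd (Suc (max l m)) N0"
    using assms(1,2) iterbnd_split by (intro prod_encode_iterbnd) (metis max.cobounded1, metis max.cobounded2)
  have "iterbnd (Suc (max l m)) N0 \<le> bnd g" using assms(3,4) by (intro iterbnd_le_bnd) simp
  with less show b: "prod_encode (a, b) < bnd g" by (rule less_le_trans)
  show "pl g (prod_encode (a, b)) = a" "pr g (prod_encode (a, b)) = b"
    using pl_pair[OF b] pr_pair[OF b] by auto
qed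

lemma small_pair:
  assumes "a < N0" "b < N0"
  shows "prod_encode (a, b) < iterbnd 1 N0" "prod_encode (a, b) < bnd g"
    "pl g (prod_encode (a, b)) = a" "pr g (prod_encode (a, b)) = b"
  using pair_less[of a 0 b 0] assms by simp_all

text \<open>The code pairs the true value of \<open>a\<close> with an argument that settles it, or
  with 0 if no witness is called for. One level of pairs suffices.\<close>

lemma justified_exists:
  assumes a: "a < length C" "leaf g a"
  shows "\<exists>h<iterbnd 1 N0. witness_ok g a h \<and> (\<forall>c. relevant g a h c \<longrightarrow> (val S c \<longleftrightarrow> pl g h = 1))"
proof -
  define b :: nat where "b = of_bool (val S a)"
  have b: "b < N0" "b = 1 \<longleftrightarrow> val S a" unfolding b_def by auto
  from leaf_kind[OF a] consider "kind g a = 0" | "kind g a = 2" | "kind g a = 3" by (elim disjE)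
  then show ?thesis
  proof cases
    case 1
    then show ?thesis using small_pair[OF b(1), of 0] b(2)
      by (intro exI[of _ "prod_encode (b, 0)"]) (auto simp: relevant_def witness_ok_def one_suffices_def)
  next
    case 2
    obtain w where w: "w < N0" "\<not> val S a \<Longrightarrow> isarg g a w \<and> \<not> val S w"
    proof (cases "val S a")
      case True
      then show ?thesis using that[of 0] by simp
    next
      case False
      then obtain w where "isarg g a w" "\<not> val S w" using val_gate(3)[OF a(1) 2] by blast
      then show ?thesis using that isarg_less[OF a(1)] N0_le(2) by (meson less_le_trans)
    qed
    then show ?thesis using small_pair[OF b(1) w(1)] b(2) 2 val_gate(3)[OF a(1) 2, of S]
      by (intro exI[of _ "prod_encode (b, w)"]) (auto simp: relevant_def witness_ok_def one_suffices_def)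
  next
    case 3
    obtain w where w: "w < N0" "val S a \<Longrightarrow> isarg g a w \<and> val S w"
    proof (cases "val S a")
      case False
      then show ?thesis using that[of 0] by simp
    next
      case True
      then obtain w where "isarg g a w" "val S w" using val_gate(4)[OF a(1) 3] by blast
      then show ?thesis using that isarg_less[OF a(1)] N0_le(2) by (meson less_le_trans)
    qed
    then show ?thesis using small_pair[OF b(1) w(1)] b(2) 3 val_gate(4)[OF a(1) 3, of S]
      by (intro exI[of _ "prod_encode (b, w)"]) (auto simp: relevant_def witness_ok_def one_suffices_def)
  qed
qed

lemma shallow_leaves: "v \<in> leaves l g a \<Longrightarrow> shallow l g a \<Longrightarrow> leaf g v"
  by (induction l arbitrary: a) (auto split: if_splits)

end

section \<open>Selections and satisfying assignments\<close>

context valid_instance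
begin

text \<open>The right-hand side of \<open>gadget.ext_rhf_iff\<close>, with \<open>bnd g\<close> both
  as the number of selectable vertices and as the number of edges of each.\<close>

abbreviation selection :: "nat set \<Rightarrow> bool" where
  "selection Z \<equiv> Z \<subseteq> {..<bnd g} \<and>
     (\<forall>x<bnd g. forced g x \<longrightarrow> x \<in> Z \<and> (\<exists>e<bnd g. \<forall>y\<in>Z. excludes d g x e y \<longrightarrow> y = x)) \<and>
     (\<forall>i<Suc (par g). \<exists>y\<in>Z. group d g i y)"

lemma input_nodes_eq: "a \<in> input_nodes C \<longleftrightarrow> a < length C \<and> kind g a = 0"
  using kind[of a] unfolding input_nodes_def by (auto split: gate.splits)

lemma satisfies_iff: "satisfies S C \<longleftrightarrow> val S (root g)"
proof -
  have "node_values S C \<noteq> []" using length_node_values[of S C] root_less by auto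
  then show ?thesis
    unfolding satisfies_def val_def by (simp add: last_conv_nth length_node_values root(1)[OF wf])
qed

lemma const_less: "n < 5 \<Longrightarrow> n < iterbnd 1 N0" "n < 4 \<Longrightarrow> n < N0"
proof -
  assume n: "n < 5"
  have "4 * 4 * 4 \<le> 4 * N0 * N0" by (intro mult_mono) auto
  then show "n < iterbnd 1 N0" using n by simp
qed simp

text \<open>Being forced, a vertex of type 4 is in every selection and so spoils the edges of bad
  guesses.\<close>

lemma blocker: "\<exists>b<bnd g. pl g b = 4"
proof -
  have "4 < iterbnd 1 N0" "0 < iterbnd 1 N0" by (rule const_less; simp)+
  then show ?thesis using pair_less[of 4 1 0 1] by (intro exI[of _ "prod_encode (4, 0)"]) simp
qed

lemma zero_less_bnd: "0 < bnd g"
  using blocker by force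

lemma satisfiable_if_selection:
  assumes Z: "selection Z"
  shows "\<exists>T\<subseteq>input_nodes C. card T = par g \<and> satisfies T C"
proof -
  have excl: "\<exists>e<bnd g. \<forall>y\<in>Z. excludes d g x e y \<longrightarrow> y = x" if "x < bnd g" "2 \<le> pl g x" for x
    using Z that unfolding forced_def by blast
  from Z have groups: "\<forall>i<Suc (par g). \<exists>y\<in>Z. group d g i y" by (elim conjE)
  have "\<exists>y\<in>Z. pl g y = 0 \<and> pl g (pr g y) = i \<and> pr g (pr g y) \<in> input_nodes C" if i: "i < par g" for i
  proof -
    obtain y where "y \<in> Z" "group d g i y" using groups[rule_format, of i] i by auto
    then show ?thesis using i unfolding group_def input_nodes_eq ngates by auto
  qed
  \<comment> \<open>A selection may hit a set several times. Any choice will do, since the private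
    edges avoid all other selected vertices. The same goes for the guess \<open>h\<close>
    below.\<close>
  then obtain Y where Y: "\<And>i. i < par g \<Longrightarrow> Y i \<in> Z \<and> pl g (Y i) = 0 \<and> pl g (pr g (Y i)) = i \<and>
      pr g (pr g (Y i)) \<in> input_nodes C" by metis
  define \<sigma> where "\<sigma> i = pr g (pr g (Y i))" for i
  obtain y where y: "y \<in> Z" "group d g (par g) y" using groups[rule_format, of "par g"] by auto
  define h where "h = pr g y"
  from y(2) have y1: "pl g y = 1" and h: "guess_value d g (root g) h"
    and wit: "\<And>a h'. (a, h') \<in> insts d g (root g) h \<Longrightarrow> witness_ok g a h'"
    and addr: "\<And>c. c < len g \<Longrightarrow> \<exists>w<bnd g. pl g w = 2 \<and> pl g (pr g w) = c \<and> pr g (pr g w) = h"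
    unfolding group_def h_def by (auto simp: ex_leaf_iff)
  have inj: "inj_on \<sigma> {..<par g}"
  proof (rule inj_onI, rule ccontr)
    fix i j assume ij: "i \<in> {..<par g}" "j \<in> {..<par g}" "\<sigma> i = \<sigma> j" "i \<noteq> j"
    have "\<sigma> i < length C" using Y[of i] ij(1) unfolding \<sigma>_def input_nodes_eq by simp
    then have v: "\<sigma> i < N0" using N0_le(2) by (rule less_le_trans)
    have "i < N0" "j < N0" using ij(1,2) by auto
    note p1 = small_pair[OF this]
    have p2: "prod_encode (\<sigma> i, prod_encode (i, j)) < iterbnd 2 N0"
      "pl g (prod_encode (\<sigma> i, prod_encode (i, j))) = \<sigma> i"
      "pr g (prod_encode (\<sigma> i, prod_encode (i, j))) = prod_encode (i, j)"
      using pair_less[of "\<sigma> i" 0 "prod_encode (i, j)" 1] v p1(1) by (simp_all add: numeral_2_eq_2)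
    \<comment> \<open>This check has no private edge if one input is number \<open>i\<close> and
      number \<open>j\<close>: edges with first component 0 contain \<open>Y i\<close>, all others
      contain \<open>Y j\<close>.\<close>
    define x where "x = prod_encode (3, prod_encode (\<sigma> i, prod_encode (i, j)))"
    have x: "x < bnd g" "pl g x = 3" "pr g x = prod_encode (\<sigma> i, prod_encode (i, j))"
      using pair_less[of 3 0 "prod_encode (\<sigma> i, prod_encode (i, j))" 2] p2(1) unfolding x_def by simp_all
    from excl[of x] x obtain e where e: "\<And>y. y \<in> Z \<Longrightarrow> excludes d g x e y \<Longrightarrow> y = x" by auto
    have "excludes d g x e (Y i) \<or> excludes d g x e (Y j)"
      using Y[of i] Y[of j] ij p1 p2 x unfolding excludes_def \<sigma>_def by auto
    then have "Y i = x \<or> Y j = x" using e Y[of i] Y[of j] ij by blast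
    then show False using Y[of i] Y[of j] ij x by auto
  qed
  define T where "T = \<sigma> ` {..<par g}"
  have T: "T \<subseteq> input_nodes C" unfolding T_def \<sigma>_def using Y by auto
  have card: "card T = par g" unfolding T_def using inj by (simp add: card_image)
  have just: "pl g h' = 1 \<longleftrightarrow> val T a" if ah: "(a, h') \<in> insts d g (root g) h" for a h'
  proof (rule justified_leaf)
    note al = insts_leaves[OF ah]
    show "a < length C" using leaves_less[OF al root_less] .
    show "leaf g a" using shallow_leaves[OF al shallow_root] .
    show "witness_ok g a h'" using wit[OF ah] .
    fix c assume rel: "relevant g a h' c"
    note c = below_leaf[OF al relevant_cases[OF wit[OF ah] rel]]
    \<comment> \<open>The selected \<open>h\<close> need not be of the size of an honest guess; that
      its check of \<open>c\<close> is a vertex comes from the last condition in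
      \<open>group\<close>.\<close>
    obtain w where w: "w < bnd g" "pl g w = 2" "pl g (pr g w) = c" "pr g (pr g w) = h"
      using addr[OF C_le[OF c(1)]] by blast
    have req: "required d g h c" unfolding required_def ex_leaf_iff using ah rel by blast
    from excl[of w] w obtain e where e: "\<And>y. y \<in> Z \<Longrightarrow> excludes d g w e y \<Longrightarrow> y = w" by auto
    \<comment> \<open>A check that is needed cannot use its idle edges: they contain the vertex
      \<open>y\<close> of the guess \<open>h\<close>.\<close>
    have e0: "pl g e \<noteq> 0"
    proof
      assume "pl g e = 0"
      then have "excludes d g w e y" unfolding excludes_def using w y1 req h_def by simp
      then have "y = w" using e y(1) by blast
      then show False using w y1 by simp
    qed
    define \<epsilon> where "\<epsilon> = pr g e"
    have bad: "\<not> bad_guess d g c h \<epsilon>"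
    proof
      assume *: "bad_guess d g c h \<epsilon>"
      obtain b where b: "b < bnd g" "pl g b = 4" using blocker by blast
      then have "b \<in> Z" using Z unfolding forced_def by simp
      moreover have "excludes d g w e b" unfolding excludes_def using w b e0 * \<epsilon>_def by simp
      ultimately have "b = w" using e by blast
      then show False using w b by simp
    qed
    have conf: "\<not> conflicts d g c \<epsilon> (pr g (Y i))" if i: "i < par g" for i
    proof
      assume "conflicts d g c \<epsilon> (pr g (Y i))"
      then have "excludes d g w e (Y i)" unfolding excludes_def using w e0 \<epsilon>_def Y[OF i] by simp
      then have "Y i = w" using e Y[OF i] by blast
      then show False using w Y[OF i] by simp
    qed
    have "guess_value d g c \<epsilon> \<longleftrightarrow> val T c"
    proof (rule guess_value_correct[OF c(1,2)])
      fix v e' assume ve: "(v, e') \<in> insts d g c \<epsilon>"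
      have vC: "v < length C" using leaves_less[OF insts_leaves[OF ve] c(1)] .
      have v0: "kind g v = 0" using c(3)[OF insts_leaves[OF ve]] .
      have "pl g e' = 1 \<longleftrightarrow> v \<in> T"
      proof
        assume e': "pl g e' = 1"
        \<comment> \<open>\<open>bad_guess\<close> rules out other numbers, so \<open>Y\<close>
          provides a selected vertex for this one; that it causes no conflict identifies its input
          as \<open>v\<close>.\<close>
        then have i: "pr g e' < par g" using bad ve unfolding bad_guess_def ex_leaf_iff by force
        then have "\<sigma> (pr g e') = v"
          using conf[OF i] ve e' Y[OF i] unfolding conflicts_def ex_leaf_iff \<sigma>_def by force
        then show "v \<in> T" unfolding T_def using i by auto
      next
        assume "v \<in> T"
        then obtain i where i: "i < par g" "\<sigma> i = v" unfolding T_def by auto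
        show "pl g e' = 1"
          using conf[OF i(1)] ve i(2) unfolding conflicts_def ex_leaf_iff \<sigma>_def by force
      qed
      then show "pl g e' = 1 \<longleftrightarrow> val T v" using val_gate(1)[OF vC v0] by simp
    qed
    moreover have "pl g h' = 1 \<longleftrightarrow> guess_value d g c \<epsilon>"
      using bad ah rel unfolding bad_guess_def ex_leaf_iff by blast
    ultimately show "val T c \<longleftrightarrow> pl g h' = 1" by simp
  qed
  have "val T (root g)"
    using guess_value_correct[OF root_less shallow_root just] h by blast
  then show ?thesis using T card satisfies_iff by blast
qed

lemma selection_if_satisfiable:
  assumes T: "T \<subseteq> input_nodes C" "card T = par g" "satisfies T C"
  shows "\<exists>Z. selection Z"
proof -
  have "finite T" using T(1) by (rule finite_subset) (simp add: input_nodes_def)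
  then obtain \<sigma> where \<sigma>: "bij_betw \<sigma> {..<par g} T"
    using T(2) by (metis ex_bij_betw_nat_finite lessThan_atLeast0)
  have \<sigma>T: "\<sigma> i \<in> T" if "i < par g" for i using \<sigma> that by (auto simp: bij_betw_def)
  have \<sigma>inj: "i = j" if "i < par g" "j < par g" "\<sigma> i = \<sigma> j" for i j
    using \<sigma> that by (auto simp: bij_betw_def inj_on_def)
  have \<sigma>N: "\<sigma> i < N0" if "i < par g" for i
    using \<sigma>T[OF that] T(1) N0_le(2) unfolding input_nodes_def by auto
  let ?OK = "\<lambda>a h. witness_ok g a h \<and> (\<forall>c. relevant g a h c \<longrightarrow> (val T c \<longleftrightarrow> pl g h = 1))"
  have one: "1 \<le> iterbnd 1 N0" using const_less(1)[of 0] by simp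
  \<comment> \<open>Guesses at leaves are pairs already, so the \<open>d\<close> levels of gates
    start from \<open>iterbnd 1 N0\<close>.\<close>
  have iter: "iterbnd l (iterbnd 1 N0) = iterbnd (Suc l) N0" for l
    by (induction l) auto
  have "\<exists>h<iterbnd d (iterbnd 1 N0). \<forall>(a, h')\<in>insts d g (root g) h. ?OK a h'"
  proof (rule guess_exists[OF root_less shallow_root _ one])
    fix v assume v: "v \<in> leaves d g (root g)"
    show "\<exists>h<iterbnd 1 N0. ?OK v h"
      by (rule justified_exists[OF leaves_less[OF v root_less] shallow_leaves[OF v shallow_root]])
  qed (simp only: iter, rule iterbnd_le_bnd, simp)
  then obtain h where h: "h < iterbnd (Suc d) N0" and OK: "\<And>a h'. (a, h') \<in> insts d g (root g) h \<Longrightarrow> ?OK a h'"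
    unfolding iter by blast
  have hval: "guess_value d g (root g) h"
  proof -
    have "guess_value d g (root g) h \<longleftrightarrow> val T (root g)"
    proof (rule guess_value_correct[OF root_less shallow_root])
      fix v e assume ve: "(v, e) \<in> insts d g (root g) h"
      note v = insts_leaves[OF ve]
      show "pl g e = 1 \<longleftrightarrow> val T v"
        by (rule justified_leaf[OF leaves_less[OF v root_less] shallow_leaves[OF v shallow_root]])
          (use OK[OF ve] in blast)+
    qed
    then show ?thesis using T(3) satisfies_iff by blast
  qed
  define y where "y = prod_encode (1, h)"
  have y: "y < bnd g" "pl g y = 1" "pr g y = h"
    using pair_less[of 1 0 h "Suc d"] h unfolding y_def by simp_all
  define Y where "Y i = prod_encode (0, prod_encode (i, \<sigma> i))" for i
  have Y: "Y i < bnd g" "pl g (Y i) = 0" "pl g (pr g (Y i)) = i" "pr g (pr g (Y i)) = \<sigma> i" if i: "i < par g" for i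
  proof -
    have "i < N0" using i by simp
    note p = small_pair[OF this \<sigma>N[OF i]]
    show "Y i < bnd g" "pl g (Y i) = 0" "pl g (pr g (Y i)) = i" "pr g (pr g (Y i)) = \<sigma> i"
      using pair_less[of 0 0 "prod_encode (i, \<sigma> i)" 1] p unfolding Y_def by simp_all
  qed
  define Z where "Z = {x. x < bnd g \<and> forced g x} \<union> Y ` {..<par g} \<union> {y}"
  have Z0: "\<exists>i<par g. x = Y i" if "x \<in> Z" "pl g x = 0" for x
    using that y unfolding Z_def forced_def by auto
  have Z1: "x = y" if "x \<in> Z" "pl g x = 1" for x
    using that Y unfolding Z_def forced_def by auto
  have "\<exists>e<bnd g. \<forall>z\<in>Z. excludes d g x e z \<longrightarrow> z = x" if x: "x < bnd g" "forced g x" for x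
  proof -
    have e0: "0 < bnd g" "pl g 0 = 0"
      using small_pair[of 0 0] by (simp_all add: prod_encode_def zero_less_bnd)
    consider "pl g x = 2" | "pl g x = 3" | "4 \<le> pl g x" using x(2) unfolding forced_def by linarith
    then show ?thesis
    proof cases
      case 1
      define c where "c = pl g (pr g x)"
      show ?thesis
      proof (cases "pr g (pr g x) = h \<and> required d g h c")
        case False
        \<comment> \<open>Edge 0, the code of \<open>(0, 0)\<close>, is private: either the check
          concerns a guess that is not selected, or \<open>h\<close> requires no value of
          \<open>c\<close>.\<close>
        have "\<not> excludes d g x 0 z" if "z \<in> Z" for z
          using False Z1[OF that] y(3) 1 e0 unfolding excludes_def c_def by auto
        then show ?thesis using e0(1) by blast
      next
        case True
        then obtain a h' where ah: "(a, h') \<in> insts d g (root g) h" and rel: "relevant g a h' c"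
          unfolding required_def ex_leaf_iff by blast
        have "witness_ok g a h'" using OK[OF ah] by blast
        note c = below_leaf[OF insts_leaves[OF ah] relevant_cases[OF this rel]]
        \<comment> \<open>For every input in \<open>T\<close> below \<open>c\<close>, the guess
          names the number under which it is selected.\<close>
        let ?V = "\<lambda>v e. (pl g e = 1 \<longleftrightarrow> v \<in> T) \<and> (pl g e = 1 \<longrightarrow> pr g e < par g \<and> \<sigma> (pr g e) = v)"
        have "\<exists>\<epsilon><iterbnd d (iterbnd 1 N0). \<forall>(v, e)\<in>insts d g c \<epsilon>. ?V v e"
        proof (rule guess_exists[OF c(1,2) _ one])
          fix v assume v: "v \<in> leaves d g c"
          show "\<exists>e<iterbnd 1 N0. ?V v e"
          proof (cases "v \<in> T")
            case True
            then obtain i where i: "i < par g" "\<sigma> i = v" using \<sigma> by (auto simp: bij_betw_def)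
            then show ?thesis using small_pair[of 1 i] True by (intro exI[of _ "prod_encode (1, i)"]) simp
          next
            case False
            then show ?thesis using small_pair[of 0 0] by (intro exI[of _ "prod_encode (0, 0)"]) simp
          qed
        qed (simp only: iter, rule iterbnd_le_bnd, simp)
        then obtain \<epsilon> where \<epsilon>: "\<epsilon> < iterbnd (Suc d) N0" and V: "\<And>v e. (v, e) \<in> insts d g c \<epsilon> \<Longrightarrow> ?V v e"
          unfolding iter by blast
        define e where "e = prod_encode (1, \<epsilon>)"
        have e: "e < bnd g" "pl g e = 1" "pr g e = \<epsilon>"
          using pair_less[of 1 0 \<epsilon> "Suc d"] \<epsilon> unfolding e_def by simp_all
        have gv: "guess_value d g c \<epsilon> \<longleftrightarrow> val T c"
        proof (rule guess_value_correct[OF c(1,2)])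
          fix v e' assume ve: "(v, e') \<in> insts d g c \<epsilon>"
          note v = insts_leaves[OF ve]
          show "pl g e' = 1 \<longleftrightarrow> val T v"
            using V[OF ve] val_gate(1)[OF leaves_less[OF v c(1)] c(3)[OF v]] by simp
        qed
        have "\<not> bad_guess d g c h \<epsilon>"
        proof
          assume "bad_guess d g c h \<epsilon>"
          then show False
            unfolding bad_guess_def ex_leaf_iff gv using V OK by fastforce
        qed
        moreover have "\<not> conflicts d g c \<epsilon> (pr g (Y i))" if i: "i < par g" for i
        proof
          assume "conflicts d g c \<epsilon> (pr g (Y i))"
          then obtain v e' where ve: "(v, e') \<in> insts d g c \<epsilon>"
            "if pl g e' = 1 then i = pr g e' \<and> \<sigma> i \<noteq> v else \<sigma> i = v"
            unfolding conflicts_def ex_leaf_iff Y[OF i] by blast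
          then show False using V[OF ve(1)] \<sigma>T[OF i] by (auto split: if_splits)
        qed
        ultimately have "\<not> excludes d g x e z" if "z \<in> Z" for z
          using 1 True e Z0[OF that] unfolding excludes_def c_def[symmetric] by auto
        then show ?thesis using e(1) by blast
      qed
    next
      case 2
      define v i j where "v = pl g (pr g x)" and "i = pl g (pr g (pr g x))" and "j = pr g (pr g (pr g x))"
      have *: "\<not> excludes d g x e z"
        if z: "z \<in> Z" and not: "\<not> (if pl g e = 0 then i < par g \<and> \<sigma> i = v \<and> i \<noteq> j else j < par g \<and> \<sigma> j = v \<and> i \<noteq> j)" for e z
      proof
        assume ex: "excludes d g x e z"
        then have "pl g z = 0" using 2 unfolding excludes_def by simp
        then obtain i' where "i' < par g" "z = Y i'" using Z0[OF z] by blast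
        then show False using ex not 2 Y[of i'] unfolding excludes_def v_def i_def j_def by (cases "pl g e = 0") auto
      qed
      show ?thesis
      proof (cases "i < par g \<and> \<sigma> i = v \<and> i \<noteq> j")
        case False
        then show ?thesis using *[of _ 0] e0 by auto
      next
        case True
        \<comment> \<open>If \<open>v\<close> is number \<open>i\<close>, edge 0 is hit. But then,
          by injectivity of \<open>\<sigma>\<close>, \<open>v\<close> is not number
          \<open>j\<close>, and the edge \<open>(1, 0)\<close> is private.\<close>
        then have "\<not> (j < par g \<and> \<sigma> j = v \<and> i \<noteq> j)" using \<sigma>inj[of i j] by blast
        then show ?thesis using *[of _ "prod_encode (1, 0)"] small_pair[of 1 0] by auto
      qed
    next
      case 3
      then show ?thesis using e0(1) unfolding excludes_def by auto
    qed
  qed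
  moreover have "\<exists>z\<in>Z. group d g i z" if "i < Suc (par g)" for i
  proof (cases "i < par g")
    case True
    then have "group d g i (Y i)"
      using Y[OF True] \<sigma>T[OF True] T(1) input_nodes_eq ngates unfolding group_def by auto
    then show ?thesis using True unfolding Z_def by blast
  next
    case False
    \<comment> \<open>The honest guess is small enough for two more levels of pairs; here the full
      \<open>d + 3\<close> levels are used.\<close>
    have "\<exists>w<bnd g. pl g w = 2 \<and> pl g (pr g w) = c \<and> pr g (pr g w) = h" if c: "c < len g" for c
    proof -
      have p: "prod_encode (c, h) < iterbnd (Suc (Suc d)) N0" "pl g (prod_encode (c, h)) = c"
        "pr g (prod_encode (c, h)) = h"
        using pair_less[of c 0 h "Suc d"] c h by simp_all
      show ?thesis
        using pair_less[of 2 0 "prod_encode (c, h)" "Suc (Suc d)"] p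
        by (intro exI[of _ "prod_encode (2, prod_encode (c, h))"]) simp
    qed
    then have "group d g i y"
      using False y hval OK wf depth weft valid_iff unfolding group_def ex_leaf_iff by auto
    then show ?thesis unfolding Z_def by blast
  qed
  moreover have "Z \<subseteq> {..<bnd g}" unfolding Z_def using Y y by auto
  ultimately have "selection Z" unfolding Z_def by blast
  then show ?thesis by blast
qed

end


section \<open>The reduction\<close>

text \<open>The gadget needs a forced vertex for every input string, including those that encode no
  circuit. The vertex 14 is the pair \<open>(4, 0)\<close>.\<close>

lemma forced_blocker: "15 \<le> bnd g \<Longrightarrow> \<exists>x<bnd g. forced g x"
proof -
  assume "15 \<le> bnd g"
  moreover have "prod_encode (4, 0) = 14" by (simp add: prod_encode_def eval_nat_numeral)
  ultimately have "14 < bnd g" "pl g 14 = 4" using pl_pair[of 4 0 g] by auto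
  then show ?thesis unfolding forced_def by (intro exI[of _ 14]) simp
qed

abbreviation ctx_of :: "nat \<Rightarrow> bool list \<Rightarrow> nat \<Rightarrow> ctx" where
  "ctx_of d x k \<equiv> (x, k, bound_of (d + 3) x k)"

lemma ctx_of_bound: "15 \<le> bnd (ctx_of d x k)"
proof -
  have "4 * 4 * 4 \<le> 4 * (length x + k + 4) * (length x + k + 4)" by (intro mult_mono) auto
  then have "15 \<le> iterbnd 1 (length x + k + 4)" by simp
  also have "\<dots> \<le> bound_of (d + 3) x k" by (rule iterbnd_le) auto
  finally show ?thesis by simp
qed

text \<open>A selection hits the last set, which has elements only if the string passes the test
  \<open>valid\<close>. So the circuit can be recovered from the mere existence of a
  selection.\<close>

lemma WCS_iff_selection:
  "(x, k) \<in> WCS 1 d \<longleftrightarrow> (\<exists>Z\<subseteq>{..<bnd (ctx_of d x k)}.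
     (\<forall>y<bnd (ctx_of d x k). forced (ctx_of d x k) y \<longrightarrow> y \<in> Z \<and>
       (\<exists>e<bnd (ctx_of d x k). \<forall>z\<in>Z. excludes d (ctx_of d x k) y e z \<longrightarrow> z = y)) \<and>
     (\<forall>i<Suc k. \<exists>y\<in>Z. group d (ctx_of d x k) i y))"
    (is "_ \<longleftrightarrow> (\<exists>Z\<subseteq>_. ?S Z)")
proof
  let ?g = "ctx_of d x k"
  assume "(x, k) \<in> WCS 1 d"
  then obtain C S where C: "x = encode_circuit C" "wf_circuit C" "weft_le 1 C" "depth_le d C"
    and S: "S \<subseteq> input_nodes C" "card S = k" "satisfies S C" unfolding WCS_def by blast
  interpret valid_instance ?g C d
    by unfold_locales (use C in simp_all)
  show "\<exists>Z\<subseteq>{..<bnd ?g}. ?S Z"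
    using selection_if_satisfiable[of S] S by auto
next
  let ?g = "ctx_of d x k"
  assume "\<exists>Z\<subseteq>{..<bnd ?g}. ?S Z"
  then obtain Z where Z: "Z \<subseteq> {..<bnd ?g}" "?S Z" by blast
  then obtain y where "group d ?g k y" by blast
  then have valid: "valid d ?g" unfolding group_def by simp
  then obtain C where C: "inp ?g = encode_circuit C" using wf_code_exists unfolding valid_def by blast
  interpret encoded ?g C by unfold_locales (rule C)
  have *: "wf_circuit C" "depth_le d C" "weft_le 1 C" using valid valid_iff by blast+
  interpret valid_instance ?g C d by unfold_locales (use * in simp_all)
  obtain T where "T \<subseteq> input_nodes C" "card T = k" "satisfies T C"
    using satisfiable_if_selection[of Z] Z by auto
  then show "(x, k) \<in> WCS 1 d" unfolding WCS_def using C * by auto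
qed

section \<open>Writing the instance\<close>

abbreviation "nvertices g \<equiv> gadget_data.nverts (bnd g) (bnd g)"
abbreviation "nhyperedges g \<equiv> gadget_data.nedges (bnd g) (bnd g) (Suc (par g))"
abbreviation "incident d g \<equiv> gadget_data.inc (bnd g) (bnd g) (Suc (par g)) (group d g) (excludes d g)"
abbreviation "own_edge g \<equiv> gadget_data.\<tau> (bnd g) (Suc (par g))"
abbreviation "demand g \<equiv> gadget_data.f (bnd g) (forced g)"

lemmas nvertices_def = gadget_data.nverts_def and nhyperedges_def = gadget_data.nedges_def
  and incident_def = gadget_data.inc_def and own_edge_def = gadget_data.\<tau>_def and demand_def = gadget_data.f_def

definition instance_nats :: "nat \<Rightarrow> ctx \<Rightarrow> nat list" where
  "instance_nats d g = [nvertices g] @ [nhyperedges g] @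
     concat (map (\<lambda>i. map (\<lambda>y. of_bool (incident d g i y)) [0..<nvertices g]) [0..<nhyperedges g]) @
     map (own_edge g) [0..<nvertices g] @ map (demand g) [0..<nvertices g]"

lemma feas_Suc: "feas r F \<Longrightarrow> feas r (\<lambda>g w. Suc (F g w))"
  using feas_add[OF feas_const[of r 1], of F] by simp

lemma small_Suc: "small F \<Longrightarrow> small (\<lambda>g w. Suc (F g w))"
  using small_add[OF small_const[of 1], of F] by simp

lemma small_nvertices: "small (\<lambda>g w. nvertices g)"
  unfolding nvertices_def by (intro small_intros)

lemma small_nhyperedges: "small (\<lambda>g w. nhyperedges g)"
  unfolding nhyperedges_def by (intro small_intros small_Suc)

lemma feas_nvertices: "feas r (\<lambda>g w. nvertices g)"
  unfolding nvertices_def by (intro feas_basic feas_mult)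

lemma feas_nhyperedges: "feas r (\<lambda>g w. nhyperedges g)"
  unfolding nhyperedges_def by (intro feas_basic feas_mult feas_Suc)

lemma feasp_incident: "feas r A \<Longrightarrow> feas r B \<Longrightarrow> feasp r (\<lambda>g w. incident d g (A g w) (B g w))"
proof -
  assume A: "feas r A" and B: "feas r B"
  have True: "feasp r (\<lambda>g w. True)" using feas_const[of r 1] by simp
  \<comment> \<open>\<open>feas_mult\<close> wants its small factor first, and a variable has no
    bound, so the product is formed with \<open>bnd g\<close> in front and then commuted.\<close>
  have *: "feas (Suc (Suc r)) (\<lambda>g w. hd (tl w) * bnd g)"
    by (rule feas_cong[OF feas_mult[OF feas_bnd small_bnd feas_tl[OF feas_hd]]]) (rule mult.commute)
  show ?thesis
    unfolding incident_def
    by (intro feasp_if feasp_conj feasp_disj feasp_less feasp_le feasp_eq feasp_ex feas_add feas_sub feas_Suc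
        feasp_group feasp_excludes True * feas_bnd feas_par small_bnd feas_tl[OF A] feas_tl[OF B]
        feas_tl[OF feas_tl[OF A]] feas_tl[OF feas_tl[OF B]] A B feas_hd feas_tl[OF feas_hd])
qed

lemma feas_own_edge: "feas r A \<Longrightarrow> feas r (\<lambda>g w. own_edge g (A g w))"
  unfolding own_edge_def by (intro feas_basic feas_Suc)

lemma own_edge_le: "y < nvertices g \<Longrightarrow> own_edge g y \<le> nhyperedges g"
  unfolding own_edge_def nvertices_def nhyperedges_def by (simp, arith)

lemma feas_demand: "feas r A \<Longrightarrow> feas r (\<lambda>g w. demand g (A g w))"
  unfolding demand_def by (intro feas_basic feasp_forced)

lemma outp_instance: "outp 0 (\<lambda>g w. instance_nats d g)"
  unfolding instance_nats_def
proof (intro outp_append outp_num feas_nvertices feas_nhyperedges small_nvertices small_nhyperedges)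
  show "outp 0 (\<lambda>g w. concat (map (\<lambda>i. map (\<lambda>y. of_bool (incident d g i y)) [0..<nvertices g]) [0..<nhyperedges g]))"
    by (rule outp_concat[OF feas_nhyperedges small_nhyperedges], rule outp_map[where V = "\<lambda>g w. 1"])
      (intro feas_nvertices small_nvertices feasp_incident feas_hd feas_tl small_const feas_const | simp)+
  show "outp 0 (\<lambda>g w. map (own_edge g) [0..<nvertices g])"
    by (rule outp_map[where V = "\<lambda>g w. nhyperedges g"])
      (intro feas_nvertices small_nvertices feas_own_edge feas_hd small_nhyperedges feas_nhyperedges own_edge_le
        | assumption)+
  show "outp 0 (\<lambda>g w. map (demand g) [0..<nvertices g])"
    by (rule outp_map[where V = "\<lambda>g w. 2"])
      (intro feas_nvertices small_nvertices feas_demand feas_hd small_const feas_const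
        | simp add: demand_def)+
qed

lemma reduction_correct:
  "(x, k) \<in> WCS 1 d \<longleftrightarrow> (encode_nats (instance_nats d (ctx_of d x k)), Suc k) \<in> ExtensionRHF_kappa1"
proof -
  define g where "g = ctx_of d x k"
  have par: "par g = k" and bound: "15 \<le> bnd g"
    using ctx_of_bound[of x k d] by (simp_all add: g_def)
  note WCS = WCS_iff_selection[of x k d, folded g_def]
  interpret gadget "bnd g" "bnd g" "Suc (par g)" "forced g" "group d g" "excludes d g"
  proof
    show "\<exists>x<bnd g. forced g x" by (rule forced_blocker[OF bound])
    show "0 < bnd g" using bound by simp
    show "\<not> group d g i y" if "forced g y" for i y
      using that unfolding forced_def group_def by auto
    show "forced g y" if "excludes d g y e z" for y e z
      using that unfolding forced_def excludes_def by auto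
  qed
  have "map (\<lambda>y. of_bool (y \<in> edge i) :: nat) [0..<nverts] = map (\<lambda>y. of_bool (incident d g i y)) [0..<nverts]" for i
    unfolding edge_def by (intro map_cong) auto
  then have "encode_instance nverts nedges edge \<tau> f = encode_nats (instance_nats d g)"
    unfolding encode_instance_def instance_nats_def by (simp only: append.simps)
  then show ?thesis
    using encode_instance_in_ExtensionRHF[OF hypergraph correspondence f_range kappa1[symmetric]]
      ext_rhf_iff WCS unfolding par g_def[symmetric] by simp
qed

theorem theorem15: "W_hard 1 ExtensionRHF_kappa1"
proof -
  have "fpt_reducible (WCS 1 d) ExtensionRHF_kappa1" for d
    by (rule fpt_reducibleI[OF outp_instance reduction_correct])
  then show ?thesis
    unfolding W_hard_def W_class_def using fpt_reducible_trans by blast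
qed

end
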